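(* Let $\sigma,\tau>0$, $v\in C^\infty(\mathbb T^n,{\mathbb R}^n)$, let $(x(t),y(t))$ be the diffusion on $\mathbb T^n\times{\mathbb R}^n$ described in the context, and let $\mu$ be its invariant probability measure. Let $\psi:\mathbb T^n\times{\mathbb R}^n\to{\mathbb R}$ be measurable with $$\sup_{x\in\mathbb T^n,\,y\in{\mathbb R}^n}\Big|\psi(x,y)\exp\Big(-\tfrac14\|\sigma^{-1}y\|^2\Big)\Big|<\infty.$$ Then there exist constants $C,\delta>0$ such that for every initial condition $(x(0),y(0))$ and every $t\ge0$, $$\mathbf E\,\psi(x(t),y(t))-\int_{\mathbb T^n\times{\mathbb R}^n}\psi\,d\mu\le C\exp\big(\|\sigma^{-1}y(0)\|^2-\delta t\big).$$
   Context: The diffusion solves $dx=\tau^{-1/2}y\,dt$, $dy=\tau^{-1/2}v(x)\,dt-\tau^{-1}y\,dt+\sigma\tau^{-1/2}d\beta(t)$ with $\beta$ a standard $n$-dimensional Brownian motion and $x$ taken modulo $1$; its generator is $\mathcal L=\tau^{-1/2}(y\cdot\nabla_x+v(x)\cdot\nabla_y)+\tau^{-1}(-y\cdot\nabla_y+\frac{\sigma^2}{2}\Delta_y)$, and it has a unique invariant probability measure $\mu$. *)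

theory Defs
  imports "HOL-Probability.Probability"
begin

type_synonym ('n) state = "(real ^ ('n::finite)) \<times> (real ^ 'n)"

coinductive smooth_fun :: "('a::real_normed_vector \<Rightarrow> 'b::real_normed_vector) \<Rightarrow> bool" where
  "(\<And>x. (f has_derivative f' x) (at x)) \<Longrightarrow> (\<And>u. smooth_fun (\<lambda>x. f' x u)) \<Longrightarrow> smooth_fun f"

definition test_fun :: "('a::real_normed_vector \<Rightarrow> real) \<Rightarrow> bool" where
  "test_fun f \<longleftrightarrow> smooth_fun f \<and> compact (closure {z. f z \<noteq> 0})"

definition int_vec :: "real ^ 'n \<Rightarrow> bool" where
  "int_vec k \<longleftrightarrow> (\<forall>i. k $ i \<in> \<int>)"

definition periodic_x :: "(('n::finite) state \<Rightarrow> 'b) \<Rightarrow> bool" where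
  "periodic_x f \<longleftrightarrow> (\<forall>x y k. int_vec k \<longrightarrow> f (x + k, y) = f (x, y))"

definition fund_dom :: "('n::finite) state set" where
  "fund_dom = {x. \<forall>i. 0 \<le> x $ i \<and> x $ i < 1} \<times> UNIV"

definition gen :: "real \<Rightarrow> real \<Rightarrow> (real ^ ('n::finite) \<Rightarrow> real ^ 'n) \<Rightarrow> ('n state \<Rightarrow> real) \<Rightarrow> 'n state \<Rightarrow> real" where
  "gen \<sigma> \<tau> v f z =
     (let x = fst z; y = snd z; Df = (\<lambda>w. frechet_derivative f (at w)) in
      (1 / sqrt \<tau>) * (Df z (y, 0) + Df z (0, v x))
      + (1 / \<tau>) * (- Df z (0, y)
          + \<sigma>\<^sup>2 / 2 * (\<Sum>i\<in>(Basis :: (real^'n) set).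
               frechet_derivative (\<lambda>w. Df w (0, i)) (at z) (0, i))))"

text \<open>K t z is the law at time t of the (lifted to R^n x R^n) diffusion started at z:
  probability measures on the Borel sets with K 0 z the Dirac mass and satisfying the
  Kolmogorov equation  int f dK_t = f(z) + int_0^t int L f dK_s ds  for all test functions f
  (equivalently, the one-dimensional marginals of the unique solution of the martingale
  problem / SDE).\<close>
definition diffusion_law :: "real \<Rightarrow> real \<Rightarrow> (real ^ ('n::finite) \<Rightarrow> real ^ 'n)
     \<Rightarrow> (real \<Rightarrow> 'n state \<Rightarrow> 'n state measure) \<Rightarrow> bool" where
  "diffusion_law \<sigma> \<tau> v K \<longleftrightarrow>
     (\<forall>t z. 0 \<le> t \<longrightarrow> prob_space (K t z) \<and> sets (K t z) = sets borel) \<and>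
     (\<forall>t. 0 \<le> t \<longrightarrow> K t \<in> borel \<rightarrow>\<^sub>M prob_algebra borel) \<and>
     (\<forall>z. K 0 z = return borel z) \<and>
     (\<forall>f z t. test_fun f \<longrightarrow> 0 \<le> t \<longrightarrow>
        ((\<lambda>s. \<integral>w. gen \<sigma> \<tau> v f w \<partial>K s z) has_integral
           ((\<integral>w. f w \<partial>K t z) - f z)) {0..t})"

text \<open>mu (a probability measure on the fundamental domain, i.e. on T^n x R^n) is invariant:
  int (int f dK_t(z)) dmu(z) = int f dmu for bounded measurable f periodic in x.\<close>
definition invariant_prob :: "(real \<Rightarrow> ('n::finite) state \<Rightarrow> 'n state measure) \<Rightarrow> 'n state measure \<Rightarrow> bool" where
  "invariant_prob K \<mu> \<longleftrightarrow>
     prob_space \<mu> \<and> sets \<mu> = sets borel \<and> emeasure \<mu> fund_dom = 1 \<and>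
     (\<forall>(f :: 'n state \<Rightarrow> real) t. f \<in> borel_measurable borel \<longrightarrow> bounded (range f) \<longrightarrow> periodic_x f \<longrightarrow> 0 \<le> t \<longrightarrow>
        (\<integral>z. (\<integral>w. f w \<partial>K t z) \<partial>\<mu>) = (\<integral>z. f z \<partial>\<mu>))"

end

theory Submission
  imports Defs
begin

text \<open>
  Write \<open>L\<close> for the generator, \<open>b = v / sqrt \<tau>\<close> for the bounded part of the drift, and \<open>G\<^sub>t\<close> for the explicit
  Gaussian semigroup obtained by dropping \<open>v\<close>. For a trigonometric polynomial \<open>f\<close> the function \<open>u\<^sub>s = G\<^sub>t\<^sub>-\<^sub>s f\<close> is an
  explicit sum of plane waves with \<open>(\<partial>\<^sub>s + L) u = b \<cdot> \<nabla>\<^sub>y u\<close>, while \<open>(\<partial>\<^sub>s + L) u\<^sup>2\<close> gains the term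
  \<open>(\<sigma>\<^sup>2 / \<tau>) |\<nabla>\<^sub>y u|\<^sup>2\<close>, which absorbs the drift. This has two consequences. First, if \<open>\<nu>\<close> is the difference of
  two solutions of the Kolmogorov equation with the same initial law and \<open>M\<close> is their sum, an inequality
  \<open>\<nu>\<^sub>s(g)\<^sup>2 \<le> D M\<^sub>s(g\<^sup>2)\<close> valid on a short time interval improves to \<open>D / 2\<close>; hence solutions are unique, and the
  kernels form a Markov semigroup commuting with integer translations of \<open>x\<close>. Second,
  \<open>(G\<^sub>t f)\<^sup>2 \<le> exp (c t) K\<^sub>t(f\<^sup>2)\<close>. Since \<open>G\<^sub>t\<close> has a density bounded below on compact sets, applying this to \<open>f\<close> and
  \<open>1 - f\<close> shows that any two transition probabilities started with bounded \<open>y\<close> overlap by a fixed amount.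
  Together with the Lyapunov function \<open>exp (|y|\<^sup>2 / (4 \<sigma>\<^sup>2))\<close>, Harris' theorem gives exponential convergence.
\<close>

section \<open>Smooth functions\<close>

text \<open>\<open>diffusion_law\<close> only provides one-dimensional marginals tested against
  compactly supported smooth functions: no paths, no Markov property, no moments, no smoothing.
  Hence uniqueness comes early, and explicit solutions replace change of measure and hypoelliptic
  theory. Plane waves fit because the coefficients without \<open>v\<close> are linear: a wave stays
  a wave while its frequency follows an ODE. As waves lack compact support, the Kolmogorov equation
  must first be extended to suitable bounded observables. The drift \<open>v\<close> acts only in
  the y-directions, which are exactly the noisy ones; this is why the carre du champ can control it
  although the diffusion is degenerate. Only squares produce that term, hence the quadratic
  estimates; in the overlap estimate the loss is harmless since f^2 is at most f for f between 0 and
  1. The Lyapunov weight is the one in the hypothesis on \<psi>. Its square, exp(|y|^2 / (2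
  \<sigma>^2)), is still below the Gaussian threshold exp(|y|^2 / \<sigma>^2), and this room pays
  for truncating the weight.\<close>

lemma smooth_funD:
  assumes "smooth_fun f"
  shows smooth_fun_has_derivative: "(f has_derivative frechet_derivative f (at x)) (at x)"
    and smooth_fun_frechet: "smooth_fun (\<lambda>x. frechet_derivative f (at x) u)"
proof -
  from assms obtain f' where f': "\<And>x. (f has_derivative f' x) (at x)" "\<And>u. smooth_fun (\<lambda>x. f' x u)"
    by (cases rule: smooth_fun.cases) auto
  have "f' = (\<lambda>x. frechet_derivative f (at x))"
    using f'(1) frechet_derivative_at by blast
  with f' show "(f has_derivative frechet_derivative f (at x)) (at x)"
    "smooth_fun (\<lambda>x. frechet_derivative f (at x) u)" by auto
qed

lemma smooth_fun_continuous: "smooth_fun f \<Longrightarrow> continuous_on S f"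
  by (meson continuous_at_imp_continuous_on has_derivative_continuous smooth_fun_has_derivative)

lemma smooth_fun_const: "smooth_fun (\<lambda>x. c)"
proof (coinduction arbitrary: c)
  case smooth_fun
  show ?case by (rule exI[of _ "\<lambda>x. c"], rule exI[of _ "\<lambda>x u. 0"]) auto
qed

lemma smooth_fun_bounded_linear: "bounded_linear f \<Longrightarrow> smooth_fun f"
  by (rule smooth_fun.intros[of f "\<lambda>x. f"])
    (auto intro: bounded_linear_imp_has_derivative smooth_fun_const)

lemma smooth_fun_translate:
  assumes "smooth_fun f" shows "smooth_fun (\<lambda>x. f (x + a))"
  using assms
proof (coinduction arbitrary: f)
  case smooth_fun
  have "((\<lambda>x. f (x + a)) has_derivative frechet_derivative f (at (x + a))) (at x)" for x
    using has_derivative_compose[OF _ smooth_fun_has_derivative[OF smooth_fun], of "\<lambda>x. x + a" "\<lambda>x. x" x UNIV]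
    by (simp add: has_derivative_add_const)
  then show ?case
    apply (intro exI[of _ "\<lambda>x. f (x + a)"] exI[of _ "\<lambda>x. frechet_derivative f (at (x + a))"])
    using smooth_fun_frechet[OF smooth_fun] by auto
qed

text \<open>Coinduction needs an invariant stable under differentiation, so the smooth functions are closed under all
  operations at once.\<close>

inductive smooth_alg :: "('a::real_normed_vector \<Rightarrow> real) \<Rightarrow> bool" where
  base: "smooth_fun f \<Longrightarrow> smooth_alg f"
| add: "smooth_alg f \<Longrightarrow> smooth_alg g \<Longrightarrow> smooth_alg (\<lambda>x. f x + g x)"
| mult: "smooth_alg f \<Longrightarrow> smooth_alg g \<Longrightarrow> smooth_alg (\<lambda>x. f x * g x)"
| comp: "smooth_fun (\<phi> :: real \<Rightarrow> real) \<Longrightarrow> smooth_alg f \<Longrightarrow> smooth_alg (\<lambda>x. \<phi> (f x))"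
| inv: "smooth_alg f \<Longrightarrow> (\<And>x. f x \<noteq> 0) \<Longrightarrow> smooth_alg (\<lambda>x. inverse (f x))"

lemma smooth_alg_derivative:
  assumes "smooth_alg f"
  shows "\<exists>f'. (\<forall>x. (f has_derivative f' x) (at x)) \<and> (\<forall>u. smooth_alg (\<lambda>x. f' x u))"
  using assms
proof induction
  case (base f)
  then show ?case
    by (intro exI[of _ "\<lambda>x. frechet_derivative f (at x)"])
      (auto intro: smooth_funD smooth_alg.base)
next
  case (add f g)
  then obtain f' g' where
    "\<And>x. (f has_derivative f' x) (at x)" "\<And>u. smooth_alg (\<lambda>x. f' x u)"
    "\<And>x. (g has_derivative g' x) (at x)" "\<And>u. smooth_alg (\<lambda>x. g' x u)" by blast
  then show ?case
    by (intro exI[of _ "\<lambda>x u. f' x u + g' x u"]) (simp add: has_derivative_add smooth_alg.add)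
next
  case (mult f g)
  then obtain f' g' where
    "\<And>x. (f has_derivative f' x) (at x)" "\<And>u. smooth_alg (\<lambda>x. f' x u)"
    "\<And>x. (g has_derivative g' x) (at x)" "\<And>u. smooth_alg (\<lambda>x. g' x u)" by blast
  with mult.hyps show ?case
    by (intro exI[of _ "\<lambda>x u. f x * g' x u + f' x u * g x"])
      (simp add: has_derivative_mult smooth_alg.add smooth_alg.mult)
next
  case (comp \<phi> f)
  then obtain f' where
    f': "\<And>x. (f has_derivative f' x) (at x)" "\<And>u. smooth_alg (\<lambda>x. f' x u)" by blast
  let ?d = "\<lambda>r. frechet_derivative \<phi> (at r) 1"
  have lin: "frechet_derivative \<phi> (at r) h = h * ?d r" for r h
    using linear_scale[OF has_derivative_linear[OF smooth_fun_has_derivative[OF comp(1), of r]], of h 1]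
    by simp
  have "((\<lambda>x. \<phi> (f x)) has_derivative (\<lambda>u. f' x u * ?d (f x))) (at x)" for x
    using has_derivative_compose[OF f'(1) smooth_fun_has_derivative[OF comp(1)], of x]
    by (subst (asm) lin) auto
  moreover have "smooth_alg (\<lambda>x. f' x u * ?d (f x))" for u
    using f'(2) smooth_alg.comp[OF smooth_fun_frechet[OF comp(1)] comp.hyps(2)]
    by (intro smooth_alg.mult)
  ultimately show ?case by (intro exI[of _ "\<lambda>x u. f' x u * ?d (f x)"]) auto
next
  case (inv f)
  then obtain f' where
    f': "\<And>x. (f has_derivative f' x) (at x)" "\<And>u. smooth_alg (\<lambda>x. f' x u)" by blast
  let ?D = "\<lambda>x u. (- 1) * (inverse (f x) * f' x u * inverse (f x))"
  have "((\<lambda>x. inverse (f x)) has_derivative ?D x) (at x)" for x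
    using Deriv.has_derivative_inverse[OF inv(2) f'(1), of x] by simp
  moreover have "smooth_alg (\<lambda>x. ?D x u)" for u
    using smooth_alg.inv[OF inv(1,2)] f'(2)
    by (intro smooth_alg.mult smooth_alg.base[OF smooth_fun_const]) auto
  ultimately show ?case by (intro exI[of _ ?D]) auto
qed

lemma smooth_alg_iff: "smooth_alg f \<longleftrightarrow> smooth_fun f"
proof
  assume "smooth_alg f"
  then show "smooth_fun f"
  proof (coinduction arbitrary: f)
    case smooth_fun
    from smooth_alg_derivative[OF this] show ?case by blast
  qed
qed (rule smooth_alg.base)

lemmas smooth_fun_add = smooth_alg.add[unfolded smooth_alg_iff]
  and smooth_fun_mult = smooth_alg.mult[unfolded smooth_alg_iff]
  and smooth_fun_comp = smooth_alg.comp[unfolded smooth_alg_iff]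
  and smooth_fun_inverse = smooth_alg.inv[unfolded smooth_alg_iff]

lemma smooth_fun_sum:
  assumes "\<And>i. i \<in> I \<Longrightarrow> smooth_fun (f i :: _ \<Rightarrow> real)"
  shows "smooth_fun (\<lambda>x. \<Sum>i\<in>I. f i x)"
  using assms
  by (induction I rule: infinite_finite_induct) (auto intro: smooth_fun_const smooth_fun_add)

lemma smooth_fun_real_polynomial_function: "real_polynomial_function p \<Longrightarrow> smooth_fun p"
  by (induction rule: real_polynomial_function.induct)
    (auto intro: smooth_fun_const smooth_fun_add smooth_fun_mult smooth_fun_bounded_linear)

section \<open>Elementary smooth functions: exponential, cosine and a function flat at 0\<close>

lemma smooth_fun_exp: "smooth_fun (exp :: real \<Rightarrow> real)"
proof -
  \<comment> \<open>The factor \<open>c\<close> makes the family closed under directional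
    derivatives, which only replace \<open>c\<close> by \<open>c * u\<close>; this is the
    coinduction invariant.\<close>
  have "smooth_fun (\<lambda>x. c * exp x :: real)" for c
  proof (coinduction arbitrary: c)
    case smooth_fun
    show ?case
      by (rule exI[of _ "\<lambda>x. c * exp x"], rule exI[of _ "\<lambda>x u. c * u * exp x"])
        (auto intro!: derivative_eq_intros)
  qed
  from this[of 1] show ?thesis by simp
qed

lemma smooth_fun_cos: "smooth_fun (cos :: real \<Rightarrow> real)"
proof -
  \<comment> \<open>With a free phase the derivative stays in the family: a negative sine is a
    cosine shifted by a quarter period.\<close>
  have "smooth_fun (\<lambda>x. c * cos (x + a) :: real)" for c a
  proof (coinduction arbitrary: c a)
    case smooth_fun
    have *: "- sin x = cos (x + pi/2)" for x :: real by (simp add: cos_add)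
    have "((\<lambda>x. c * cos (x + a)) has_derivative (\<lambda>u. (c * u) * cos (x + (a + pi/2)))) (at x)" for x
      by (auto intro!: derivative_eq_intros simp: *[symmetric] add.assoc[symmetric])
    then show ?case
      by (intro exI[of _ "\<lambda>x. c * cos (x + a)"] exI[of _ "\<lambda>x u. (c * u) * cos (x + (a + pi/2))"]) blast
  qed
  from this[of 1 0] show ?thesis by simp
qed

text \<open>The classical function exp(-1/r) extended by 0, with a polynomial in 1/r as a factor so
  that the family is closed under differentiation. The instance \<open>p = 1\<close> builds the
  cutoff functions.\<close>

definition flat_exp :: "real poly \<Rightarrow> real \<Rightarrow> real" where
  "flat_exp p r = (if r \<le> 0 then 0 else poly p (1 / r) * exp (- (1 / r)))"

lemma poly_times_exp_neg_tendsto_0: "((\<lambda>x. poly p x * exp (- x)) \<longlongrightarrow> (0::real)) at_top"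
proof -
  have "((\<lambda>x. \<Sum>i\<le>degree p. coeff p i * (x ^ i / exp x)) \<longlongrightarrow> (\<Sum>i\<le>degree p. coeff p i * 0)) at_top"
    by (intro tendsto_intros tendsto_power_div_exp_0)
  then show ?thesis
    by (simp add: poly_altdef sum_distrib_right exp_minus divide_inverse mult.assoc)
qed

lemma flat_exp_tendsto_0: "(flat_exp p \<longlongrightarrow> 0) (at 0)"
proof -
  have "((\<lambda>r. poly p (inverse r) * exp (- inverse r)) \<longlongrightarrow> 0) (at_right 0)"
    by (rule filterlim_compose[OF poly_times_exp_neg_tendsto_0 filterlim_inverse_at_top_right])
  then have "(flat_exp p \<longlongrightarrow> 0) (at_right 0)"
    by (rule Lim_transform_eventually)
      (auto simp: flat_exp_def eventually_at_filter inverse_eq_divide)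
  moreover have "((\<lambda>_. 0::real) \<longlongrightarrow> 0) (at_left 0)" by simp
  then have "(flat_exp p \<longlongrightarrow> 0) (at_left 0)"
    by (rule Lim_transform_eventually) (auto simp: flat_exp_def eventually_at_filter)
  ultimately show ?thesis by (simp add: filterlim_split_at)
qed

text \<open>With x = 1/r, the derivative of p(x) exp(-x) in r is x^2 (p(x) - p'(x)) exp(-x).\<close>

definition flat_exp_deriv :: "real poly \<Rightarrow> real poly" where
  "flat_exp_deriv p = [:0, 0, 1:] * (p - pderiv p)"

lemma flat_exp_has_derivative: "(flat_exp p has_field_derivative flat_exp (flat_exp_deriv p) r) (at r)"
proof -
  consider "r < 0" | "r > 0" | "r = 0" by linarith
  then show ?thesis
  proof cases
    case 1
    have "((\<lambda>_. 0) has_field_derivative flat_exp (flat_exp_deriv p) r) (at r)"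
      using 1 by (auto simp: flat_exp_def)
    then show ?thesis
      by (rule has_field_derivative_transform_within_open[of _ _ _ "{..<0}"])
        (use 1 in \<open>auto simp: flat_exp_def\<close>)
  next
    case 2
    have "((\<lambda>r. poly p (1 / r) * exp (- (1 / r))) has_field_derivative flat_exp (flat_exp_deriv p) r) (at r)"
      using 2 by (auto intro!: derivative_eq_intros simp: flat_exp_def flat_exp_deriv_def field_simps power2_eq_square)
    then show ?thesis
      by (rule has_field_derivative_transform_within_open[of _ _ _ "{0<..}"])
        (use 2 in \<open>auto simp: flat_exp_def\<close>)
  next
    case 3
    \<comment> \<open>Dividing by h multiplies the polynomial in 1/h by one more power, so the
      difference quotient at 0 is again a flat function and the limit at 0 is already known.\<close>
    have "((\<lambda>h. (flat_exp p (0 + h) - flat_exp p 0) / h) \<longlongrightarrow> 0) (at 0)"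
    proof (rule Lim_transform_eventually[OF flat_exp_tendsto_0[of "[:0, 1:] * p"]])
      show "\<forall>\<^sub>F h in at 0. flat_exp ([:0, 1:] * p) h = (flat_exp p (0 + h) - flat_exp p 0) / h"
        by (auto simp: flat_exp_def eventually_at_filter)
    qed
    with 3 show ?thesis by (auto simp: DERIV_def flat_exp_def)
  qed
qed

lemma flat_exp_continuous: "continuous_on S (flat_exp p)"
  by (meson continuous_at_imp_continuous_on DERIV_isCont flat_exp_has_derivative)

lemma smooth_fun_flat_exp: "smooth_fun (flat_exp p)"
proof -
  have "smooth_fun (\<lambda>x. c * flat_exp p x)" for c
  proof (coinduction arbitrary: c p)
    case smooth_fun
    have "((\<lambda>x. c * flat_exp p x) has_derivative (\<lambda>u. (c * u) * flat_exp (flat_exp_deriv p) x)) (at x)" for x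
      using flat_exp_has_derivative[of p x, unfolded has_field_derivative_def]
      by (auto intro!: derivative_eq_intros simp: algebra_simps)
    then show ?case
      by (intro exI[of _ "\<lambda>x. c * flat_exp p x"] exI[of _ "\<lambda>x u. (c * u) * flat_exp (flat_exp_deriv p) x"]) blast
  qed
  from this[of 1] show ?thesis by simp
qed

section \<open>Generator and cutoff functions\<close>

definition grad_y :: "('n::finite state \<Rightarrow> real) \<Rightarrow> 'n state \<Rightarrow> real ^ 'n" where
  "grad_y f w = (\<Sum>i\<in>Basis. frechet_derivative f (at w) (0, i) *\<^sub>R i)"

definition lap_y :: "('n::finite state \<Rightarrow> real) \<Rightarrow> 'n state \<Rightarrow> real" where
  "lap_y f z = (\<Sum>i\<in>Basis. frechet_derivative (\<lambda>w. frechet_derivative f (at w) (0, i)) (at z) (0, i))"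

lemma grad_y_inner_Basis: "i \<in> Basis \<Longrightarrow> grad_y f w \<bullet> i = frechet_derivative f (at w) (0, i)"
  by (simp add: grad_y_def inner_sum_left inner_Basis if_distrib cong: if_cong)

lemma frechet_derivative_y:
  assumes "smooth_fun f"
  shows "frechet_derivative f (at w) (0, u) = grad_y f w \<bullet> u"
proof -
  interpret linear "frechet_derivative f (at w)"
    using smooth_fun_has_derivative[OF assms] by (rule has_derivative_linear)
  have "(0::real^'a, u) = (\<Sum>i\<in>Basis. (u \<bullet> i) *\<^sub>R (0, i))"
    by (simp add: sum_prod scaleR_Pair euclidean_representation)
  then have "frechet_derivative f (at w) (0, u) = (\<Sum>i\<in>Basis. (u \<bullet> i) *\<^sub>R frechet_derivative f (at w) (0, i))"
    by (metis (no_types, lifting) sum scaleR sum.cong)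
  also have "\<dots> = grad_y f w \<bullet> u"
    by (subst euclidean_inner[of "grad_y f w" u]) (simp add: grad_y_inner_Basis mult.commute)
  finally show ?thesis .
qed

lemma gen_alt:
  assumes "smooth_fun f"
  shows "gen \<sigma> \<tau> v f z = (1 / sqrt \<tau>) * (frechet_derivative f (at z) (snd z, 0) + grad_y f z \<bullet> v (fst z))
    + (1 / \<tau>) * (- (grad_y f z \<bullet> snd z) + \<sigma>\<^sup>2 / 2 * lap_y f z)"
  by (simp add: gen_def Let_def lap_y_def frechet_derivative_y[OF assms])

lemma frechet_derivative_mult_smooth:
  fixes f g :: "'a::real_normed_vector \<Rightarrow> real"
  assumes "smooth_fun f" "smooth_fun g"
  shows "frechet_derivative (\<lambda>w. f w * g w) (at z) =
    (\<lambda>h. f z * frechet_derivative g (at z) h + frechet_derivative f (at z) h * g z)"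
  by (rule frechet_derivative_at[symmetric])
    (intro has_derivative_mult smooth_fun_has_derivative assms)

lemma frechet_derivative_add_smooth:
  fixes f g :: "'a::real_normed_vector \<Rightarrow> real"
  assumes "smooth_fun f" "smooth_fun g"
  shows "frechet_derivative (\<lambda>w. f w + g w) (at z) =
    (\<lambda>h. frechet_derivative f (at z) h + frechet_derivative g (at z) h)"
  by (rule frechet_derivative_at[symmetric])
    (intro has_derivative_add smooth_fun_has_derivative assms)

lemma grad_y_add:
  assumes "smooth_fun f" "smooth_fun g"
  shows "grad_y (\<lambda>w. f w + g w) z = grad_y f z + grad_y g z"
  by (simp add: grad_y_def frechet_derivative_add_smooth[OF assms] scaleR_left_distrib sum.distrib)

lemma lap_y_add:
  assumes "smooth_fun f" "smooth_fun g"
  shows "lap_y (\<lambda>w. f w + g w) z = lap_y f z + lap_y g z"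
  by (simp add: lap_y_def frechet_derivative_add_smooth[OF assms] sum.distrib
      frechet_derivative_add_smooth[OF smooth_fun_frechet[OF assms(1)] smooth_fun_frechet[OF assms(2)]])

lemma gen_add:
  assumes "smooth_fun f" "smooth_fun g"
  shows "gen \<sigma> \<tau> v (\<lambda>w. f w + g w) z = gen \<sigma> \<tau> v f z + gen \<sigma> \<tau> v g z"
  by (simp add: gen_alt smooth_fun_add assms grad_y_add lap_y_add inner_add_left
      frechet_derivative_add_smooth[OF assms] add_divide_distrib diff_divide_distrib distrib_left)

lemma grad_y_mult:
  assumes "smooth_fun f" "smooth_fun g"
  shows "grad_y (\<lambda>w. f w * g w) z = f z *\<^sub>R grad_y g z + g z *\<^sub>R grad_y f z"
  by (simp add: grad_y_def frechet_derivative_mult_smooth[OF assms] scaleR_left_distrib sum.distrib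
      scaleR_sum_right mult.commute)

lemma lap_y_mult:
  assumes f: "smooth_fun f" and g: "smooth_fun g"
  shows "lap_y (\<lambda>w. f w * g w) z = f z * lap_y g z + g z * lap_y f z + 2 * (grad_y f z \<bullet> grad_y g z)"
proof -
  let ?D = "\<lambda>f w i. frechet_derivative f (at w) (0, i)"
  have D2: "?D (\<lambda>w. ?D (\<lambda>w. f w * g w) w i) z i =
    f z * ?D (\<lambda>w. ?D g w i) z i + g z * ?D (\<lambda>w. ?D f w i) z i + 2 * (?D f z i * ?D g z i)" for i
    unfolding frechet_derivative_mult_smooth[OF f g]
        frechet_derivative_add_smooth[OF smooth_fun_mult[OF f smooth_fun_frechet[OF g]]
          smooth_fun_mult[OF smooth_fun_frechet[OF f] g]]
        frechet_derivative_mult_smooth[OF f smooth_fun_frechet[OF g]]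
        frechet_derivative_mult_smooth[OF smooth_fun_frechet[OF f] g] by (simp add: algebra_simps)
  have "grad_y f z \<bullet> grad_y g z = (\<Sum>i\<in>Basis. ?D f z i * ?D g z i)"
    by (subst euclidean_inner) (simp add: grad_y_inner_Basis)
  then show ?thesis
    by (simp add: lap_y_def D2 sum.distrib sum_distrib_left)
qed

text \<open>The first-order part is a derivation; only the Laplacian in y leaves a remainder, the
  carre du champ. This term is the source of every estimate against the drift.\<close>

lemma gen_mult:
  assumes "smooth_fun f" "smooth_fun g"
  shows "gen \<sigma> \<tau> v (\<lambda>w. f w * g w) z =
    f z * gen \<sigma> \<tau> v g z + g z * gen \<sigma> \<tau> v f z + \<sigma>\<^sup>2 / \<tau> * (grad_y f z \<bullet> grad_y g z)"
  by (simp add: gen_alt smooth_fun_mult assms grad_y_mult lap_y_mult inner_add_left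
      frechet_derivative_mult_smooth[OF assms] algebra_simps add_divide_distrib)

lemma gen_const: "gen \<sigma> \<tau> v (\<lambda>w. c) z = 0"
  and grad_y_const: "grad_y (\<lambda>w. c) z = 0"
  by (simp_all add: gen_def Let_def grad_y_def frechet_derivative_const)

lemma grad_y_cmult:
  assumes "smooth_fun f"
  shows "grad_y (\<lambda>w. c * f w) z = c *\<^sub>R grad_y f z"
  using grad_y_mult[OF smooth_fun_const[of c] assms] by (simp add: grad_y_const)

text \<open>For explicit functions: once a gradient field \<open>P\<close> is guessed, only first
  derivatives of its y-components remain to be checked, and no nested
  \<open>frechet_derivative\<close> has to be computed.\<close>

lemma
  assumes P: "\<And>w. (f has_derivative (\<lambda>h. P w \<bullet> h)) (at w)"
    and D: "\<And>i. i \<in> Basis \<Longrightarrow> ((\<lambda>w. snd (P w) \<bullet> i) has_derivative D i) (at z)"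
  shows grad_y_eqI: "grad_y f w = snd (P w)"
    and gen_eqI: "gen \<sigma> \<tau> v f z =
      (1 / sqrt \<tau>) * (fst (P z) \<bullet> snd z + snd (P z) \<bullet> v (fst z))
       + (1 / \<tau>) * (- (snd (P z) \<bullet> snd z) + \<sigma>\<^sup>2 / 2 * (\<Sum>i\<in>Basis. D i (0, i)))"
proof -
  have D1: "frechet_derivative f (at w) = (\<lambda>h. P w \<bullet> h)" for w
    using frechet_derivative_at[OF P[of w]] by simp
  have [simp]: "P w \<bullet> (0, i) = snd (P w) \<bullet> i" "P w \<bullet> (i, 0) = fst (P w) \<bullet> i" for w i
    by (simp_all add: inner_prod_def)
  show "grad_y f w = snd (P w)"
    by (simp add: grad_y_def D1 euclidean_representation)
  have "frechet_derivative (\<lambda>w. snd (P w) \<bullet> i) (at z) = D i" if "i \<in> Basis" for i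
    using frechet_derivative_at[OF D[OF that]] by simp
  then show "gen \<sigma> \<tau> v f z =
      (1 / sqrt \<tau>) * (fst (P z) \<bullet> snd z + snd (P z) \<bullet> v (fst z))
       + (1 / \<tau>) * (- (snd (P z) \<bullet> snd z) + \<sigma>\<^sup>2 / 2 * (\<Sum>i\<in>Basis. D i (0, i)))"
    by (simp add: gen_def Let_def D1)
qed

lemma continuous_on_grad_y: "smooth_fun f \<Longrightarrow> continuous_on S (grad_y f)"
  unfolding grad_y_def
  by (intro continuous_intros smooth_fun_continuous smooth_fun_frechet)

lemma continuous_on_gen:
  assumes "smooth_fun f" "continuous_on UNIV v"
  shows "continuous_on UNIV (gen \<sigma> \<tau> v f)"
proof -
  have *: "frechet_derivative f (at z) (snd z, 0) =
      (\<Sum>i\<in>Basis. (snd z \<bullet> i) * frechet_derivative f (at z) (i, 0))" for z :: "'a state"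
  proof -
    interpret linear "frechet_derivative f (at z)"
      using smooth_fun_has_derivative[OF assms(1)] by (rule has_derivative_linear)
    have "(snd z, 0::real^'a) = (\<Sum>i\<in>Basis. (snd z \<bullet> i) *\<^sub>R (i, 0))"
      by (simp add: sum_prod scaleR_Pair euclidean_representation)
    then have "frechet_derivative f (at z) (snd z, 0) =
      (\<Sum>i\<in>Basis. (snd z \<bullet> i) *\<^sub>R frechet_derivative f (at z) (i, 0))"
      by (metis (no_types, lifting) sum scaleR sum.cong)
    then show ?thesis by simp
  qed
  have cv: "continuous_on UNIV (\<lambda>z::'a state. v (fst z))"
    by (rule continuous_on_compose2[OF assms(2)]) (auto intro: continuous_intros)
  show ?thesis
    unfolding gen_alt[OF assms(1)] lap_y_def *
    by (intro continuous_intros continuous_on_grad_y smooth_fun_continuous smooth_fun_frechet assms cv)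
qed

lemma gen_eq_0:
  assumes "open U" "z \<in> U" "\<And>w. w \<in> U \<Longrightarrow> f w = 0"
  shows "gen \<sigma> \<tau> v f z = 0" "grad_y f z = 0"
proof -
  have D: "frechet_derivative g (at w) = (\<lambda>h. 0)" if "w \<in> U" "\<And>w. w \<in> U \<Longrightarrow> g w = 0" 
    for g :: "'a state \<Rightarrow> real" and w
  proof -
    have "((\<lambda>_. 0) has_derivative (\<lambda>h. 0)) (at w)" by simp
    then have "(g has_derivative (\<lambda>h. 0)) (at w)"
      by (rule has_derivative_transform_within_open[of _ _ _ _ U]) (use assms that in auto)
    then show ?thesis using frechet_derivative_at by metis
  qed
  show "grad_y f z = 0" by (simp add: grad_y_def D assms)
  have "frechet_derivative (\<lambda>w. frechet_derivative f (at w) (0, i)) (at z) (0, i) = 0" for i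
    by (subst D) (auto simp: D assms)
  then show "gen \<sigma> \<tau> v f z = 0" by (simp add: gen_def Let_def D assms)
qed

lemma test_funI:
  fixes f :: "'a::euclidean_space \<Rightarrow> real"
  assumes "smooth_fun f" "\<And>w. norm w \<ge> R \<Longrightarrow> f w = 0"
  shows "test_fun f"
proof -
  have "closure {z. f z \<noteq> 0} \<subseteq> cball 0 R"
    using assms(2) by (intro closure_minimal) (force simp: not_le)+
  then show ?thesis
    unfolding test_fun_def using assms(1) compact_cball
    by (metis bounded_subset closed_closure compact_eq_bounded_closed)
qed

lemma test_fun_gen_bounded:
  assumes "test_fun f" "continuous_on UNIV v"
  shows "\<exists>B. (\<forall>w. \<bar>gen \<sigma> \<tau> v f w\<bar> \<le> B) \<and> (\<forall>w. \<bar>f w\<bar> \<le> B)"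
proof -
  let ?S = "closure {z. f z \<noteq> 0}"
  have f: "smooth_fun f" "compact ?S" using assms(1) by (auto simp: test_fun_def)
  note c = continuous_on_gen[OF f(1) assms(2), of \<sigma> \<tau>]
  have "bounded (gen \<sigma> \<tau> v f ` ?S)" "bounded (f ` ?S)"
    using compact_continuous_image[OF continuous_on_subset[OF c]] f(2)
      compact_continuous_image[OF smooth_fun_continuous[OF f(1)]]
    by (auto intro!: compact_imp_bounded)
  then obtain A B where AB: "\<And>w. w \<in> ?S \<Longrightarrow> \<bar>gen \<sigma> \<tau> v f w\<bar> \<le> A" "\<And>w. w \<in> ?S \<Longrightarrow> \<bar>f w\<bar> \<le> B"
    by (auto simp: bounded_iff)
  have *: "gen \<sigma> \<tau> v f w = 0" "f w = 0" if "w \<notin> ?S" for w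
  proof -
    show "gen \<sigma> \<tau> v f w = 0"
      by (rule gen_eq_0[of "- ?S"]) (use that closure_subset[of "{z. f z \<noteq> 0}"] in auto)
    show "f w = 0" using that closure_subset[of "{z. f z \<noteq> 0}"] by auto
  qed
  have "\<bar>gen \<sigma> \<tau> v f w\<bar> \<le> max 0 (max A B)" "\<bar>f w\<bar> \<le> max 0 (max A B)" for w
    using AB[of w] *[of w] by (cases "w \<in> ?S"; force)+
  then show ?thesis by blast
qed

text \<open>A bump supported in the ball of radius \<open>R\<close>. The factor \<open>exp 1\<close>
  normalizes its value at the origin to 1. It is not constant near the origin; what is used is that
  it lies between 0 and 1 and tends to 1 pointwise as \<open>R\<close> grows.\<close>

definition cutoff :: "real \<Rightarrow> 'n::finite state \<Rightarrow> real" where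
  "cutoff R w = exp 1 * flat_exp 1 (1 - (w \<bullet> w) / R\<^sup>2)"

lemma cutoff_smooth: "smooth_fun (cutoff R)"
proof -
  have "smooth_fun (\<lambda>w::'a state. 1 + (- 1 / R\<^sup>2) * (\<Sum>i\<in>Basis. (w \<bullet> i) * (w \<bullet> i)))"
    by (intro smooth_fun_add smooth_fun_mult smooth_fun_const smooth_fun_sum
        smooth_fun_bounded_linear bounded_linear_inner_left)
  from smooth_fun_mult[OF smooth_fun_const smooth_fun_comp[OF smooth_fun_flat_exp this]]
  have "smooth_fun (\<lambda>w::'a state. exp 1 * flat_exp 1 (1 + (- 1 / R\<^sup>2) * (\<Sum>i\<in>Basis. (w \<bullet> i) * (w \<bullet> i))))" .
  also have "(\<lambda>w::'a state. exp 1 * flat_exp 1 (1 + (- 1 / R\<^sup>2) * (\<Sum>i\<in>Basis. (w \<bullet> i) * (w \<bullet> i)))) = cutoff R"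
    by (simp add: cutoff_def fun_eq_iff euclidean_inner[symmetric])
  finally show ?thesis .
qed

lemma cutoff_nonneg: "0 \<le> cutoff R w"
  by (simp add: cutoff_def flat_exp_def)

lemma cutoff_le_1: "cutoff R w \<le> 1"
proof (cases "1 - (w \<bullet> w) / R\<^sup>2 \<le> 0")
  case False
  then have "1 \<le> 1 / (1 - (w \<bullet> w) / R\<^sup>2)" by (simp add: field_simps)
  then show ?thesis using False by (simp add: cutoff_def flat_exp_def flip: exp_add)
qed (simp add: cutoff_def flat_exp_def)

lemma inner_div_ge_1: "R > 0 \<Longrightarrow> norm w \<ge> R \<Longrightarrow> 1 - (w \<bullet> w) / R\<^sup>2 \<le> 0"
  by (simp add: divide_simps dot_square_norm power_mono)

lemma cutoff_eq_0: "R > 0 \<Longrightarrow> norm w \<ge> R \<Longrightarrow> cutoff R w = 0"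
  using inner_div_ge_1[of R w] by (simp add: cutoff_def flat_exp_def)

lemma cutoff_test_fun: "R > 0 \<Longrightarrow> test_fun (cutoff R)"
  by (rule test_funI[OF cutoff_smooth]) (rule cutoff_eq_0)

lemma cutoff_tendsto: "((\<lambda>R. cutoff R w) \<longlongrightarrow> 1) at_top"
proof -
  have "((\<lambda>R. 1 - (w \<bullet> w) / R\<^sup>2) \<longlongrightarrow> 1 - 0) at_top"
    by (intro tendsto_intros tendsto_divide_0[OF tendsto_const] filterlim_at_top_imp_at_infinity
        filterlim_pow_at_top filterlim_ident) auto
  moreover have "isCont (flat_exp 1) (1 - 0)"
    using flat_exp_has_derivative DERIV_isCont by blast
  ultimately have "((\<lambda>R. exp 1 * flat_exp 1 (1 - (w \<bullet> w) / R\<^sup>2)) \<longlongrightarrow> exp 1 * flat_exp 1 (1 - 0)) at_top"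
    by (intro tendsto_mult tendsto_const) (rule isCont_tendsto_compose)
  then show ?thesis by (simp add: cutoff_def flat_exp_def flip: exp_add)
qed

lemma flat_exp_bounded: "\<exists>B. \<forall>r\<le>1. \<bar>flat_exp p r\<bar> \<le> B"
proof -
  have "bounded (flat_exp p ` {0..1})"
    by (intro compact_imp_bounded compact_continuous_image flat_exp_continuous) auto
  then obtain B where "\<forall>x\<in>flat_exp p ` {0..1}. norm x \<le> B" by (auto simp only: bounded_iff)
  then have B: "\<bar>flat_exp p r\<bar> \<le> B" if "r \<in> {0..1}" for r using that by simp
  have "\<bar>flat_exp p r\<bar> \<le> max B 0" if "r \<le> 1" for r
    using B[of r] that by (cases "r \<le> 0") (auto simp: flat_exp_def)
  then show ?thesis by blast
qed

lemma cutoff_derivatives: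
  fixes w :: "'n::finite state" and R :: real
  defines "F p \<equiv> flat_exp p (1 - (w \<bullet> w) / R\<^sup>2)"
  shows "grad_y (cutoff R) w = (- 2 * exp 1 / R\<^sup>2 * F (flat_exp_deriv 1)) *\<^sub>R snd w" (is ?G)
    and "gen \<sigma> \<tau> v (cutoff R) w = - 2 * exp 1 / R\<^sup>2 * (F (flat_exp_deriv 1) *
        ((fst w \<bullet> snd w + snd w \<bullet> v (fst w)) / sqrt \<tau> - (snd w \<bullet> snd w) / \<tau> + \<sigma>\<^sup>2 / 2 * DIM(real^'n) / \<tau>)
        - F (flat_exp_deriv (flat_exp_deriv 1)) * (\<sigma>\<^sup>2 / \<tau> * (snd w \<bullet> snd w) / R\<^sup>2))" (is ?L)
proof -
  let ?c = "\<lambda>w::'n state. 1 - (w \<bullet> w) / R\<^sup>2"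
  let ?d1 = "flat_exp_deriv 1" and ?d2 = "flat_exp_deriv (flat_exp_deriv 1)"
  let ?P = "\<lambda>w::'n state. (- 2 * exp 1 / R\<^sup>2 * flat_exp ?d1 (?c w)) *\<^sub>R w"
  have flat: "((\<lambda>w. flat_exp p (?c w)) has_derivative (\<lambda>h. - 2 / R\<^sup>2 * flat_exp (flat_exp_deriv p) (?c w) * (w \<bullet> h))) (at w)"
    for p w
  proof -
    have "((\<lambda>w. 1 - k * (w \<bullet> w)) has_derivative (\<lambda>h. - 2 * k * (w \<bullet> h))) (at w)" for k :: real
      by (auto intro!: derivative_eq_intros simp: inner_commute fun_eq_iff)
    from this[of "1 / R\<^sup>2"] have "(?c has_derivative (\<lambda>h. - 2 / R\<^sup>2 * (w \<bullet> h))) (at w)" by simp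
    from has_derivative_compose[OF this flat_exp_has_derivative[of p, unfolded has_field_derivative_def]]
    show ?thesis by (simp add: mult_ac)
  qed
  have P: "(cutoff R has_derivative (\<lambda>h. ?P w \<bullet> h)) (at w)" for w :: "'n state"
    unfolding cutoff_def
    by (rule has_derivative_eq_rhs[OF has_derivative_mult_right[OF flat]]) (simp add: fun_eq_iff)
  let ?D = "\<lambda>i h. - 2 * exp 1 / R\<^sup>2 * (flat_exp ?d1 (?c w) * (snd h \<bullet> i) +
      (- 2 / R\<^sup>2 * flat_exp ?d2 (?c w) * (w \<bullet> h)) * (snd w \<bullet> i))"
  have D: "((\<lambda>w. snd (?P w) \<bullet> i) has_derivative ?D i) (at w)" for i
  proof -
    have "((\<lambda>w. - 2 * exp 1 / R\<^sup>2 * (flat_exp ?d1 (?c w) * (snd w \<bullet> i))) has_derivative ?D i) (at w)"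
      by (intro has_derivative_mult_right has_derivative_mult flat has_derivative_inner_left
          has_derivative_snd has_derivative_ident)
    then show ?thesis by (simp only: snd_scaleR inner_scaleR_left mult.assoc)
  qed
  show ?G using grad_y_eqI[OF P D] by (simp add: F_def)
  have S: "(\<Sum>i\<in>Basis. (snd w \<bullet> i) * (snd w \<bullet> i)) = snd w \<bullet> snd w"
    by (simp add: euclidean_inner[symmetric])
  have "(\<Sum>i\<in>Basis. ?D i (0, i)) = - 2 * exp 1 / R\<^sup>2 * (\<Sum>i\<in>(Basis::(real^'n) set). flat_exp ?d1 (?c w)
     + (- 2 / R\<^sup>2 * flat_exp ?d2 (?c w)) * ((snd w \<bullet> i) * (snd w \<bullet> i)))"
    by (subst sum_distrib_left, intro sum.cong) (auto simp: inner_prod_def)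
  also have "\<dots> = - 2 * exp 1 / R\<^sup>2 * (DIM(real^'n) * flat_exp ?d1 (?c w)
     + (- 2 / R\<^sup>2 * flat_exp ?d2 (?c w)) * (snd w \<bullet> snd w))"
    by (simp only: sum.distrib sum_distrib_left[symmetric] S) simp
  finally have S2: "(\<Sum>i\<in>Basis. ?D i (0, i)) = - 2 * exp 1 / R\<^sup>2 * (DIM(real^'n) * F ?d1
     + (- 2 / R\<^sup>2 * F ?d2) * (snd w \<bullet> snd w))" by (simp add: F_def)
  have alg: "(1 / st) * (c * k * xy + c * k * yv) + (1 / \<tau>) * (- (c * k * yy) + \<sigma>\<^sup>2 / 2 * (c * (n * k + (- 2 / r * m) * yy)))
     = c * (k * ((xy + yv) / st - yy / \<tau> + \<sigma>\<^sup>2 / 2 * n / \<tau>) - m * (\<sigma>\<^sup>2 / \<tau> * yy / r))"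
    for st c k xy yv yy n r m :: real
    by (simp add: algebra_simps add_divide_distrib diff_divide_distrib)
  show ?L
    unfolding gen_eqI[OF P D] S2 alg[symmetric] by (simp add: F_def inner_commute)
qed

text \<open>The gradient of the cutoff has size |w| / R^2 and the coefficients grow linearly, so the
  generator is of order |w|^2 / R^2. At a fixed point this tends to 0, and on the support it is
  bounded; the two forms provide pointwise convergence and domination when the cutoff is
  removed.\<close>

lemma cutoff_estimates:
  assumes v: "\<And>x. norm (v x) \<le> B" and "B \<ge> 0" "\<tau> > 0"
  obtains C where "C \<ge> 0"
    and "\<And>R (w::'n::finite state). R \<ge> 1 \<Longrightarrow> \<bar>gen \<sigma> \<tau> v (cutoff R) w\<bar> \<le> C * (1 + norm w)\<^sup>2 / R\<^sup>2"
    and "\<And>R (w::'n::finite state). R \<ge> 1 \<Longrightarrow> norm (grad_y (cutoff R) w) \<le> C * (1 + norm w)\<^sup>2 / R\<^sup>2"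
    and "\<And>R (w::'n::finite state). R \<ge> 1 \<Longrightarrow> \<bar>gen \<sigma> \<tau> v (cutoff R) w\<bar> \<le> C"
    and "\<And>R (w::'n::finite state). R \<ge> 1 \<Longrightarrow> norm (grad_y (cutoff R) w) \<le> C"
proof -
  obtain B1 B2 where B1: "\<And>r. r \<le> 1 \<Longrightarrow> \<bar>flat_exp (flat_exp_deriv 1) r\<bar> \<le> B1"
    and B2: "\<And>r. r \<le> 1 \<Longrightarrow> \<bar>flat_exp (flat_exp_deriv (flat_exp_deriv 1)) r\<bar> \<le> B2"
    using flat_exp_bounded by metis
  have pos: "0 \<le> B1" "0 \<le> B2" using B1[of 1] B2[of 1] by linarith+
  define n where "n = real DIM(real^'n)"
  define A where "A = (1 + B) / sqrt \<tau> + 1 / \<tau> + \<sigma>\<^sup>2 / 2 * n / \<tau>"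
  define C0 where "C0 = 2 * exp 1 * (B1 * (A + 1) + B2 * (\<sigma>\<^sup>2 / \<tau>))"
  have A0: "A \<ge> 0" using assms by (auto simp: A_def n_def)
  have C0: "C0 \<ge> 0" using pos A0 assms by (auto simp: C0_def)
  have est: "\<bar>gen \<sigma> \<tau> v (cutoff R) w\<bar> \<le> C0 * (1 + norm w)\<^sup>2 / R\<^sup>2"
    "norm (grad_y (cutoff R) w) \<le> C0 * (1 + norm w)\<^sup>2 / R\<^sup>2"
    if R: "R \<ge> 1" for R :: real and w :: "'n state"
  proof -
    define N where "N = (1 + norm w)\<^sup>2"
    have le1: "1 - (w \<bullet> w) / R\<^sup>2 \<le> 1" by simp
    have ny: "norm (snd w) \<le> norm w" "norm (fst w) \<le> norm w"
      by (metis norm_snd_le prod.collapse, metis norm_fst_le prod.collapse)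
    have N: "1 \<le> N" "norm w \<le> N" "norm w * norm w \<le> N"
      by (auto simp: N_def power2_eq_square algebra_simps)
    have xy: "\<bar>fst w \<bullet> snd w\<bar> \<le> N"
      using Cauchy_Schwarz_ineq2[of "fst w" "snd w"] mult_mono[OF ny(2) ny(1)] N by auto
    have yv: "\<bar>snd w \<bullet> v (fst w)\<bar> \<le> B * N"
      using Cauchy_Schwarz_ineq2[of "snd w" "v (fst w)"] mult_mono[OF ny(1) v[of "fst w"]]
        mult_left_mono[OF N(2) assms(2)] by (auto simp: mult.commute)
    have yy: "0 \<le> snd w \<bullet> snd w" "snd w \<bullet> snd w \<le> N"
      using mult_mono[OF ny(1) ny(1)] N by (auto simp: dot_square_norm power2_eq_square)
    have "\<bar>(fst w \<bullet> snd w + snd w \<bullet> v (fst w)) / sqrt \<tau> - (snd w \<bullet> snd w) / \<tau> + \<sigma>\<^sup>2 / 2 * n / \<tau>\<bar>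
       \<le> \<bar>(fst w \<bullet> snd w + snd w \<bullet> v (fst w)) / sqrt \<tau>\<bar> + \<bar>(snd w \<bullet> snd w) / \<tau>\<bar> + \<bar>\<sigma>\<^sup>2 / 2 * n / \<tau>\<bar>"
      by linarith
    also have "\<dots> \<le> (N + B * N) / sqrt \<tau> + N / \<tau> + \<sigma>\<^sup>2 / 2 * (n * N) / \<tau>"
    proof (intro add_mono)
      show "\<bar>(fst w \<bullet> snd w + snd w \<bullet> v (fst w)) / sqrt \<tau>\<bar> \<le> (N + B * N) / sqrt \<tau>"
        using xy yv assms by (simp add: abs_divide divide_right_mono)
      show "\<bar>(snd w \<bullet> snd w) / \<tau>\<bar> \<le> N / \<tau>" using yy assms by (simp add: abs_divide divide_right_mono)
      have "n * 1 \<le> n * N" using N by (intro mult_left_mono) (auto simp: n_def)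
      then have "\<sigma>\<^sup>2 / 2 * n / \<tau> \<le> \<sigma>\<^sup>2 / 2 * (n * N) / \<tau>" 
        using assms by (intro divide_right_mono mult_left_mono) auto
      moreover have "\<bar>\<sigma>\<^sup>2 / 2 * n / \<tau>\<bar> = \<sigma>\<^sup>2 / 2 * n / \<tau>" using assms by (auto simp: n_def)
      ultimately show "\<bar>\<sigma>\<^sup>2 / 2 * n / \<tau>\<bar> \<le> \<sigma>\<^sup>2 / 2 * (n * N) / \<tau>" by simp
    qed
    also have "\<dots> = A * N" by (simp add: A_def algebra_simps add_divide_distrib)
    finally have e1: "\<bar>(fst w \<bullet> snd w + snd w \<bullet> v (fst w)) / sqrt \<tau> - (snd w \<bullet> snd w) / \<tau> + \<sigma>\<^sup>2 / 2 * n / \<tau>\<bar> \<le> A * N" .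
    have R2: "1 \<le> R\<^sup>2" using R by simp
    have "(snd w \<bullet> snd w) / R\<^sup>2 \<le> N / 1" using yy N R2 by (intro frac_le) auto
    then have e2: "\<bar>\<sigma>\<^sup>2 / \<tau> * (snd w \<bullet> snd w) / R\<^sup>2\<bar> \<le> \<sigma>\<^sup>2 / \<tau> * N"
      using yy assms mult_left_mono[of "(snd w \<bullet> snd w) / R\<^sup>2" N "\<sigma>\<^sup>2 / \<tau>"] by (simp add: abs_mult)
    let ?f1 = "flat_exp (flat_exp_deriv 1) (1 - (w \<bullet> w) / R\<^sup>2)"
    let ?f2 = "flat_exp (flat_exp_deriv (flat_exp_deriv 1)) (1 - (w \<bullet> w) / R\<^sup>2)"
    let ?e1 = "(fst w \<bullet> snd w + snd w \<bullet> v (fst w)) / sqrt \<tau> - (snd w \<bullet> snd w) / \<tau> + \<sigma>\<^sup>2 / 2 * n / \<tau>"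
    let ?e2 = "\<sigma>\<^sup>2 / \<tau> * (snd w \<bullet> snd w) / R\<^sup>2"
    have "\<bar>?f1 * ?e1\<bar> \<le> B1 * (A * N)" "\<bar>?f2 * ?e2\<bar> \<le> B2 * (\<sigma>\<^sup>2 / \<tau> * N)"
      unfolding abs_mult[of ?f1] abs_mult[of ?f2]
      by (intro mult_mono B1[OF le1] B2[OF le1] e1 e2 pos abs_ge_zero)+
    then have "\<bar>?f1 * ?e1 - ?f2 * ?e2\<bar> \<le> B1 * (A * N) + B2 * (\<sigma>\<^sup>2 / \<tau> * N)" by linarith
    then have "2 * exp 1 / R\<^sup>2 * \<bar>?f1 * ?e1 - ?f2 * ?e2\<bar> \<le> 2 * exp 1 / R\<^sup>2 * (B1 * (A * N) + B2 * (\<sigma>\<^sup>2 / \<tau> * N))"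
      by (intro mult_left_mono) auto
    also have "\<dots> \<le> C0 * N / R\<^sup>2"
    proof -
      have "0 \<le> exp 1 * (B1 * N)" using pos N by simp
      then have "2 * exp 1 * (B1 * (A * N) + B2 * (\<sigma>\<^sup>2 / \<tau> * N)) \<le> C0 * N"
        by (simp add: C0_def algebra_simps)
      then show ?thesis by (simp add: divide_right_mono)
    qed
    finally show "\<bar>gen \<sigma> \<tau> v (cutoff R) w\<bar> \<le> C0 * (1 + norm w)\<^sup>2 / R\<^sup>2"
      unfolding cutoff_derivatives(2) n_def[symmetric] N_def[symmetric] by (simp add: abs_mult)
    have "norm (grad_y (cutoff R) w) = 2 * exp 1 / R\<^sup>2 * (\<bar>?f1\<bar> * norm (snd w))"
      by (simp add: cutoff_derivatives(1) abs_mult)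
    also have "\<dots> \<le> 2 * exp 1 / R\<^sup>2 * (B1 * N)"
      using ny(1) N by (intro mult_left_mono mult_mono B1 le1 pos) auto
    also have "\<dots> \<le> C0 * N / R\<^sup>2"
    proof -
      have "0 \<le> exp 1 * (B1 * A * N)" "0 \<le> exp 1 * (B2 * (\<sigma>\<^sup>2 / \<tau>) * N)"
        using pos N A0 assms by (auto intro!: mult_nonneg_nonneg)
      moreover have "C0 * N = 2 * exp 1 * (B1 * N) + 2 * (exp 1 * (B1 * A * N)) + 2 * (exp 1 * (B2 * (\<sigma>\<^sup>2 / \<tau>) * N))"
        unfolding C0_def by (simp only: distrib_left distrib_right mult.assoc mult_1)
      ultimately have "2 * exp 1 * (B1 * N) \<le> C0 * N" by linarith
      then show ?thesis by (simp add: divide_right_mono)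
    qed
    finally show "norm (grad_y (cutoff R) w) \<le> C0 * (1 + norm w)\<^sup>2 / R\<^sup>2"
      by (simp add: N_def)
  qed
  \<comment> \<open>On the support 1 + |w| is at most 2 R, because \<open>R\<close> is at least 1;
    this is the origin of the factor 4 in the final constant.\<close>
  have bd: "C0 * (1 + norm w)\<^sup>2 / R\<^sup>2 \<le> 4 * C0" if "R \<ge> 1" "norm w < R" for R :: real and w :: "'n state"
  proof -
    have "(1 + norm w)\<^sup>2 \<le> (2 * R)\<^sup>2" using that by (intro power_mono) auto
    then have "C0 * (1 + norm w)\<^sup>2 \<le> C0 * (2 * R)\<^sup>2" using C0 by (intro mult_left_mono)
    then show ?thesis using that by (simp add: divide_le_eq power_mult_distrib mult_ac)
  qed
  have 0: "gen \<sigma> \<tau> v (cutoff R) w = 0" "grad_y (cutoff R) w = 0"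
    if "R \<ge> 1" "\<not> norm w < R" for R :: real and w :: "'n state"
    using inner_div_ge_1[of R w] that by (auto simp: cutoff_derivatives flat_exp_def)
  show ?thesis
  proof (rule that[of "4 * C0"])
    show "0 \<le> 4 * C0" using C0 by simp
  next
    fix R :: real and w :: "'n state" assume R: "1 \<le> R"
    have *: "C0 * (1 + norm w)\<^sup>2 / R\<^sup>2 \<le> 4 * C0 * (1 + norm w)\<^sup>2 / R\<^sup>2"
      using C0 by (intro divide_right_mono mult_right_mono) auto
    show "\<bar>gen \<sigma> \<tau> v (cutoff R) w\<bar> \<le> 4 * C0 * (1 + norm w)\<^sup>2 / R\<^sup>2"
      "norm (grad_y (cutoff R) w) \<le> 4 * C0 * (1 + norm w)\<^sup>2 / R\<^sup>2"
      using est[OF R, of w] * by linarith+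
    show "\<bar>gen \<sigma> \<tau> v (cutoff R) w\<bar> \<le> 4 * C0" "norm (grad_y (cutoff R) w) \<le> 4 * C0"
      using est[OF R, of w] bd[OF R, of w] 0[OF R, of w] C0
      by (cases "norm w < R"; fastforce)+
  qed
qed

section \<open>Bounded Borel functions as limits of trigonometric polynomials\<close>

inductive trig_poly :: "('a::euclidean_space \<Rightarrow> real) \<Rightarrow> bool" where
  wave: "trig_poly (\<lambda>w. c * cos (\<zeta> \<bullet> w + \<phi>))"
| add: "trig_poly f \<Longrightarrow> trig_poly g \<Longrightarrow> trig_poly (\<lambda>w. f w + g w)"

lemma trig_poly_const: "trig_poly (\<lambda>w. c)"
  using trig_poly.wave[of c 0 0] by simp

lemma trig_poly_wave_mult:
  assumes "trig_poly f" shows "trig_poly (\<lambda>w. c * cos (\<zeta> \<bullet> w + \<phi>) * f w)"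
  using assms
proof induction
  case (wave d \<xi> \<omega>)
  have "trig_poly (\<lambda>w. c * d / 2 * cos ((\<zeta> - \<xi>) \<bullet> w + (\<phi> - \<omega>)) + c * d / 2 * cos ((\<zeta> + \<xi>) \<bullet> w + (\<phi> + \<omega>)))"
    by (intro trig_poly.intros)
  also have "(\<lambda>w. c * d / 2 * cos ((\<zeta> - \<xi>) \<bullet> w + (\<phi> - \<omega>)) + c * d / 2 * cos ((\<zeta> + \<xi>) \<bullet> w + (\<phi> + \<omega>)))
    = (\<lambda>w. c * cos (\<zeta> \<bullet> w + \<phi>) * (d * cos (\<xi> \<bullet> w + \<omega>)))"
  proof
    fix w
    have "(\<zeta> - \<xi>) \<bullet> w + (\<phi> - \<omega>) = (\<zeta> \<bullet> w + \<phi>) - (\<xi> \<bullet> w + \<omega>)"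
      "(\<zeta> + \<xi>) \<bullet> w + (\<phi> + \<omega>) = (\<zeta> \<bullet> w + \<phi>) + (\<xi> \<bullet> w + \<omega>)"
      by (simp_all add: inner_diff_left inner_add_left)
    then show "c * d / 2 * cos ((\<zeta> - \<xi>) \<bullet> w + (\<phi> - \<omega>)) + c * d / 2 * cos ((\<zeta> + \<xi>) \<bullet> w + (\<phi> + \<omega>))
      = c * cos (\<zeta> \<bullet> w + \<phi>) * (d * cos (\<xi> \<bullet> w + \<omega>))"
      by (simp only: cos_diff cos_add) (simp add: algebra_simps)
  qed
  finally show ?case .
next
  case (add f g)
  then show ?case by (simp add: distrib_left trig_poly.add)
qed

lemma trig_poly_mult:
  assumes "trig_poly f" "trig_poly g" shows "trig_poly (\<lambda>w. f w * g w)"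
  using assms(1)
  by induction (simp_all add: trig_poly_wave_mult[OF assms(2)] distrib_right trig_poly.add)

lemma trig_poly_sum:
  assumes "\<And>i. i \<in> I \<Longrightarrow> trig_poly (f i)" shows "trig_poly (\<lambda>w. \<Sum>i\<in>I. f i w)"
  using assms
  by (induction I rule: infinite_finite_induct) (auto intro: trig_poly_const trig_poly.add)

lemma trig_poly_bounded: "trig_poly f \<Longrightarrow> \<exists>B. \<forall>w. \<bar>f w\<bar> \<le> B"
proof (induction rule: trig_poly.induct)
  case (wave c \<zeta> \<phi>)
  have "\<bar>c * cos x\<bar> \<le> \<bar>c\<bar>" for x by (simp add: abs_mult mult_left_le)
  then show ?case by blast
next
  case (add f g)
  then obtain A B where "\<And>w. \<bar>f w\<bar> \<le> A" "\<And>w. \<bar>g w\<bar> \<le> B" by blast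
  then have "\<bar>f w + g w\<bar> \<le> A + B" for w by (meson abs_triangle_ineq add_mono order_trans)
  then show ?case by blast
qed

lemma trig_poly_continuous: "trig_poly f \<Longrightarrow> continuous_on S f"
  by (induction rule: trig_poly.induct) (auto intro!: continuous_intros)

text \<open>Limits are pointwise with a common bound, exactly what dominated convergence under a
  probability measure needs. Inequalities between integrals of f and of f^2 thus pass from
  trigonometric polynomials to the closure by induction.\<close>

inductive trig_closure :: "('a::euclidean_space \<Rightarrow> real) \<Rightarrow> bool" where
  base: "trig_poly f \<Longrightarrow> trig_closure f"
| lim: "(\<And>k::nat. trig_closure (F k)) \<Longrightarrow> (\<And>k w. \<bar>F k w\<bar> \<le> B) \<Longrightarrow> (\<And>w. (\<lambda>k. F k w) \<longlonglongrightarrow> f w)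
    \<Longrightarrow> trig_closure f"

lemma trig_closure_bounded: "trig_closure f \<Longrightarrow> \<exists>B. \<forall>w. \<bar>f w\<bar> \<le> B"
proof (induction rule: trig_closure.induct)
  case (base f)
  then show ?case by (rule trig_poly_bounded)
next
  case (lim F B f)
  have "\<bar>f w\<bar> \<le> B" for w
    using lim(2)[of _ w] lim(3)[of w] by (intro LIMSEQ_le_const2[OF tendsto_rabs]) auto
  then show ?case by blast
qed

lemma trig_closure_measurable: "trig_closure f \<Longrightarrow> f \<in> borel_measurable borel"
proof (induction rule: trig_closure.induct)
  case (base f)
  then show ?case by (intro borel_measurable_continuous_onI trig_poly_continuous)
next
  case (lim F B f)
  then show ?case by (intro borel_measurable_LIMSEQ_real[OF lim(3)]) auto
qed

lemma trig_closure_add: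
  assumes "trig_closure f" "trig_closure g" shows "trig_closure (\<lambda>w. f w + g w)"
proof -
  have bd: "\<bar>x + y\<bar> \<le> A + B" if "\<bar>x\<bar> \<le> A" "\<bar>y\<bar> \<le> B" for x y A B :: real
    using that by linarith
  \<comment> \<open>The closure is generated by iterated limits, so the two arguments are handled
    one at a time: here one is still a trigonometric polynomial, and the outer induction then frees
    it.\<close>
  have trig: "trig_closure (\<lambda>w. f w + g w)" if "trig_closure g" "trig_poly f" for f g :: "'a \<Rightarrow> real"
    using that
  proof (induction rule: trig_closure.induct)
    case (lim F B g)
    obtain A where A: "\<And>w. \<bar>f w\<bar> \<le> A" using trig_poly_bounded[OF lim.prems] by blast
    show ?case
      by (rule trig_closure.lim[OF lim.IH[OF lim.prems] bd[OF A lim(2)] tendsto_add[OF tendsto_const lim(3)]])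
  qed (intro trig_closure.base trig_poly.add)
  show ?thesis using assms(1)
  proof (induction rule: trig_closure.induct)
    case (base f)
    then show ?case by (rule trig[OF assms(2)])
  next
    case (lim F B f)
    obtain A where A: "\<And>w. \<bar>g w\<bar> \<le> A" using trig_closure_bounded[OF assms(2)] by blast
    show ?case
      by (rule trig_closure.lim[OF lim.IH bd[OF lim(2) A] tendsto_add[OF lim(3) tendsto_const]])
  qed
qed

lemma trig_closure_mult:
  assumes "trig_closure f" "trig_closure g" shows "trig_closure (\<lambda>w. f w * g w)"
proof -
  have bd: "\<bar>x * y\<bar> \<le> A * B" if "\<bar>x\<bar> \<le> A" "\<bar>y\<bar> \<le> B" for x y A B :: real
    unfolding abs_mult using that by (intro mult_mono) auto
  have trig: "trig_closure (\<lambda>w. f w * g w)" if "trig_closure g" "trig_poly f" for f g :: "'a \<Rightarrow> real"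
    using that
  proof (induction rule: trig_closure.induct)
    case (lim F B g)
    obtain A where A: "\<And>w. \<bar>f w\<bar> \<le> A" using trig_poly_bounded[OF lim.prems] by blast
    show ?case
      by (rule trig_closure.lim[OF lim.IH[OF lim.prems] bd[OF A lim(2)] tendsto_mult[OF tendsto_const lim(3)]])
  qed (intro trig_closure.base trig_poly_mult)
  show ?thesis using assms(1)
  proof (induction rule: trig_closure.induct)
    case (base f)
    then show ?case by (rule trig[OF assms(2)])
  next
    case (lim F B f)
    obtain A where A: "\<And>w. \<bar>g w\<bar> \<le> A" using trig_closure_bounded[OF assms(2)] by blast
    show ?case
      by (rule trig_closure.lim[OF lim.IH bd[OF lim(2) A] tendsto_mult[OF lim(3) tendsto_const]])
  qed
qed

lemma trig_closure_const: "trig_closure (\<lambda>w. c)"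
  by (intro trig_closure.base trig_poly_const)

lemma scaled_sin_tendsto: "(\<lambda>k. real (Suc k) * sin (t / real (Suc k))) \<longlonglongrightarrow> t"
proof -
  have "((\<lambda>h. sin (t * h)) has_field_derivative t) (at 0)"
    by (auto intro!: derivative_eq_intros)
  then have "((\<lambda>h. sin (t * h) / h) \<longlongrightarrow> t) (at 0)" by (simp add: DERIV_def)
  moreover have "filterlim (\<lambda>k. inverse (real (Suc k))) (at 0) sequentially"
    using LIMSEQ_inverse_real_of_nat by (intro filterlim_atI) auto
  ultimately have "(\<lambda>k. sin (t * inverse (real (Suc k))) / inverse (real (Suc k))) \<longlonglongrightarrow> t"
    by (rule filterlim_compose)
  then show ?thesis by (simp add: field_simps)
qed

text \<open>\<open>L sin (w / L)\<close> tends to \<open>w\<close> as \<open>L\<close> grows and turns polynomials into trigonometric polynomials; this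
  converts Weierstrass approximation on cubes into approximation by globally bounded functions.\<close>

definition sin_map :: "real \<Rightarrow> 'a::euclidean_space \<Rightarrow> 'a" where
  "sin_map L w = (\<Sum>i\<in>Basis. (L * sin ((w \<bullet> i) / L)) *\<^sub>R i)"

lemma trig_poly_polynomial_sin_map:
  assumes "real_polynomial_function p" shows "trig_poly (\<lambda>w::'a::euclidean_space. p (sin_map L w))"
  using assms
proof induction
  case (linear f)
  interpret bounded_linear f by fact
  have "trig_poly (\<lambda>w::'a. L * f i * cos ((i /\<^sub>R L) \<bullet> w + - (pi / 2)))" for i
    by (rule trig_poly.wave)
  moreover have "cos ((i /\<^sub>R L) \<bullet> w + - (pi / 2)) = sin ((w \<bullet> i) / L)" for i w :: 'a
  proof -
    have "cos (x + - (pi / 2)) = sin x" for x :: real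
      unfolding cos_add cos_minus sin_minus cos_pi_half sin_pi_half by (rule trans[of _ "0 - sin x * - 1"]) auto
    moreover have "(i /\<^sub>R L) \<bullet> w = (w \<bullet> i) / L"
      unfolding inner_scaleR_left inner_commute[of i w] by (rule divide_inverse_commute[symmetric])
    ultimately show ?thesis by (simp only:)
  qed
  ultimately have "trig_poly (\<lambda>w::'a. L * f i * sin ((w \<bullet> i) / L))" for i by (simp only:)
  then have "trig_poly (\<lambda>w::'a. \<Sum>i\<in>Basis. L * f i * sin ((w \<bullet> i) / L))" by (intro trig_poly_sum)
  then show ?case by (simp add: sin_map_def sum scaleR mult_ac)
qed (auto intro: trig_poly_const trig_poly.add trig_poly_mult)

text \<open>The range of \<open>sin_map\<close> lies in the cube on which the polynomial
  approximates \<open>f\<close>, so composing turns an error bound on the cube into a bound on the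
  whole space. The common bound is \<open>B + 1\<close> because all errors are below 1.\<close>

lemma trig_closure_continuous:
  fixes f :: "'a::euclidean_space \<Rightarrow> real"
  assumes f: "continuous_on UNIV f" and B: "\<And>w. \<bar>f w\<bar> \<le> B"
  shows "trig_closure f"
proof -
  define Q :: "nat \<Rightarrow> 'a set" where "Q k = cbox (- real (Suc k) *\<^sub>R One) (real (Suc k) *\<^sub>R One)" for k
  have "\<exists>p. real_polynomial_function p \<and> (\<forall>x\<in>Q k. \<bar>f x - p x\<bar> < inverse (real (Suc k)))" for k
  proof -
    obtain p where "real_polynomial_function p" "\<And>x. x \<in> Q k \<Longrightarrow> \<bar>f x - p x\<bar> < inverse (real (Suc k))"
      by (rule Stone_Weierstrass_real_polynomial_function[of "Q k" f "inverse (real (Suc k))"])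
        (auto simp: Q_def compact_cbox intro: continuous_on_subset[OF f])
    then show ?thesis by blast
  qed
  then obtain p where p: "\<And>k. real_polynomial_function (p k)"
    "\<And>k x. x \<in> Q k \<Longrightarrow> \<bar>f x - p k x\<bar> < inverse (real (Suc k))" by metis
  let ?S = "\<lambda>k. sin_map (real (Suc k)) :: 'a \<Rightarrow> 'a"
  have SQ: "?S k w \<in> Q k" for k w
  proof -
    have "\<bar>real (Suc k) * sin x\<bar> \<le> real (Suc k)" for x
      by (subst abs_mult) (simp add: mult_left_le)
    then have "- real (Suc k) \<le> real (Suc k) * sin x" "real (Suc k) * sin x \<le> real (Suc k)" for x
      by (metis abs_le_D2 minus_le_iff, metis abs_le_D1)
    then show ?thesis by (auto simp: Q_def sin_map_def mem_box)
  qed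
  have lim: "(\<lambda>k. ?S k w) \<longlonglongrightarrow> w" for w
  proof -
    have "(\<lambda>k. ?S k w) \<longlonglongrightarrow> (\<Sum>i\<in>Basis. (w \<bullet> i) *\<^sub>R i)"
      unfolding sin_map_def by (intro tendsto_intros scaled_sin_tendsto)
    then show ?thesis by (simp add: euclidean_representation)
  qed
  show ?thesis
  proof (rule trig_closure.lim[of "\<lambda>k w. p k (?S k w)" "B + 1"])
    show "trig_closure (\<lambda>w. p k (?S k w))" for k
      by (intro trig_closure.base trig_poly_polynomial_sin_map p)
    show "\<bar>p k (?S k w)\<bar> \<le> B + 1" for k w
    proof -
      have "inverse (real (Suc k)) \<le> 1" by (simp add: field_simps)
      with p(2)[OF SQ[of k w]] B[of "?S k w"] show ?thesis by linarith
    qed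
    show "(\<lambda>k. p k (?S k w)) \<longlonglongrightarrow> f w" for w
    proof -
      have "(\<lambda>k. f (?S k w) - p k (?S k w)) \<longlonglongrightarrow> 0"
        by (rule Lim_null_comparison[OF _ LIMSEQ_inverse_real_of_nat])
          (use p(2)[OF SQ] in \<open>auto intro!: always_eventually less_imp_le\<close>)
      moreover have "(\<lambda>k. f (?S k w)) \<longlonglongrightarrow> f w"
        by (rule continuous_on_tendsto_compose[OF f lim]) auto
      ultimately show ?thesis using tendsto_diff by fastforce
    qed
  qed
qed

lemma trig_closure_indicator_open:
  fixes U :: "'a::euclidean_space set"
  assumes "open U" shows "trig_closure (indicator U)"
\<comment> \<open>The distance to the empty set is 0 by convention, so the approximation by
  multiples of the distance to the complement would give the wrong limit for the whole
  space.\<close>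
proof (cases "U = UNIV")
  case True
  then show ?thesis using trig_closure_const[of 1] by (simp add: indicator_def)
next
  case False
  let ?g = "\<lambda>(k::nat) w. min 1 (real k * infdist w (- U))"
  show ?thesis
  proof (rule trig_closure.lim[of ?g 1])
    show "trig_closure (?g k)" for k
      by (rule trig_closure_continuous[of _ 1])
        (auto intro!: continuous_intros simp: infdist_nonneg)
    show "\<bar>?g k w\<bar> \<le> 1" for k w by (auto simp: infdist_nonneg)
    show "(\<lambda>k. ?g k w) \<longlonglongrightarrow> indicator U w" for w
    proof (cases "w \<in> U")
      case True
      then have pos: "infdist w (- U) > 0"
        using False assms by (metis Compl_empty_eq ComplD closed_Compl double_complement in_closed_iff_infdist_zero
            infdist_nonneg less_eq_real_def)
      obtain N where N: "real N * infdist w (- U) \<ge> 1"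
        using reals_Archimedean3[OF pos] by (meson less_imp_le)
      have "\<forall>\<^sub>F k in sequentially. ?g k w = 1"
        using eventually_ge_at_top[of N]
      proof eventually_elim
        case (elim k)
        have "real N * infdist w (- U) \<le> real k * infdist w (- U)"
          using elim pos by (intro mult_right_mono) auto
        with N show ?case by linarith
      qed
      then show ?thesis using True by (simp add: tendsto_eventually)
    next
      case False
      then show ?thesis by simp
    qed
  qed
qed

lemma trig_closure_indicator:
  fixes A :: "'a::euclidean_space set"
  assumes "A \<in> sets borel" shows "trig_closure (indicator A)"
proof -
  have "A \<in> sigma_sets UNIV {S. open S}" using assms by (simp add: borel_def)
  have G: "Int_stable {S::'a set. open S}" "{S::'a set. open S} \<subseteq> Pow UNIV" by (auto simp: Int_stable_def)
  from G \<open>A \<in> sigma_sets UNIV {S. open S}\<close> show ?thesis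
  proof (induction rule: sigma_sets_induct_disjoint)
    case (basic A)
    then show ?case using trig_closure_indicator_open by auto
  next
    case empty
    show ?case using trig_closure_const[of 0] by (simp add: indicator_def)
  next
    case (compl A)
    have "trig_closure (\<lambda>w. 1 + (- 1) * indicator A w :: real)"
      by (intro trig_closure_add trig_closure_mult trig_closure_const compl.IH)
    also have "(\<lambda>w. 1 + (- 1) * indicator A w :: real) = indicator (UNIV - A)"
      by (auto simp: indicator_def)
    finally show ?case .
  next
    case (union A)
    let ?B = "\<lambda>k. \<Union>i<k. A i"
    have ind: "indicator (?B k) w = (\<Sum>i<k. indicator (A i) w :: real)" for k w
      by (rule indicator_UN_disjoint) (use union(1) in \<open>auto simp: disjoint_family_on_def\<close>)
    have "trig_closure (\<lambda>w. \<Sum>i<k. indicator (A i) w :: real)" for k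
      by (induction k) (auto intro: trig_closure_const trig_closure_add union.IH)
    then have B: "trig_closure (indicator (?B k) :: 'a \<Rightarrow> real)" for k
      using ind[of k] by presburger
    show ?case
    proof (rule trig_closure.lim[OF B, where B = 1])
      show "\<bar>indicator (?B k) w :: real\<bar> \<le> 1" for k w by (auto simp: indicator_def)
      show "(\<lambda>k. indicator (?B k) w :: real) \<longlonglongrightarrow> indicator (\<Union>i. A i) w" for w
        by (rule LIMSEQ_indicator_UN)
    qed
  qed
qed

theorem trig_closure_borel:
  fixes f :: "'a::euclidean_space \<Rightarrow> real"
  assumes f: "f \<in> borel_measurable borel" and B: "\<And>w. \<bar>f w\<bar> \<le> B"
  shows "trig_closure f"
proof -
  \<comment> \<open>Boundedness is part of the induction claim: by nonnegativity and monotonicity, a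
    bound on the composed function is inherited by its summands and approximants.\<close>
  have nn: "(\<exists>B. \<forall>w. u w \<le> B) \<longrightarrow> trig_closure u" if "u \<in> borel_measurable borel" "\<And>w. 0 \<le> u w" for u :: "'a \<Rightarrow> real"
    using that
  proof (induction rule: borel_measurable_induct_real)
    case (set A)
    then show ?case using trig_closure_indicator by auto
  next
    case (mult u c)
    show ?case
    proof (cases "c = 0")
      case False
      with mult.hyps(1) have c: "c > 0" by simp
      show ?thesis
      proof
        assume "\<exists>B. \<forall>w. c * u w \<le> B"
        then obtain B where "\<And>w. c * u w \<le> B" by blast
        then have "u w \<le> B / c" for w using c by (simp add: field_simps)
        with mult.IH have "trig_closure u" by blast
        then show "trig_closure (\<lambda>w. c * u w)" by (intro trig_closure_mult trig_closure_const)
      qed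
    qed (auto intro: trig_closure_const)
  next
    case (add u v)
    show ?case
    proof
      assume "\<exists>B. \<forall>w. v w + u w \<le> B"
      then obtain B where B: "\<And>w. v w + u w \<le> B" by blast
      have "u w \<le> B" "v w \<le> B" for w
        using B[of w] add.hyps(2,4)[of w] by linarith+
      with add.IH show "trig_closure (\<lambda>w. v w + u w)" by (blast intro: trig_closure_add)
    qed
  next
    case (seq U)
    show ?case
    proof
      assume "\<exists>B. \<forall>w. u w \<le> B"
      then obtain B where B: "\<And>w. u w \<le> B" by blast
      have le: "U i w \<le> B" for i w
      proof -
        have "incseq (\<lambda>i. U i w)" using seq.hyps(3) by (auto simp: incseq_def le_fun_def)
        then have "U i w \<le> u w" using seq.hyps(4)[of w] by (intro incseq_le) auto
        with B[of w] show ?thesis by simp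
      qed
      show "trig_closure u"
      proof (rule trig_closure.lim[of U B])
        show "trig_closure (U k)" for k using seq.IH le by blast
        show "\<bar>U k w\<bar> \<le> B" for k w using le[of k w] seq.hyps(2)[of k w] by simp
        show "(\<lambda>k. U k w) \<longlonglongrightarrow> u w" for w using seq.hyps(4) by auto
      qed
    qed
  qed
  have "0 \<le> f w + B" "f w + B \<le> 2 * B" for w using B[of w] by auto
  moreover have "(\<lambda>w. f w + B) \<in> borel_measurable borel" using f by auto
  ultimately have "trig_closure (\<lambda>w. f w + B)" using nn[of "\<lambda>w. f w + B"] by metis
  from trig_closure_add[OF this trig_closure_const[of "- B"]] show ?thesis by simp
qed

section \<open>Measure-valued solutions of the Kolmogorov equation\<close>

lemma prob_space_integrable_borel:
  fixes f :: "'a::topological_space \<Rightarrow> real"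
  assumes "prob_space M" "sets M = sets borel" "f \<in> borel_measurable borel" "\<And>w. \<bar>f w\<bar> \<le> B"
  shows "integrable M f"
proof -
  interpret prob_space M by fact
  show ?thesis
    using assms(3,4) measurable_cong_sets[OF assms(2) refl, of borel]
    by (intro integrable_const_bound[of _ B]) auto
qed

lemma (in prob_space) integral_abs_le:
  fixes f :: "'a \<Rightarrow> real"
  assumes "\<And>w. \<bar>f w\<bar> \<le> B"
  shows "\<bar>\<integral>w. f w \<partial>M\<bar> \<le> B"
proof (cases "integrable M f")
  case True
  then have "\<bar>\<integral>w. f w \<partial>M\<bar> \<le> (\<integral>w. B \<partial>M)"
    using assms by (intro order_trans[OF integral_abs_bound] integral_mono) auto
  then show ?thesis by (simp add: prob_space)
next
  \<comment> \<open>A nonintegrable function has integral 0 by convention, and \<open>B\<close> is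
    nonnegative as a bound of an absolute value.\<close>
  case False
  then show ?thesis using order_trans[OF abs_ge_zero assms] by (simp add: not_integrable_integral_eq)
qed

lemma abs_mult_cutoff_le:
  assumes "\<bar>x\<bar> \<le> B" shows "\<bar>x * cutoff R w\<bar> \<le> B"
proof -
  have "\<bar>x\<bar> * cutoff R w \<le> B * 1"
    using assms by (intro mult_mono cutoff_le_1 cutoff_nonneg) auto
  then show ?thesis by (simp add: abs_mult cutoff_nonneg)
qed

lemma cutoff_measurable: "cutoff R \<in> borel_measurable borel"
  by (intro borel_measurable_continuous_onI smooth_fun_continuous cutoff_smooth)

text \<open>The bound on the drift is taken at least 1 so that it may appear in denominators, as in
  \<open>short_time\<close>.\<close>

locale kinetic =
  fixes \<sigma> \<tau> B\<^sub>v :: real and v :: "real ^ ('n::finite) \<Rightarrow> real ^ 'n"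
  assumes \<sigma>_pos: "\<sigma> > 0" and \<tau>_pos: "\<tau> > 0"
    and v_cont: "continuous_on UNIV v" and v_bound: "\<And>x. norm (v x) \<le> B\<^sub>v" and B\<^sub>v_ge_1: "1 \<le> B\<^sub>v"
begin

abbreviation L :: "('n state \<Rightarrow> real) \<Rightarrow> 'n state \<Rightarrow> real" where "L \<equiv> gen \<sigma> \<tau> v"

text \<open>The initial law is arbitrary, not a Dirac mass, so that time shifts, translates and
  mixtures of solutions are again solutions; uniqueness is applied to each of these.\<close>

definition evol :: "(real \<Rightarrow> 'n state measure) \<Rightarrow> bool" where
  "evol Q \<longleftrightarrow> (\<forall>t\<ge>0. prob_space (Q t) \<and> sets (Q t) = sets borel) \<and>
     (\<forall>f t. test_fun f \<longrightarrow> 0 \<le> t \<longrightarrow>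
       ((\<lambda>s. \<integral>w. L f w \<partial>Q s) has_integral ((\<integral>w. f w \<partial>Q t) - (\<integral>w. f w \<partial>Q 0))) {0..t})"

lemma evolD:
  assumes "evol Q"
  shows evol_prob: "0 \<le> t \<Longrightarrow> prob_space (Q t)"
    and evol_sets: "0 \<le> t \<Longrightarrow> sets (Q t) = sets borel"
    and evol_has_integral: "test_fun f \<Longrightarrow> 0 \<le> t \<Longrightarrow>
       ((\<lambda>s. \<integral>w. L f w \<partial>Q s) has_integral ((\<integral>w. f w \<partial>Q t) - (\<integral>w. f w \<partial>Q 0))) {0..t}"
  using assms by (auto simp: evol_def)

lemma evol_integrable:
  fixes f :: "'n state \<Rightarrow> real"
  assumes "evol Q" "0 \<le> t" "f \<in> borel_measurable borel" "\<And>w. \<bar>f w\<bar> \<le> B"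
  shows "integrable (Q t) f"
  by (rule prob_space_integrable_borel[OF evol_prob[OF assms(1,2)] evol_sets[OF assms(1,2)] assms(3,4)])

lemma evol_has_integral_between:
  assumes Q: "evol Q" and f: "test_fun f" and st: "0 \<le> s" "s \<le> t"
  shows "((\<lambda>r. \<integral>w. L f w \<partial>Q r) has_integral ((\<integral>w. f w \<partial>Q t) - (\<integral>w. f w \<partial>Q s))) {s..t}"
proof -
  let ?g = "\<lambda>r. \<integral>w. L f w \<partial>Q r"
  have 0: "?g integrable_on {0..t}" using evol_has_integral[OF Q f, of t] st by auto
  then have 1: "?g integrable_on {s..t}" by (rule integrable_subinterval_real) (use st in auto)
  have "integral {0..s} ?g + integral {s..t} ?g = integral {0..t} ?g"
    using 0 st by (intro Henstock_Kurzweil_Integration.integral_combine) auto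
  then have "integral {s..t} ?g = (\<integral>w. f w \<partial>Q t) - (\<integral>w. f w \<partial>Q s)"
    using integral_unique[OF evol_has_integral[OF Q f, of t]] integral_unique[OF evol_has_integral[OF Q f, of s]] st
    by auto
  with 1 show ?thesis by (metis integrable_integral)
qed

lemma evol_lipschitz:
  assumes Q: "evol Q" and f: "test_fun f" and B: "\<And>w. \<bar>L f w\<bar> \<le> B" and st: "0 \<le> s" "0 \<le> t"
  shows "\<bar>(\<integral>w. f w \<partial>Q t) - (\<integral>w. f w \<partial>Q s)\<bar> \<le> B * \<bar>t - s\<bar>"
proof -
  have B0: "0 \<le> B" using order_trans[OF abs_ge_zero B] .
  have *: "\<bar>(\<integral>w. f w \<partial>Q t) - (\<integral>w. f w \<partial>Q s)\<bar> \<le> B * (t - s)" if "0 \<le> s" "s \<le> t" for s t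
  proof -
    have "\<bar>\<integral>w. L f w \<partial>Q r\<bar> \<le> B" if "r \<in> {s..t}" for r
      using that \<open>0 \<le> s\<close> by (intro prob_space.integral_abs_le[OF evol_prob[OF Q]] B) auto
    with has_integral_bound_real[OF B0 finite.emptyI evol_has_integral_between[OF Q f that]] that show ?thesis
      by (auto simp: content_real)
  qed
  from *[of s t] *[of t s] st show ?thesis by (cases "s \<le> t") (auto simp: abs_minus_commute)
qed

lemma evol_continuous_test:
  assumes Q: "evol Q" and f: "test_fun f"
  shows "continuous_on {0..} (\<lambda>s. \<integral>w. f w \<partial>Q s)"
proof -
  obtain B where B: "\<And>w. \<bar>L f w\<bar> \<le> B" using test_fun_gen_bounded[OF f v_cont, of \<sigma> \<tau>] by blast
  have "(max B 0)-lipschitz_on {0..} (\<lambda>s. \<integral>w. f w \<partial>Q s)"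
  proof (rule lipschitz_onI)
    fix s t :: real assume st: "s \<in> {0..}" "t \<in> {0..}"
    have "B * \<bar>s - t\<bar> \<le> max B 0 * \<bar>s - t\<bar>" by (intro mult_right_mono) auto
    with evol_lipschitz[OF Q f B, of t s] st
    show "dist (\<integral>w. f w \<partial>Q s) (\<integral>w. f w \<partial>Q t) \<le> max B 0 * dist s t" by (auto simp: dist_real_def)
  qed auto
  then show ?thesis by (rule lipschitz_on_continuous_on)
qed

text \<open>Polynomials times the cutoff are test functions, and by Weierstrass they approximate
  \<open>g\<close> times the cutoff uniformly, hence uniformly in time after integration against
  probability measures.\<close>

lemma evol_continuous_cutoff:
  fixes g :: "'n state \<Rightarrow> real"
  assumes Q: "evol Q" and g: "continuous_on UNIV g" "\<And>w. \<bar>g w\<bar> \<le> B" and R: "R > 0"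
  shows "continuous_on {0..} (\<lambda>s. \<integral>w. g w * cutoff R w \<partial>Q s)"
proof -
  have "\<exists>p. real_polynomial_function p \<and> (\<forall>w\<in>cball 0 R. \<bar>g w - p w\<bar> < inverse (real (Suc k)))" for k
  proof -
    obtain p where "real_polynomial_function p" "\<And>w. w \<in> cball 0 R \<Longrightarrow> \<bar>g w - p w\<bar> < inverse (real (Suc k))"
      by (rule Stone_Weierstrass_real_polynomial_function[of "cball 0 R" g "inverse (real (Suc k))"])
        (auto intro: continuous_on_subset[OF g(1)])
    then show ?thesis by blast
  qed
  then obtain p where p: "\<And>k. real_polynomial_function (p k)"
    "\<And>k w. w \<in> cball 0 R \<Longrightarrow> \<bar>g w - p k w\<bar> < inverse (real (Suc k))" by metis
  let ?f = "\<lambda>k w. p k w * cutoff R w"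
  have test: "test_fun (?f k)" for k
    by (rule test_funI[OF smooth_fun_mult[OF smooth_fun_real_polynomial_function[OF p(1)] cutoff_smooth], of R])
      (simp add: cutoff_eq_0 R)
  have close: "\<bar>?f k w - g w * cutoff R w\<bar> \<le> inverse (real (Suc k))" for k w
  proof (cases "norm w < R")
    case True
    have "\<bar>?f k w - g w * cutoff R w\<bar> = \<bar>g w - p k w\<bar> * cutoff R w"
      by (simp add: left_diff_distrib[symmetric] abs_mult cutoff_nonneg abs_minus_commute)
    also have "\<dots> \<le> inverse (real (Suc k)) * 1"
      using True p(2)[of w k] by (intro mult_mono cutoff_nonneg cutoff_le_1) auto
    finally show ?thesis by simp
  qed (simp add: cutoff_eq_0 R)
  have meas: "(\<lambda>w. g w * cutoff R w) \<in> borel_measurable borel"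
    by (intro borel_measurable_continuous_onI continuous_intros g smooth_fun_continuous cutoff_smooth)
  have gR: "\<bar>g w * cutoff R w\<bar> \<le> B" for w
    by (rule abs_mult_cutoff_le[OF g(2)])
  have "uniform_limit {0..} (\<lambda>k s. \<integral>w. ?f k w \<partial>Q s) (\<lambda>s. \<integral>w. g w * cutoff R w \<partial>Q s) sequentially"
  proof (rule uniform_limitI)
    fix e :: real assume "e > 0"
    then have "\<forall>\<^sub>F k in sequentially. inverse (real (Suc k)) < e"
      using LIMSEQ_inverse_real_of_nat by (rule order_tendstoD(2)[rotated])
    then show "\<forall>\<^sub>F k in sequentially. \<forall>s\<in>{0..}. dist (\<integral>w. ?f k w \<partial>Q s) (\<integral>w. g w * cutoff R w \<partial>Q s) < e"
    proof eventually_elim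
      case (elim k)
      show ?case
      proof
        fix s :: real assume "s \<in> {0..}"
        then have s: "0 \<le> s" by simp
        obtain C where C: "\<And>w. \<bar>?f k w\<bar> \<le> C" using test_fun_gen_bounded[OF test v_cont, of \<sigma> \<tau> k] by blast
        have meask: "?f k \<in> borel_measurable borel"
          using test[of k] by (intro borel_measurable_continuous_onI smooth_fun_continuous) (auto simp: test_fun_def)
        have "(\<integral>w. ?f k w \<partial>Q s) - (\<integral>w. g w * cutoff R w \<partial>Q s) = (\<integral>w. ?f k w - g w * cutoff R w \<partial>Q s)"
          by (intro Bochner_Integration.integral_diff[symmetric] evol_integrable[OF Q s meask C] evol_integrable[OF Q s meas gR])
        also have "\<bar>\<dots>\<bar> \<le> inverse (real (Suc k))"
          by (intro prob_space.integral_abs_le[OF evol_prob[OF Q s]] close)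
        finally show "dist (\<integral>w. ?f k w \<partial>Q s) (\<integral>w. g w * cutoff R w \<partial>Q s) < e"
          using elim by (simp add: dist_real_def)
      qed
    qed
  qed
  then show ?thesis
    by (rule uniform_limit_theorem[rotated])
      (auto intro!: always_eventually evol_continuous_test[OF Q test])
qed

lemma cutoff_integral_tendsto:
  fixes g :: "'n state \<Rightarrow> real"
  assumes "prob_space M" "sets M = sets borel" "g \<in> borel_measurable borel" "\<And>w. \<bar>g w\<bar> \<le> B"
  shows "(\<lambda>k. \<integral>w. g w * cutoff (real (Suc k)) w \<partial>M) \<longlonglongrightarrow> (\<integral>w. g w \<partial>M)"
proof -
  interpret prob_space M by fact
  have meas: "(\<lambda>w::'n state. cutoff R w) \<in> borel_measurable borel" for R :: real
    by (intro borel_measurable_continuous_onI smooth_fun_continuous cutoff_smooth)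
  have lim: "(\<lambda>k. cutoff (real (Suc k)) w) \<longlonglongrightarrow> 1" for w :: "'n state"
    by (rule filterlim_compose[OF cutoff_tendsto]) 
      (rule filterlim_compose[OF filterlim_real_sequentially filterlim_Suc])
  show ?thesis
  proof (rule integral_dominated_convergence[where w = "\<lambda>_. B"])
    show "g \<in> borel_measurable M" "(\<lambda>w. g w * cutoff (real (Suc k)) w) \<in> borel_measurable M" for k
      using assms(3) meas by (auto cong: measurable_cong_sets simp: measurable_cong_sets[OF assms(2) refl])
    show "AE w in M. (\<lambda>k. g w * cutoff (real (Suc k)) w) \<longlonglongrightarrow> g w"
      using tendsto_mult[OF tendsto_const lim] by auto
    show "AE w in M. norm (g w * cutoff (real (Suc k)) w) \<le> B" for k
      unfolding real_norm_def by (intro AE_I2 abs_mult_cutoff_le[OF assms(4)])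
  qed auto
qed

text \<open>Continuity is known only after cutting off. A cutoff carrying almost all mass at
  \<open>s0\<close> does so at nearby times too, because its own integral is continuous; no mass
  escapes to infinity locally in time, so the cutoff can be removed.\<close>

lemma evol_weakly_continuous:
  fixes g :: "'n state \<Rightarrow> real"
  assumes Q: "evol Q" and g: "continuous_on UNIV g" "\<And>w. \<bar>g w\<bar> \<le> B"
  shows "continuous_on {0..} (\<lambda>s. \<integral>w. g w \<partial>Q s)"
  unfolding continuous_on_iff
proof (intro ballI allI impI)
  fix s0 e :: real assume "s0 \<in> {0..}" "0 < e"
  then have s0: "0 \<le> s0" and e: "e > 0" by auto
  have B0: "0 \<le> B" using order_trans[OF abs_ge_zero g(2)] .
  \<comment> \<open>Two tails of size \<open>B * \<delta>\<close> and one cutoff difference of size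
    \<delta> then add up to e / 2.\<close>
  define \<delta> where "\<delta> = e / (4 * B + 2)"
  have \<delta>: "\<delta> > 0" using e B0 by (auto simp: \<delta>_def)
  have meas: "g \<in> borel_measurable borel" using g by (intro borel_measurable_continuous_onI)
  have "(\<lambda>k. \<integral>w. 1 * cutoff (real (Suc k)) w \<partial>Q s0) \<longlonglongrightarrow> (\<integral>w. 1 \<partial>Q s0)"
    by (rule cutoff_integral_tendsto[OF evol_prob[OF Q s0] evol_sets[OF Q s0], where B = 1]) auto
  then have "(\<lambda>k. \<integral>w. cutoff (real (Suc k)) w \<partial>Q s0) \<longlonglongrightarrow> 1"
    using prob_space.prob_space[OF evol_prob[OF Q s0]] by simp
  from order_tendstoD(1)[OF this, of "1 - \<delta>"] \<delta>
  obtain k where "1 - \<delta> < (\<integral>w. cutoff (real (Suc k)) w \<partial>Q s0)" 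
    by (force simp: eventually_sequentially)
  define R where "R = real (Suc k)"
  have R: "R > 0" and R\<delta>: "1 - \<delta> < (\<integral>w. cutoff R w \<partial>Q s0)"
    using \<open>1 - \<delta> < _\<close> by (auto simp: R_def)
  have "continuous_on {0..} (\<lambda>s. \<integral>w. cutoff R w \<partial>Q s)"
    by (rule evol_continuous_test[OF Q cutoff_test_fun[OF R]])
  then have "((\<lambda>s. \<integral>w. cutoff R w \<partial>Q s) \<longlongrightarrow> (\<integral>w. cutoff R w \<partial>Q s0)) (at s0 within {0..})"
    using s0 by (simp add: continuous_on)
  from order_tendstoD(1)[OF this R\<delta>]
  have ev1: "\<forall>\<^sub>F s in at s0 within {0..}. 1 - \<delta> < (\<integral>w. cutoff R w \<partial>Q s)" .
  have "((\<lambda>s. \<integral>w. g w * cutoff R w \<partial>Q s) \<longlongrightarrow> (\<integral>w. g w * cutoff R w \<partial>Q s0)) (at s0 within {0..})"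
    using evol_continuous_cutoff[OF Q g R] s0 by (simp add: continuous_on)
  from tendstoD[OF this \<delta>]
  have ev2: "\<forall>\<^sub>F s in at s0 within {0..}. dist (\<integral>w. g w * cutoff R w \<partial>Q s) (\<integral>w. g w * cutoff R w \<partial>Q s0) < \<delta>" .
  have tail: "\<bar>(\<integral>w. g w \<partial>Q s) - (\<integral>w. g w * cutoff R w \<partial>Q s)\<bar> \<le> B * \<delta>"
    if s: "0 \<le> s" and *: "1 - \<delta> < (\<integral>w. cutoff R w \<partial>Q s)" for s
  proof -
    interpret prob_space "Q s" by (rule evol_prob[OF Q s])
    note int = evol_integrable[OF Q s]
    have c1: "\<bar>cutoff R w\<bar> \<le> 1" for w :: "'n state" using cutoff_nonneg[of R w] cutoff_le_1[of R w] by simp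
    have ig: "integrable (Q s) g" "integrable (Q s) (cutoff R)" "integrable (Q s) (\<lambda>w. g w * cutoff R w)"
      using int[OF meas g(2)] int[OF cutoff_measurable c1]
        int[OF borel_measurable_times[OF meas cutoff_measurable] abs_mult_cutoff_le[OF g(2)]] by blast+
    have "(\<integral>w. g w \<partial>Q s) - (\<integral>w. g w * cutoff R w \<partial>Q s) = (\<integral>w. g w * (1 - cutoff R w) \<partial>Q s)"
      using ig by (simp add: right_diff_distrib)
    also have "\<bar>\<dots>\<bar> \<le> (\<integral>w. \<bar>g w * (1 - cutoff R w)\<bar> \<partial>Q s)" by (rule integral_abs_bound)
    also have "\<dots> \<le> (\<integral>w. B * (1 - cutoff R w) \<partial>Q s)"
    proof (rule integral_mono)
      show "integrable (Q s) (\<lambda>w. \<bar>g w * (1 - cutoff R w)\<bar>)" "integrable (Q s) (\<lambda>w. B * (1 - cutoff R w))"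
        using ig by (auto simp: right_diff_distrib)
      show "\<bar>g w * (1 - cutoff R w)\<bar> \<le> B * (1 - cutoff R w)" for w
        using g(2)[of w] cutoff_le_1[of R w] by (simp add: abs_mult mult_right_mono)
    qed
    also have "\<dots> = B * (1 - (\<integral>w. cutoff R w \<partial>Q s))"
      using ig by (simp add: prob_space)
    also have "\<dots> \<le> B * \<delta>" using * B0 by (intro mult_left_mono) auto
    finally show ?thesis .
  qed
  have nonneg: "\<forall>\<^sub>F s in at s0 within {0..}. 0 \<le> s" by (simp add: eventually_at_filter)
  have "\<forall>\<^sub>F s in at s0 within {0..}. dist (\<integral>w. g w \<partial>Q s) (\<integral>w. g w \<partial>Q s0) < e"
    using ev1 ev2 nonneg
  proof eventually_elim
    case (elim s)
    have "(2 * B + 1) * \<delta> = e / 2" using B0 by (simp add: \<delta>_def field_simps)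
    then have "2 * (B * \<delta>) + \<delta> < e" using e by (simp add: algebra_simps)
    with tail[of s] tail[OF s0 R\<delta>] elim show ?case by (auto simp: dist_real_def)
  qed
  then obtain d where "d > 0" "\<And>s. s \<in> {0..} \<Longrightarrow> s \<noteq> s0 \<Longrightarrow> dist s s0 < d \<Longrightarrow> dist (\<integral>w. g w \<partial>Q s) (\<integral>w. g w \<partial>Q s0) < e"
    by (auto simp: eventually_at)
  then show "\<exists>d>0. \<forall>s\<in>{0..}. dist s s0 < d \<longrightarrow> dist (\<integral>w. g w \<partial>Q s) (\<integral>w. g w \<partial>Q s0) < e"
    using e by (metis dist_self)
qed

text \<open>Weak continuity applied to \<open>L f\<close> makes the integrand of the Kolmogorov
  equation continuous, so its integral form can be differentiated at every time.\<close>

lemma evol_has_derivative: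
  assumes Q: "evol Q" and f: "test_fun f" and s: "s \<in> {0..T}"
  shows "((\<lambda>s. \<integral>w. f w \<partial>Q s) has_real_derivative (\<integral>w. L f w \<partial>Q s)) (at s within {0..T})"
proof -
  obtain B where B: "\<And>w. \<bar>L f w\<bar> \<le> B" using test_fun_gen_bounded[OF f v_cont, of \<sigma> \<tau>] by blast
  have c: "continuous_on UNIV (L f)"
    using f by (intro continuous_on_gen v_cont) (simp add: test_fun_def)
  let ?g = "\<lambda>s. \<integral>w. L f w \<partial>Q s"
  have "continuous_on {0..T} ?g"
    by (rule continuous_on_subset[OF evol_weakly_continuous[OF Q c B]]) auto
  from integral_has_real_derivative[OF this s]
  have "((\<lambda>x. (\<integral>w. f w \<partial>Q 0) + integral {0..x} ?g) has_real_derivative ?g s) (at s within {0..T})"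
    by (auto intro!: derivative_eq_intros)
  then show ?thesis
    by (rule has_field_derivative_transform_within[where d = 1])
      (use s integral_unique[OF evol_has_integral[OF Q f]] in auto)
qed

end

section \<open>Time-dependent observables\<close>

context kinetic begin

lemma evol_has_integral_time_compact:
  fixes F F' :: "real \<Rightarrow> 'n state \<Rightarrow> real"
  assumes Q: "evol Q" and T: "0 \<le> T"
    and smooth: "\<And>s. smooth_fun (F s)"
    and supp: "\<And>s w. norm w \<ge> R \<Longrightarrow> F s w = 0"
    and deriv: "\<And>s w. ((\<lambda>s. F s w) has_real_derivative F' s w) (at s)"
    and cont: "continuous_on UNIV (\<lambda>(s, w). F' s w)"
  shows "((\<lambda>s. \<integral>w. F' s w + L (F s) w \<partial>Q s) has_integral
     ((\<integral>w. F T w \<partial>Q T) - (\<integral>w. F 0 w \<partial>Q 0))) {0..T}"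
proof (rule fundamental_theorem_of_calculus[OF T])
  fix s0 assume s0: "s0 \<in> {0..T}"
  have test: "test_fun (F s)" for s by (rule test_funI[OF smooth supp])
  have F'0: "F' s w = 0" if "norm w \<ge> R" for s w
  proof -
    have "((\<lambda>s. F s w) has_real_derivative 0) (at s)" using supp[OF that] by simp
    with deriv[of w s] show ?thesis by (metis DERIV_unique)
  qed
  have F'c: "continuous_on UNIV (F' s)" for s
    using continuous_on_compose2[OF cont, of UNIV "\<lambda>w. (s, w)"] by (simp add: continuous_on_Pair)
  have F'b: "\<exists>B. \<forall>w. \<bar>F' s w\<bar> \<le> B" for s
  proof -
    have "bounded (F' s ` cball 0 R)"
      by (intro compact_imp_bounded compact_continuous_image continuous_on_subset[OF F'c]) auto
    then obtain B where "\<forall>x\<in>F' s ` cball 0 R. norm x \<le> B" unfolding bounded_iff by blast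
    then have B: "\<bar>F' s w\<bar> \<le> B" if "w \<in> cball 0 R" for w using that by (metis image_eqI real_norm_def)
    have "\<bar>F' s w\<bar> \<le> max B 0" for w using B[of w] F'0[of w s] by (cases "norm w \<le> R") auto
    then show ?thesis by blast
  qed
  then obtain B where B: "\<And>w. \<bar>F' s0 w\<bar> \<le> B" by blast
  have F'm: "F' s0 \<in> borel_measurable borel" by (intro borel_measurable_continuous_onI F'c)
  have Fm: "F s \<in> borel_measurable borel" for s
    by (intro borel_measurable_continuous_onI smooth_fun_continuous smooth)
  have Fb: "\<exists>B. \<forall>w. \<bar>F s w\<bar> \<le> B" for s using test_fun_gen_bounded[OF test v_cont] by blast
  \<comment> \<open>It must be small uniformly in \<open>w\<close>, since it is integrated against
    \<open>Q s\<close> with \<open>s\<close> moving. The mean value theorem and uniform continuity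
    of \<open>F'\<close> on a compact set give this; outside the ball everything vanishes.\<close>
  define E where "E s w = (F s w - F s0 w) / (s - s0) - F' s0 w" for s w
  have E: "\<forall>\<^sub>F s in at s0. \<forall>w. \<bar>E s w\<bar> \<le> e" if "e > 0" for e
  proof -
    let ?K = "{s0 - 1..s0 + 1} \<times> cball (0::'n state) R"
    have "uniformly_continuous_on ?K (\<lambda>(s, w). F' s w)"
      by (intro compact_uniformly_continuous continuous_on_subset[OF cont] compact_Times) auto
    from this[unfolded uniformly_continuous_on_def, rule_format, OF that]
    obtain d where d: "d > 0" "\<And>p q. p \<in> ?K \<Longrightarrow> q \<in> ?K \<Longrightarrow> dist q p < d \<Longrightarrow>
        dist (case q of (s, w) \<Rightarrow> F' s w) (case p of (s, w) \<Rightarrow> F' s w) < e" by metis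
    have unif: "\<bar>F' s w - F' s0 w\<bar> \<le> e" if "\<bar>s - s0\<bar> < min d 1" for s w
    proof (cases "norm w \<le> R")
      case True
      have "dist (s, w) (s0, w) = \<bar>s - s0\<bar>" by (simp add: dist_Pair_Pair dist_real_def)
      then show ?thesis using d(2)[of "(s0, w)" "(s, w)"] True that by (auto simp: dist_real_def abs_if split: if_splits)
    qed (use F'0 that \<open>e > 0\<close> in auto)
    have "\<bar>E s w\<bar> \<le> e" if s: "s \<noteq> s0" "dist s s0 < min d 1" for s w
    proof -
      have "\<exists>r. \<bar>r - s0\<bar> \<le> \<bar>s - s0\<bar> \<and> F s w - F s0 w = (s - s0) * F' r w"
      proof (cases "s < s0")
        case True
        from MVT2[OF True, of "\<lambda>s. F s w" "\<lambda>s. F' s w"] deriv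
        obtain r where "s < r" "r < s0" "F s0 w - F s w = (s0 - s) * F' r w" by blast
        then show ?thesis by (intro exI[of _ r]) (auto simp: algebra_simps)
      next
        case False
        then have "s0 < s" using s by simp
        from MVT2[OF this, of "\<lambda>s. F s w" "\<lambda>s. F' s w"] deriv
        obtain r where "s0 < r" "r < s" "F s w - F s0 w = (s - s0) * F' r w" by blast
        then show ?thesis by (intro exI[of _ r]) auto
      qed
      then obtain r where r: "\<bar>r - s0\<bar> \<le> \<bar>s - s0\<bar>" "F s w - F s0 w = (s - s0) * F' r w" by blast
      then have "E s w = F' r w - F' s0 w" using s by (simp add: E_def)
      with unif[of r w] r s show ?thesis by (auto simp: dist_real_def)
    qed
    then show ?thesis
      unfolding eventually_at using d(1) by (intro exI[of _ "min d 1"]) auto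
  qed
  have nonneg: "\<forall>\<^sub>F s in at s0 within {0..T}. s \<in> {0..T} \<and> s \<noteq> s0" by (simp add: eventually_at_filter)
  have lim1: "((\<lambda>s. \<integral>w. E s w \<partial>Q s) \<longlongrightarrow> 0) (at s0 within {0..T})"
  proof (rule tendstoI)
    fix e :: real assume "e > 0"
    then have "\<forall>\<^sub>F s in at s0 within {0..T}. \<forall>w. \<bar>E s w\<bar> \<le> e / 2"
      using E[of "e / 2"] by (auto intro: filter_leD[OF at_le])
    with nonneg show "\<forall>\<^sub>F s in at s0 within {0..T}. dist (\<integral>w. E s w \<partial>Q s) 0 < e"
    proof eventually_elim
      case (elim s)
      then have "\<bar>\<integral>w. E s w \<partial>Q s\<bar> \<le> e / 2"
        by (intro prob_space.integral_abs_le[OF evol_prob[OF Q]]) auto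
      with \<open>e > 0\<close> show ?case by simp
    qed
  qed
  have lim2: "((\<lambda>s. \<integral>w. F' s0 w \<partial>Q s) \<longlongrightarrow> (\<integral>w. F' s0 w \<partial>Q s0)) (at s0 within {0..T})"
    using continuous_on_subset[OF evol_weakly_continuous[OF Q F'c B], of "{0..T}"] s0
    by (simp add: continuous_on)
  have lim3: "((\<lambda>s. ((\<integral>w. F s0 w \<partial>Q s) - (\<integral>w. F s0 w \<partial>Q s0)) / (s - s0)) \<longlongrightarrow> (\<integral>w. L (F s0) w \<partial>Q s0))
      (at s0 within {0..T})"
    using evol_has_derivative[OF Q test s0] by (simp add: has_field_derivative_iff)
  have Lb: "integrable (Q s0) (L (F s0))"
  proof -
    obtain C where "\<And>w. \<bar>L (F s0) w\<bar> \<le> C" using test_fun_gen_bounded[OF test v_cont] by blast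
    then show ?thesis
      using s0 by (intro evol_integrable[OF Q] borel_measurable_continuous_onI continuous_on_gen smooth v_cont) auto
  qed
  have eq: "(\<integral>w. E s w \<partial>Q s) + (\<integral>w. F' s0 w \<partial>Q s) + ((\<integral>w. F s0 w \<partial>Q s) - (\<integral>w. F s0 w \<partial>Q s0)) / (s - s0)
     = ((\<integral>w. F s w \<partial>Q s) - (\<integral>w. F s0 w \<partial>Q s0)) / (s - s0)" if "s \<in> {0..T} \<and> s \<noteq> s0" for s
  proof -
    have s: "0 \<le> s" using that by simp
    obtain B1 B2 where B12: "\<And>w. \<bar>F s w\<bar> \<le> B1" "\<And>w. \<bar>F s0 w\<bar> \<le> B2" using Fb by metis
    have int: "integrable (Q s) (F s)" "integrable (Q s) (F s0)" "integrable (Q s) (F' s0)"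
      using evol_integrable[OF Q s Fm B12(1)] evol_integrable[OF Q s Fm B12(2)] evol_integrable[OF Q s F'm B] by blast+
    then show ?thesis unfolding E_def by (simp add: diff_divide_distrib)
  qed
  have "((\<lambda>s. ((\<integral>w. F s w \<partial>Q s) - (\<integral>w. F s0 w \<partial>Q s0)) / (s - s0)) \<longlongrightarrow>
      0 + (\<integral>w. F' s0 w \<partial>Q s0) + (\<integral>w. L (F s0) w \<partial>Q s0)) (at s0 within {0..T})"
    using tendsto_add[OF tendsto_add[OF lim1 lim2] lim3]
    by (rule Lim_transform_eventually) (use nonneg eq in \<open>auto elim!: eventually_mono\<close>)
  moreover have "(\<integral>w. F' s0 w + L (F s0) w \<partial>Q s0) = (\<integral>w. F' s0 w \<partial>Q s0) + (\<integral>w. L (F s0) w \<partial>Q s0)"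
    using s0 by (intro Bochner_Integration.integral_add Lb evol_integrable[OF Q _ F'm B]) auto
  ultimately have "((\<lambda>s. \<integral>w. F s w \<partial>Q s) has_real_derivative (\<integral>w. F' s0 w + L (F s0) w \<partial>Q s0)) (at s0 within {0..T})"
    by (simp add: has_field_derivative_iff)
  then show "((\<lambda>s. \<integral>w. F s w \<partial>Q s) has_vector_derivative (\<integral>w. F' s0 w + L (F s0) w \<partial>Q s0)) (at s0 within {0..T})"
    by (simp add: has_real_derivative_iff_has_vector_derivative)
qed

text \<open>Here \<open>G = (\<partial>\<^sub>s + L) F\<close>. Only this combination has to be bounded: for plane waves \<open>\<partial>\<^sub>s F\<close> and \<open>L F\<close> grow
  linearly in \<open>y\<close>, and no moment bounds are available at this stage.\<close>

definition obs_with :: "real \<Rightarrow> (real \<Rightarrow> 'n state \<Rightarrow> real) \<Rightarrow> (real \<Rightarrow> 'n state \<Rightarrow> real)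
    \<Rightarrow> (real \<Rightarrow> 'n state \<Rightarrow> real) \<Rightarrow> real \<Rightarrow> bool" where
  "obs_with T F F' G C \<longleftrightarrow> (\<forall>s. smooth_fun (F s)) \<and>
     (\<forall>s w. ((\<lambda>s. F s w) has_real_derivative F' s w) (at s)) \<and>
     continuous_on UNIV (\<lambda>(s, w). F s w) \<and> continuous_on UNIV (\<lambda>(s, w). F' s w) \<and>
     (\<forall>s w. G s w = F' s w + L (F s) w) \<and> 0 \<le> C \<and>
     (\<forall>s\<in>{0..T}. \<forall>w. \<bar>F s w\<bar> \<le> C \<and> norm (grad_y (F s) w) \<le> C \<and> \<bar>G s w\<bar> \<le> C)"

definition obs :: "real \<Rightarrow> (real \<Rightarrow> 'n state \<Rightarrow> real) \<Rightarrow> (real \<Rightarrow> 'n state \<Rightarrow> real) \<Rightarrow> bool" where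
  "obs T F G \<longleftrightarrow> (\<exists>F' C. obs_with T F F' G C)"

lemma obs_withD:
  assumes "obs_with T F F' G C"
  shows "smooth_fun (F s)" "((\<lambda>s. F s w) has_real_derivative F' s w) (at s)"
    "continuous_on UNIV (\<lambda>(s, w). F s w)" "continuous_on UNIV (\<lambda>(s, w). F' s w)"
    "G s w = F' s w + L (F s) w" "0 \<le> C" "s \<in> {0..T} \<Longrightarrow> \<bar>F s w\<bar> \<le> C"
    "s \<in> {0..T} \<Longrightarrow> norm (grad_y (F s) w) \<le> C" "s \<in> {0..T} \<Longrightarrow> \<bar>G s w\<bar> \<le> C"
  using assms unfolding obs_with_def by blast+

lemma obsI:
  assumes "\<And>s. smooth_fun (F s)" "\<And>s w. ((\<lambda>s. F s w) has_real_derivative F' s w) (at s)"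
    "continuous_on UNIV (\<lambda>p. F (fst p) (snd p))" "continuous_on UNIV (\<lambda>p. F' (fst p) (snd p))"
    "\<And>s w. G s w = F' s w + L (F s) w" "0 \<le> C" "\<And>s w. s \<in> {0..T} \<Longrightarrow> \<bar>F s w\<bar> \<le> C"
    "\<And>s w. s \<in> {0..T} \<Longrightarrow> norm (grad_y (F s) w) \<le> C" "\<And>s w. s \<in> {0..T} \<Longrightarrow> \<bar>G s w\<bar> \<le> C"
  shows "obs T F G"
  unfolding obs_def
  unfolding obs_with_def split_beta'
  by (intro exI[of _ F'] exI[of _ C] conjI allI ballI) (rule assms; assumption?)+

lemma obs_smooth: "obs T F G \<Longrightarrow> smooth_fun (F s)"
  by (auto simp: obs_def obs_with_def)

lemma obs_measurable:
  assumes "obs T F G"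
  shows "F s \<in> borel_measurable borel" "G s \<in> borel_measurable borel"
    "grad_y (F s) \<in> borel_measurable borel"
proof -
  from assms obtain F' where F': "continuous_on UNIV (\<lambda>(s, w). F' s w)" "\<And>s. G s = (\<lambda>w. F' s w + L (F s) w)"
    by (auto simp: obs_def obs_with_def fun_eq_iff)
  have "continuous_on UNIV (F' s)"
    using continuous_on_compose2[OF F'(1), of UNIV "\<lambda>w. (s, w)"] by (simp add: continuous_on_Pair)
  then show "G s \<in> borel_measurable borel"
    unfolding F'(2)
    by (intro borel_measurable_continuous_onI continuous_on_add continuous_on_gen v_cont obs_smooth[OF assms])
  show "F s \<in> borel_measurable borel" "grad_y (F s) \<in> borel_measurable borel"
    by (intro borel_measurable_continuous_onI smooth_fun_continuous continuous_on_grad_y obs_smooth[OF assms])+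
qed

lemma obs_add:
  assumes "obs T F G" "obs T H K"
  shows "obs T (\<lambda>s w. F s w + H s w) (\<lambda>s w. G s w + K s w)"
proof -
  from assms(1) obtain F' C where "obs_with T F F' G C" by (auto simp: obs_def)
  note F = obs_withD[OF this]
  from assms(2) obtain H' D where "obs_with T H H' K D" by (auto simp: obs_def)
  note H = obs_withD[OF this]
  have c: "continuous_on UNIV (\<lambda>p. F (fst p) (snd p) + H (fst p) (snd p))"
    "continuous_on UNIV (\<lambda>p. F' (fst p) (snd p) + H' (fst p) (snd p))"
    using F(3,4) H(3,4) by (auto intro!: continuous_on_add simp: split_beta')
  have bd: "\<bar>F s w + H s w\<bar> \<le> C + D" "norm (grad_y (\<lambda>w. F s w + H s w) w) \<le> C + D" "\<bar>G s w + K s w\<bar> \<le> C + D"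
    if "s \<in> {0..T}" for s w
    using F(7-9)[OF that, of w] H(7-9)[OF that, of w] norm_triangle_ineq[of "grad_y (F s) w" "grad_y (H s) w"]
    by (auto simp: grad_y_add[OF F(1) H(1)])
  show ?thesis
    by (rule obsI[where F' = "\<lambda>s w. F' s w + H' s w" and C = "C + D", OF smooth_fun_add[OF F(1) H(1)]
        DERIV_add[OF F(2) H(2)] c _ add_nonneg_nonneg[OF F(6) H(6)] bd])
      (simp_all add: gen_add[OF F(1) H(1)] F(5) H(5))
qed

lemma obs_mult:
  assumes "obs T F G" "obs T H K"
  shows "obs T (\<lambda>s w. F s w * H s w)
    (\<lambda>s w. F s w * K s w + H s w * G s w + \<sigma>\<^sup>2 / \<tau> * (grad_y (F s) w \<bullet> grad_y (H s) w))"
proof -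
  from assms(1) obtain F' C where "obs_with T F F' G C" by (auto simp: obs_def)
  note F = obs_withD[OF this]
  from assms(2) obtain H' D where "obs_with T H H' K D" by (auto simp: obs_def)
  note H = obs_withD[OF this]
  have c: "continuous_on UNIV (\<lambda>p. F (fst p) (snd p) * H (fst p) (snd p))"
    "continuous_on UNIV (\<lambda>p. F (fst p) (snd p) * H' (fst p) (snd p) + F' (fst p) (snd p) * H (fst p) (snd p))"
    using F(3,4) H(3,4) by (auto intro!: continuous_on_add continuous_on_mult simp: split_beta')
  let ?E = "C * D + C * D + \<sigma>\<^sup>2 / \<tau> * (C * D)"
  have E: "0 \<le> C * D" "0 \<le> \<sigma>\<^sup>2 / \<tau> * (C * D)" using F(6) H(6) \<tau>_pos by auto
  have bd: "\<bar>F s w * H s w\<bar> \<le> ?E" (is ?A) "norm (grad_y (\<lambda>w. F s w * H s w) w) \<le> ?E" (is ?B)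
    "\<bar>F s w * K s w + H s w * G s w + \<sigma>\<^sup>2 / \<tau> * (grad_y (F s) w \<bullet> grad_y (H s) w)\<bar> \<le> ?E" (is ?C)
    if "s \<in> {0..T}" for s w
  proof -
    note b = F(7-9)[OF that, of w] H(7-9)[OF that, of w]
    have 1: "\<bar>F s w * H s w\<bar> \<le> C * D" unfolding abs_mult by (intro mult_mono b F H) auto
    then show ?A using E by linarith
    have "\<bar>F s w\<bar> * norm (grad_y (H s) w) \<le> C * D" "\<bar>H s w\<bar> * norm (grad_y (F s) w) \<le> D * C"
      by (intro mult_mono b F H norm_ge_zero abs_ge_zero)+
    then have "norm (grad_y (\<lambda>w. F s w * H s w) w) \<le> C * D + C * D"
      unfolding grad_y_mult[OF F(1) H(1)] by (intro order_trans[OF norm_triangle_ineq] add_mono) (auto simp: mult.commute)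
    then show ?B using E by linarith
    have "\<bar>F s w * K s w\<bar> \<le> C * D" "\<bar>H s w * G s w\<bar> \<le> D * C" unfolding abs_mult by (intro mult_mono b F H abs_ge_zero)+
    moreover have "\<bar>grad_y (F s) w \<bullet> grad_y (H s) w\<bar> \<le> C * D"
      by (intro order_trans[OF Cauchy_Schwarz_ineq2] mult_mono b F H norm_ge_zero)
    then have "\<bar>\<sigma>\<^sup>2 / \<tau> * (grad_y (F s) w \<bullet> grad_y (H s) w)\<bar> \<le> \<sigma>\<^sup>2 / \<tau> * (C * D)"
      unfolding abs_mult using \<tau>_pos by (intro mult_mono) auto
    ultimately show ?C using mult.commute[of D C] by linarith
  qed
  show ?thesis
    by (rule obsI[where F' = "\<lambda>s w. F s w * H' s w + F' s w * H s w" and C = ?E, OF smooth_fun_mult[OF F(1) H(1)]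
        DERIV_mult'[OF F(2) H(2)] c _ _ bd])
      (use E in \<open>simp_all add: gen_mult[OF F(1) H(1)] F(5) H(5) algebra_simps\<close>)
qed

lemma obs_time:
  assumes "\<And>s. (\<alpha> has_real_derivative \<alpha>' s) (at s)" "continuous_on UNIV \<alpha>'"
  shows "obs T (\<lambda>s w. \<alpha> s) (\<lambda>s w. \<alpha>' s)"
proof -
  have c: "continuous_on UNIV \<alpha>"
    by (meson assms(1) continuous_at_imp_continuous_on DERIV_isCont)
  have "bounded (\<alpha> ` {0..T})" "bounded (\<alpha>' ` {0..T})"
    by (intro compact_imp_bounded compact_continuous_image continuous_on_subset[OF c]
        continuous_on_subset[OF assms(2)]; simp)+
  then obtain A B where "\<And>s. s \<in> {0..T} \<Longrightarrow> \<bar>\<alpha> s\<bar> \<le> A" "\<And>s. s \<in> {0..T} \<Longrightarrow> \<bar>\<alpha>' s\<bar> \<le> B"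
    by (force simp: bounded_iff)
  then have "\<bar>\<alpha> s\<bar> \<le> max 0 (max A B) \<and>
      norm (grad_y (\<lambda>w. \<alpha> s) (w :: 'n state)) \<le> max 0 (max A B) \<and> \<bar>\<alpha>' s\<bar> \<le> max 0 (max A B)"
      if "s \<in> {0..T}" for s w using that
    by (auto simp: grad_y_const le_max_iff_disj)
  moreover have "continuous_on UNIV (\<lambda>p :: real \<times> 'n state. \<alpha> (fst p))" "continuous_on UNIV (\<lambda>p :: real \<times> 'n state. \<alpha>' (fst p))"
    by (rule continuous_on_compose2[OF c] continuous_on_compose2[OF assms(2)]; auto intro: continuous_intros)+
  ultimately show ?thesis
    by (intro obsI[where F' = "\<lambda>s w. \<alpha>' s" and C = "max 0 (max A B)"]) (simp_all add: assms smooth_fun_const gen_const)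
qed

lemma obs_cmult: "obs T F G \<Longrightarrow> obs T (\<lambda>s w. c * F s w) (\<lambda>s w. c * G s w)"
  using obs_mult[OF obs_time[of "\<lambda>_. c" "\<lambda>_. 0"], of T F G] by (simp add: grad_y_const)

text \<open>Multiplication by a cutoff reduces to compact support. The terms in which the generator
  or the gradient hits the cutoff are bounded and vanish pointwise in the limit; the remaining term
  is \<open>G\<close> times the cutoff, so the possibly unbounded \<open>F'\<close> and
  \<open>L (F s)\<close> never have to be dominated separately.\<close>

theorem obs_has_integral:
  assumes Q: "evol Q" and T: "0 \<le> T" and F: "obs T F G"
  shows "((\<lambda>s. \<integral>w. G s w \<partial>Q s) has_integral ((\<integral>w. F T w \<partial>Q T) - (\<integral>w. F 0 w \<partial>Q 0))) {0..T}"
proof -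
  from F obtain F' C where "obs_with T F F' G C" by (auto simp: obs_def)
  note F' = obs_withD[OF this]
  obtain D where D: "D \<ge> 0"
    "\<And>R (w::'n state). R \<ge> 1 \<Longrightarrow> \<bar>L (cutoff R) w\<bar> \<le> D * (1 + norm w)\<^sup>2 / R\<^sup>2"
    "\<And>R (w::'n state). R \<ge> 1 \<Longrightarrow> norm (grad_y (cutoff R) w) \<le> D * (1 + norm w)\<^sup>2 / R\<^sup>2"
    "\<And>R (w::'n state). R \<ge> 1 \<Longrightarrow> \<bar>L (cutoff R) w\<bar> \<le> D"
    "\<And>R (w::'n state). R \<ge> 1 \<Longrightarrow> norm (grad_y (cutoff R) w) \<le> D"
  proof -
    have "0 \<le> B\<^sub>v" using B\<^sub>v_ge_1 by simp
    show ?thesis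
      by (rule cutoff_estimates[where v = v and \<sigma> = \<sigma>, OF v_bound \<open>0 \<le> B\<^sub>v\<close> \<tau>_pos]) (rule that; blast)
  qed
  define \<theta> where "\<theta> k = (cutoff (real (Suc k)) :: 'n state \<Rightarrow> real)" for k
  have R: "real (Suc k) \<ge> 1" for k by simp
  have \<theta>_smooth: "smooth_fun (\<theta> k)" for k unfolding \<theta>_def by (rule cutoff_smooth)
  \<comment> \<open>Time derivative plus generator of the cut-off observable, expanded by
    \<open>gen_mult\<close> and with \<open>F'\<close> absorbed into \<open>G\<close>.\<close>
  define H where "H k s w = F s w * L (\<theta> k) w + \<theta> k w * G s w + \<sigma>\<^sup>2 / \<tau> * (grad_y (F s) w \<bullet> grad_y (\<theta> k) w)"
    for k s w
  have Fc: "continuous_on UNIV (F s)" for s by (intro smooth_fun_continuous F')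
  have int: "((\<lambda>s. \<integral>w. H k s w \<partial>Q s) has_integral
      ((\<integral>w. F T w * \<theta> k w \<partial>Q T) - (\<integral>w. F 0 w * \<theta> k w \<partial>Q 0))) {0..T}" for k
  proof -
    have "continuous_on UNIV (\<lambda>p :: real \<times> 'n state. \<theta> k (snd p))"
      by (rule continuous_on_compose2[OF smooth_fun_continuous[OF \<theta>_smooth, of UNIV]
          continuous_on_snd[OF continuous_on_id]]) auto
    from continuous_on_mult[OF F'(4) this]
    have "continuous_on UNIV (\<lambda>p. (case p of (s, w) \<Rightarrow> F' s w) * \<theta> k (snd p))" .
    then have c: "continuous_on UNIV (\<lambda>(s, w). F' s w * \<theta> k w)" by (simp add: split_beta')
    have "((\<lambda>s. \<integral>w. F' s w * \<theta> k w + L (\<lambda>w. F s w * \<theta> k w) w \<partial>Q s) has_integral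
      ((\<integral>w. F T w * \<theta> k w \<partial>Q T) - (\<integral>w. F 0 w * \<theta> k w \<partial>Q 0))) {0..T}"
      by (rule evol_has_integral_time_compact[OF Q T _ _ _ c, where R = "real (Suc k)"])
        (auto intro!: smooth_fun_mult F' cutoff_smooth DERIV_cmult_right simp: \<theta>_def cutoff_eq_0 simp del: of_nat_Suc)
    moreover have "F' s w * \<theta> k w + L (\<lambda>w. F s w * \<theta> k w) w = H k s w" for s w
      by (simp add: gen_mult[OF F'(1) \<theta>_smooth] H_def F'(5) algebra_simps)
    ultimately show ?thesis by simp
  qed
  let ?E = "C * D + C + \<sigma>\<^sup>2 / \<tau> * (C * D)"
  have Hb: "\<bar>H k s w\<bar> \<le> ?E" if s: "s \<in> {0..T}" for k s w
  proof -
    have "\<bar>F s w * L (\<theta> k) w\<bar> \<le> C * D"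
      unfolding abs_mult \<theta>_def by (intro mult_mono F' D R s abs_ge_zero)
    moreover have "\<bar>\<theta> k w * G s w\<bar> \<le> C"
      using abs_mult_cutoff_le[OF F'(9)[OF s]] by (simp add: \<theta>_def mult.commute)
    moreover have "\<bar>grad_y (F s) w \<bullet> grad_y (\<theta> k) w\<bar> \<le> C * D"
      unfolding \<theta>_def by (intro order_trans[OF Cauchy_Schwarz_ineq2] mult_mono F' D R s norm_ge_zero)
    then have "\<bar>\<sigma>\<^sup>2 / \<tau> * (grad_y (F s) w \<bullet> grad_y (\<theta> k) w)\<bar> \<le> \<sigma>\<^sup>2 / \<tau> * (C * D)"
      unfolding abs_mult using \<tau>_pos by (intro mult_mono) auto
    ultimately show ?thesis unfolding H_def by linarith
  qed
  have Suc: "filterlim (\<lambda>k. real (Suc k)) at_top sequentially"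
    by (rule filterlim_compose[OF filterlim_real_sequentially filterlim_Suc])
  have small: "(\<lambda>k. D * (1 + norm w)\<^sup>2 / (real (Suc k))\<^sup>2) \<longlonglongrightarrow> 0" for w :: "'n state"
    by (intro tendsto_divide_0[OF tendsto_const] filterlim_at_top_imp_at_infinity filterlim_pow_at_top Suc) auto
  have Hlim: "(\<lambda>k. H k s w) \<longlonglongrightarrow> G s w" for s w
  proof -
    have "(\<lambda>k. L (\<theta> k) w) \<longlonglongrightarrow> 0"
      by (rule Lim_null_comparison[OF _ small[of w]]) (use D(2)[OF R] in \<open>auto simp: \<theta>_def simp del: of_nat_Suc\<close>)
    moreover have "(\<lambda>k. grad_y (\<theta> k) w) \<longlonglongrightarrow> 0"
      by (rule Lim_null_comparison[OF _ small[of w]]) (use D(3)[OF R] in \<open>auto simp: \<theta>_def simp del: of_nat_Suc\<close>)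
    moreover have "(\<lambda>k. \<theta> k w) \<longlonglongrightarrow> 1" unfolding \<theta>_def by (rule filterlim_compose[OF cutoff_tendsto Suc])
    ultimately have "(\<lambda>k. H k s w) \<longlonglongrightarrow> F s w * 0 + 1 * G s w + \<sigma>\<^sup>2 / \<tau> * (grad_y (F s) w \<bullet> 0)"
      unfolding H_def by (intro tendsto_intros)
    then show ?thesis by simp
  qed
  have Hm: "H k s \<in> borel_measurable borel" for k s
    unfolding H_def[abs_def]
    by (intro borel_measurable_add borel_measurable_times borel_measurable_const borel_measurable_inner
        obs_measurable[OF F] borel_measurable_continuous_onI[of "L (\<theta> k)"]
        borel_measurable_continuous_onI[of "grad_y (\<theta> k)"] borel_measurable_continuous_onI[of "\<theta> k"]
        continuous_on_gen[OF \<theta>_smooth v_cont] continuous_on_grad_y[OF \<theta>_smooth]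
        smooth_fun_continuous[OF \<theta>_smooth])
  have lim: "(\<lambda>k. \<integral>w. H k s w \<partial>Q s) \<longlonglongrightarrow> (\<integral>w. G s w \<partial>Q s)" if s: "s \<in> {0..T}" for s
  proof -
    have s0: "0 \<le> s" using s by simp
    interpret prob_space "Q s" by (rule evol_prob[OF Q s0])
    note m = measurable_cong_sets[OF evol_sets[OF Q s0] refl, of borel]
    show ?thesis
      by (rule integral_dominated_convergence[where w = "\<lambda>_. ?E"])
        (use Hm obs_measurable[OF F] Hlim Hb[OF s] in \<open>auto simp: m\<close>)
  qed
  have ends: "(\<lambda>k. \<integral>w. F s w * \<theta> k w \<partial>Q s) \<longlonglongrightarrow> (\<integral>w. F s w \<partial>Q s)" if s: "s \<in> {0..T}" for s
    unfolding \<theta>_def using s F'(7)[OF s] obs_measurable[OF F]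
    by (intro cutoff_integral_tendsto evol_prob[OF Q] evol_sets[OF Q]) auto
  show ?thesis
  proof (rule has_integral_dominated_convergence[OF int, of "\<lambda>_. ?E"])
    show "\<forall>s\<in>{0..T}. norm (\<integral>w. H k s w \<partial>Q s) \<le> ?E" for k
      using Hb by (auto intro!: prob_space.integral_abs_le[OF evol_prob[OF Q]])
  qed (use lim ends[of T] ends[of 0] T in \<open>auto intro!: tendsto_diff\<close>)
qed

end

section \<open>Gaussian measures\<close>

definition gauss_density :: "'a::euclidean_space \<Rightarrow> real" where
  "gauss_density g = (\<Prod>i\<in>Basis. std_normal_density (g \<bullet> i))"

definition gauss :: "'a::euclidean_space measure" where
  "gauss = density lborel (\<lambda>g. ennreal (gauss_density g))"

lemma gauss_density_measurable [measurable]: "gauss_density \<in> borel_measurable borel"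
  unfolding gauss_density_def[abs_def] by measurable

lemma gauss_density_nonneg: "0 \<le> gauss_density g"
  unfolding gauss_density_def by (intro prod_nonneg) auto

lemma sets_gauss [simp, measurable_cong]: "sets gauss = sets borel"
  by (simp add: gauss_def)

lemma space_gauss [simp]: "space gauss = UNIV"
  by (simp add: gauss_def)

lemma prob_space_gauss: "prob_space (gauss :: 'a::euclidean_space measure)"
proof
  have "(\<integral>\<^sup>+g. ennreal (gauss_density (g::'a)) \<partial>lborel) =
      (\<integral>\<^sup>+g. (\<Prod>i\<in>Basis. ennreal (std_normal_density ((g::'a) \<bullet> i))) \<partial>lborel)"
    by (simp add: gauss_density_def prod_ennreal)
  also have "\<dots> = (\<Prod>i\<in>(Basis::'a set). \<integral>\<^sup>+x. ennreal (std_normal_density x) \<partial>lborel)"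
    by (rule nn_integral_lborel_prod) auto
  also have "(\<integral>\<^sup>+x. ennreal (std_normal_density x) \<partial>lborel) = 1"
    using prob_space.emeasure_space_1[OF prob_space_normal_density[of 1 0]] by (simp add: emeasure_density)
  finally show "emeasure (gauss :: 'a measure) (space gauss) = 1"
    by (simp add: gauss_def emeasure_density)
qed

lemma gauss_density_lower:
  assumes "norm (g::'a::euclidean_space) \<le> \<rho>"
  shows "std_normal_density \<rho> ^ DIM('a) \<le> gauss_density g"
proof -
  have "std_normal_density \<rho> \<le> std_normal_density (g \<bullet> i)" if "i \<in> Basis" for i
  proof -
    have "\<bar>g \<bullet> i\<bar> \<le> \<bar>\<rho>\<bar>" using Basis_le_norm[OF that, of g] assms by linarith
    then have "(g \<bullet> i)\<^sup>2 \<le> \<rho>\<^sup>2" by (simp add: abs_le_square_iff)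
    then show ?thesis by (simp add: std_normal_density_def divide_right_mono)
  qed
  then have "(\<Prod>i\<in>(Basis::'a set). std_normal_density \<rho>) \<le> gauss_density g"
    unfolding gauss_density_def by (intro prod_mono) auto
  then show ?thesis by simp
qed

lemma std_normal_char:
  "integrable lborel (\<lambda>x. iexp (t * x) * complex_of_real (std_normal_density x))"
  "(\<integral>x. iexp (t * x) * complex_of_real (std_normal_density x) \<partial>lborel) = complex_of_real (exp (- (t\<^sup>2) / 2))"
proof -
  have "integrable lborel std_normal_density" by simp
  then show "integrable lborel (\<lambda>x. iexp (t * x) * complex_of_real (std_normal_density x))"
    by (rule Bochner_Integration.integrable_bound) (auto simp: norm_mult)
  have "complex_of_real (exp (- (t\<^sup>2) / 2)) = char std_normal_distribution t"
    by (simp add: char_std_normal_distribution)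
  also have "\<dots> = (\<integral>x. std_normal_density x *\<^sub>R iexp (t * x) \<partial>lborel)"
    unfolding char_def by (rule integral_density) auto
  finally show "(\<integral>x. iexp (t * x) * complex_of_real (std_normal_density x) \<partial>lborel) = complex_of_real (exp (- (t\<^sup>2) / 2))"
    by (simp add: scaleR_conv_of_real mult.commute)
qed

lemma gauss_char:
  fixes a :: "'a::euclidean_space"
  shows "(\<integral>g. iexp (a \<bullet> g) \<partial>gauss) = complex_of_real (exp (- (a \<bullet> a) / 2))"
proof -
  interpret product_sigma_finite "\<lambda>_::'a. lborel :: real measure"
    by unfold_locales
  let ?h = "\<lambda>i x. iexp ((a \<bullet> i) * x) * complex_of_real (std_normal_density x)"
  have meas: "(\<lambda>f. \<Sum>b\<in>Basis. f b *\<^sub>R b) \<in> (\<Pi>\<^sub>M b\<in>(Basis::'a set). lborel) \<rightarrow>\<^sub>M borel" by measurable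
  have "(\<integral>g. iexp (a \<bullet> g) \<partial>gauss) = (\<integral>g. gauss_density g *\<^sub>R iexp (a \<bullet> g) \<partial>lborel)"
    unfolding gauss_def by (rule integral_density) (auto simp: gauss_density_nonneg)
  also have "\<dots> = (\<integral>g. (\<Prod>i\<in>Basis. ?h i (g \<bullet> i)) \<partial>lborel)"
  proof (rule Bochner_Integration.integral_cong[OF refl])
    fix g :: 'a
    have "iexp (a \<bullet> g) = (\<Prod>i\<in>Basis. iexp ((a \<bullet> i) * (g \<bullet> i)))"
      by (subst euclidean_inner[of a g]) (simp add: sum_distrib_left exp_sum)
    then show "gauss_density g *\<^sub>R iexp (a \<bullet> g) = (\<Prod>i\<in>Basis. ?h i (g \<bullet> i))"
      by (simp add: gauss_density_def scaleR_conv_of_real prod.distrib mult.commute)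
  qed
  also have "\<dots> = (\<integral>f. (\<Prod>i\<in>Basis. ?h i ((\<Sum>b\<in>Basis. f b *\<^sub>R b) \<bullet> i)) \<partial>(\<Pi>\<^sub>M b\<in>(Basis::'a set). lborel))"
    by (subst lborel_eq, subst integral_distr[OF meas]) (auto intro!: borel_measurable_prod)
  also have "\<dots> = (\<integral>f. (\<Prod>i\<in>Basis. ?h i (f i)) \<partial>(\<Pi>\<^sub>M b\<in>(Basis::'a set). lborel))"
    by (intro Bochner_Integration.integral_cong prod.cong refl)
      (simp add: inner_sum_left inner_Basis if_distrib cong: if_cong)
  also have "\<dots> = (\<Prod>i\<in>(Basis::'a set). \<integral>x. ?h i x \<partial>lborel)"
    by (rule product_integral_prod) (use std_normal_char(1) in auto)
  also have "\<dots> = (\<Prod>i\<in>(Basis::'a set). complex_of_real (exp (- ((a \<bullet> i)\<^sup>2) / 2)))"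
    by (intro prod.cong refl std_normal_char(2))
  also have "\<dots> = complex_of_real (exp (\<Sum>i\<in>(Basis::'a set). - ((a \<bullet> i)\<^sup>2) / 2))"
    by (simp add: exp_sum of_real_prod)
  also have "(\<Sum>i\<in>(Basis::'a set). - ((a \<bullet> i)\<^sup>2) / 2) = - (a \<bullet> a) / 2"
    by (subst euclidean_inner[of a a]) (simp add: sum_negf sum_divide_distrib power2_eq_square)
  finally show ?thesis .
qed

lemma gauss_cos:
  fixes a :: "'a::euclidean_space"
  shows "(\<integral>g. cos (a \<bullet> g + \<phi>) \<partial>gauss) = exp (- (a \<bullet> a) / 2) * cos \<phi>"
proof -
  interpret prob_space "gauss :: 'a measure" by (rule prob_space_gauss)
  have int: "integrable gauss (\<lambda>g::'a. iexp (a \<bullet> g))"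
    by (rule integrable_const_bound[of _ 1]) auto
  have "(\<integral>g. cos (a \<bullet> g + \<phi>) \<partial>gauss) = (\<integral>g. Re (iexp \<phi> * iexp (a \<bullet> g)) \<partial>gauss)"
    by (intro Bochner_Integration.integral_cong refl)
      (simp add: cis_conv_exp[symmetric] cis_mult add.commute)
  also have "\<dots> = Re (\<integral>g. iexp \<phi> * iexp (a \<bullet> g) \<partial>gauss)"
    by (rule integral_Re) (use int in simp)
  also have "(\<integral>g. iexp \<phi> * iexp (a \<bullet> g) \<partial>gauss) = iexp \<phi> * complex_of_real (exp (- (a \<bullet> a) / 2))"
    by (simp only: integral_mult_right_zero gauss_char)
  finally show ?thesis by (simp add: cis_conv_exp[symmetric] mult.commute)
qed

lemma nn_integral_lborel_affine:
  fixes t :: "'a::euclidean_space"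
  assumes "c \<noteq> 0" "f \<in> borel_measurable borel"
  shows "(\<integral>\<^sup>+x. f x \<partial>lborel) = ennreal (\<bar>c\<bar> ^ DIM('a)) * (\<integral>\<^sup>+x. f (t + c *\<^sub>R x) \<partial>lborel)"
  by (subst lborel_affine[OF assms(1), of t])
    (use assms(2) in \<open>simp add: nn_integral_density nn_integral_distr nn_integral_cmult\<close>)

text \<open>Points g whose image under the affine map lies in the unit ball have norm at most
  \<rho>, where the standard density is at least its value at radius \<rho> in every coordinate. The
  power of \<open>c\<close> is the Jacobian.\<close>

lemma gauss_affine_lower:
  fixes m :: "'a::euclidean_space" and f :: "'a \<Rightarrow> ennreal"
  assumes c: "c > 0" and f: "f \<in> borel_measurable borel"
    and \<rho>: "\<And>x. norm x \<le> 1 \<Longrightarrow> norm (x - m) \<le> c * \<rho>"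
  shows "ennreal (std_normal_density \<rho> ^ DIM('a) / c ^ DIM('a)) * (\<integral>\<^sup>+x. indicator (cball 0 1) x * f x \<partial>lborel)
    \<le> (\<integral>\<^sup>+g. f (m + c *\<^sub>R g) \<partial>gauss)"
proof -
  let ?k = "std_normal_density \<rho> ^ DIM('a)"
  have k: "0 \<le> ?k" by simp
  have ind_meas: "(\<lambda>x. indicator (cball 0 1) x * f x) \<in> borel_measurable borel"
    by (intro borel_measurable_times_ennreal f borel_measurable_indicator) auto
  from measurable_compose[OF _ this, of "\<lambda>g. m + c *\<^sub>R g" borel]
  have fm: "(\<lambda>g. indicator (cball 0 1) (m + c *\<^sub>R g) * f (m + c *\<^sub>R g)) \<in> borel_measurable borel"
    by simp
  from measurable_compose[OF _ f, of "\<lambda>g. m + c *\<^sub>R g" borel]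
  have fm': "(\<lambda>g. f (m + c *\<^sub>R g)) \<in> borel_measurable borel" by simp
  note affine = nn_integral_lborel_affine[OF _ ind_meas, of c m]
  have "(\<integral>\<^sup>+x. indicator (cball 0 1) x * f x \<partial>lborel) =
      ennreal (c ^ DIM('a)) * (\<integral>\<^sup>+g. indicator (cball 0 1) (m + c *\<^sub>R g) * f (m + c *\<^sub>R g) \<partial>lborel)"
    using affine c by simp
  then have "ennreal (?k / c ^ DIM('a)) * (\<integral>\<^sup>+x. indicator (cball 0 1) x * f x \<partial>lborel) =
    ennreal ?k * (\<integral>\<^sup>+g. indicator (cball 0 1) (m + c *\<^sub>R g) * f (m + c *\<^sub>R g) \<partial>lborel)"
    using c k by (simp add: mult.assoc[symmetric] ennreal_mult[symmetric])
  also have "\<dots> = (\<integral>\<^sup>+g. ennreal ?k * (indicator (cball 0 1) (m + c *\<^sub>R g) * f (m + c *\<^sub>R g)) \<partial>lborel)"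
    by (rule nn_integral_cmult[symmetric]) (use fm in simp)
  also have "\<dots> \<le> (\<integral>\<^sup>+g. ennreal (gauss_density g) * f (m + c *\<^sub>R g) \<partial>lborel)"
  proof (rule nn_integral_mono)
    fix g :: 'a
    show "ennreal ?k * (indicator (cball 0 1) (m + c *\<^sub>R g) * f (m + c *\<^sub>R g)) \<le> ennreal (gauss_density g) * f (m + c *\<^sub>R g)"
    proof (cases "m + c *\<^sub>R g \<in> cball 0 1")
      case True
      then have "norm (m + c *\<^sub>R g) \<le> 1" by simp
      from \<rho>[OF this] c have "norm g \<le> \<rho>" by simp
      from gauss_density_lower[OF this] True show ?thesis by (simp add: mult_right_mono ennreal_leI)
    qed simp
  qed
  also have "\<dots> = (\<integral>\<^sup>+g. f (m + c *\<^sub>R g) \<partial>gauss)"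
    unfolding gauss_def by (rule nn_integral_density[symmetric]) (use fm' in simp_all)
  finally show ?thesis .
qed

section \<open>Plane waves\<close>

context kinetic begin

text \<open>In the remaining time \<open>r\<close>, the Gaussian semigroup maps the wave with frequencies \<open>\<xi>, \<eta>\<close> to the one with
  frequencies \<open>\<xi>, freq \<xi> \<eta> r\<close>, damped by \<open>exp (- damp \<xi> \<eta> r)\<close>.\<close>

definition freq :: "real ^ 'n \<Rightarrow> real ^ 'n \<Rightarrow> real \<Rightarrow> real ^ 'n" where
  "freq \<xi> \<eta> r = sqrt \<tau> *\<^sub>R \<xi> + exp (- r / \<tau>) *\<^sub>R (\<eta> - sqrt \<tau> *\<^sub>R \<xi>)"

definition damp :: "real ^ 'n \<Rightarrow> real ^ 'n \<Rightarrow> real \<Rightarrow> real" where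
  "damp \<xi> \<eta> r = \<sigma>\<^sup>2 / 2 * ((\<xi> \<bullet> \<xi>) * r + 2 * sqrt \<tau> * (1 - exp (- r / \<tau>)) * (\<xi> \<bullet> (\<eta> - sqrt \<tau> *\<^sub>R \<xi>))
     + 1 / 2 * (1 - exp (- 2 * r / \<tau>)) * ((\<eta> - sqrt \<tau> *\<^sub>R \<xi>) \<bullet> (\<eta> - sqrt \<tau> *\<^sub>R \<xi>)))"

definition plane_wave :: "real ^ 'n \<Rightarrow> real ^ 'n \<Rightarrow> real \<Rightarrow> real \<Rightarrow> 'n state \<Rightarrow> real" where
  "plane_wave \<xi> \<eta> \<phi> r w = exp (- damp \<xi> \<eta> r) * cos ((\<xi>, freq \<xi> \<eta> r) \<bullet> w + \<phi>)"

text \<open>The characteristic equation of the linear drift: transport of x by y feeds \<xi> / sqrt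
  \<tau> into the y-frequency, friction damps it at rate 1 / \<tau>.\<close>

lemma freq_derivative:
  "(freq \<xi> \<eta> has_vector_derivative (1 / \<tau>) *\<^sub>R (sqrt \<tau> *\<^sub>R \<xi> - freq \<xi> \<eta> r)) (at r)"
proof -
  let ?d = "\<eta> - sqrt \<tau> *\<^sub>R \<xi>"
  have "((\<lambda>r. exp (- r / \<tau>)) has_real_derivative - (1 / \<tau>) * exp (- r / \<tau>)) (at r)"
    using \<tau>_pos by (auto intro!: derivative_eq_intros)
  from has_vector_derivative_add[OF has_vector_derivative_const
      has_vector_derivative_scaleR[OF this has_vector_derivative_const[of ?d]]]
  have "((\<lambda>r. sqrt \<tau> *\<^sub>R \<xi> + exp (- r / \<tau>) *\<^sub>R ?d) has_vector_derivative
      0 + (exp (- r / \<tau>) *\<^sub>R 0 + (- (1 / \<tau>) * exp (- r / \<tau>)) *\<^sub>R ?d)) (at r)" .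
  moreover have "0 + (exp (- r / \<tau>) *\<^sub>R 0 + (- (1 / \<tau>) * exp (- r / \<tau>)) *\<^sub>R ?d)
      = (1 / \<tau>) *\<^sub>R (sqrt \<tau> *\<^sub>R \<xi> - freq \<xi> \<eta> r)"
    unfolding freq_def by (simp only: add_0 scaleR_zero_right scaleR_scaleR[symmetric]
        diff_add_eq_diff_diff_swap) simp
  ultimately show ?thesis unfolding freq_def[abs_def] by simp
qed

text \<open>The right side is the eigenvalue of the y-diffusion on a wave with y-frequency
  \<open>freq \<xi> \<eta> r\<close>; \<open>damp\<close> is its accumulated value.\<close>

lemma damp_derivative:
  "(damp \<xi> \<eta> has_real_derivative \<sigma>\<^sup>2 / (2 * \<tau>) * (freq \<xi> \<eta> r \<bullet> freq \<xi> \<eta> r)) (at r)"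
proof -
  define d where "d = \<eta> - sqrt \<tau> *\<^sub>R \<xi>"
  define e where "e = exp (- r / \<tau>)"
  have e2: "exp (- 2 * r / \<tau>) = e * e" by (simp add: e_def flip: exp_add)
  have e3: "exp (- (r * 2 / \<tau>)) = exp (- (r / \<tau>)) * exp (- (r / \<tau>))" by (simp flip: exp_add)
  have st: "sqrt \<tau> * sqrt \<tau> = \<tau>" using \<tau>_pos by simp
  have "(damp \<xi> \<eta> has_real_derivative \<sigma>\<^sup>2 / 2 * (\<xi> \<bullet> \<xi> + 2 * sqrt \<tau> * (e / \<tau>) * (\<xi> \<bullet> d) + (e * e) / \<tau> * (d \<bullet> d))) (at r)"
    unfolding damp_def d_def[symmetric] e2[symmetric] e_def using \<tau>_pos
    by (auto intro!: derivative_eq_intros simp: field_simps e3)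
  also have "\<sigma>\<^sup>2 / 2 * (\<xi> \<bullet> \<xi> + 2 * sqrt \<tau> * (e / \<tau>) * (\<xi> \<bullet> d) + (e * e) / \<tau> * (d \<bullet> d))
      = \<sigma>\<^sup>2 / (2 * \<tau>) * (freq \<xi> \<eta> r \<bullet> freq \<xi> \<eta> r)"
  proof -
    have "freq \<xi> \<eta> r \<bullet> freq \<xi> \<eta> r = \<tau> * (\<xi> \<bullet> \<xi>) + 2 * sqrt \<tau> * e * (\<xi> \<bullet> d) + e * e * (d \<bullet> d)"
    proof -
      have "(s *\<^sub>R \<xi> + e *\<^sub>R d) \<bullet> (s *\<^sub>R \<xi> + e *\<^sub>R d)
          = (s * s) * (\<xi> \<bullet> \<xi>) + 2 * s * e * (\<xi> \<bullet> d) + e * e * (d \<bullet> d)" for s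
        by (simp add: inner_add_left inner_add_right inner_commute[of d \<xi>] algebra_simps)
      then show ?thesis unfolding freq_def d_def[symmetric] e_def[symmetric] by (simp only: st)
    qed
    then show ?thesis using \<tau>_pos by (simp add: field_simps)
  qed
  finally show ?thesis .
qed

lemma plane_wave_space:
  fixes \<xi> \<eta> :: "real ^ 'n" and \<phi> r :: real
  defines "E \<equiv> exp (- damp \<xi> \<eta> r)" and "\<theta> \<equiv> \<lambda>w. (\<xi>, freq \<xi> \<eta> r) \<bullet> w + \<phi>"
  shows "grad_y (plane_wave \<xi> \<eta> \<phi> r) w = (- E * sin (\<theta> w)) *\<^sub>R freq \<xi> \<eta> r" (is ?G)
    and "L (plane_wave \<xi> \<eta> \<phi> r) w = (1 / sqrt \<tau>) * (v (fst w) \<bullet> grad_y (plane_wave \<xi> \<eta> \<phi> r) w)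
      - E * sin (\<theta> w) * ((\<xi> \<bullet> snd w) / sqrt \<tau> - (freq \<xi> \<eta> r \<bullet> snd w) / \<tau>)
      - E * cos (\<theta> w) * (\<sigma>\<^sup>2 / (2 * \<tau>) * (freq \<xi> \<eta> r \<bullet> freq \<xi> \<eta> r))" (is ?L)
    and "smooth_fun (plane_wave \<xi> \<eta> \<phi> r)" (is ?S)
proof -
  let ?f = "freq \<xi> \<eta> r"
  let ?P = "\<lambda>w. (- E * sin (\<theta> w)) *\<^sub>R (\<xi>, ?f)"
  have d: "(\<theta> has_derivative (\<lambda>h. (\<xi>, ?f) \<bullet> h)) (at w)" for w
    unfolding \<theta>_def by (auto intro!: derivative_eq_intros)
  have P: "(plane_wave \<xi> \<eta> \<phi> r has_derivative (\<lambda>h. ?P w \<bullet> h)) (at w)" for w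
  proof -
    have "((\<lambda>w. E * cos (\<theta> w)) has_derivative (\<lambda>h. E * (- sin (\<theta> w) * ((\<xi>, ?f) \<bullet> h)))) (at w)"
      by (intro has_derivative_mult_right) (rule has_derivative_cos[OF d, THEN has_derivative_eq_rhs], simp add: fun_eq_iff)
    then have "(plane_wave \<xi> \<eta> \<phi> r has_derivative (\<lambda>h. E * (- sin (\<theta> w) * ((\<xi>, ?f) \<bullet> h)))) (at w)"
      unfolding plane_wave_def[abs_def] E_def \<theta>_def .
    then show ?thesis by (rule has_derivative_eq_rhs) (rule ext, subst inner_scaleR_left, simp)
  qed
  let ?D = "\<lambda>i h. (- E * (cos (\<theta> w) * ((\<xi>, ?f) \<bullet> h))) * (?f \<bullet> i)"
  have D: "((\<lambda>w. snd (?P w) \<bullet> i) has_derivative ?D i) (at w)" for i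
  proof -
    have "((\<lambda>w. (- E * sin (\<theta> w)) * (?f \<bullet> i)) has_derivative ?D i) (at w)"
      by (intro has_derivative_mult_left has_derivative_mult_right)
        (rule has_derivative_sin[OF d, THEN has_derivative_eq_rhs], simp add: fun_eq_iff)
    then show ?thesis by simp
  qed
  show G: ?G using grad_y_eqI[OF P D] by simp
  have "(\<Sum>i\<in>Basis. ?D i (0, i)) = - E * cos (\<theta> w) * (\<Sum>i\<in>Basis. (?f \<bullet> i) * (?f \<bullet> i))"
    unfolding sum_distrib_left by (intro sum.cong refl) (simp add: inner_prod_def)
  then have S: "(\<Sum>i\<in>Basis. ?D i (0, i)) = - E * cos (\<theta> w) * (?f \<bullet> ?f)"
    by (simp add: euclidean_inner[symmetric])
  show ?L unfolding gen_eqI[OF P D] S G using \<tau>_pos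
    by (simp add: inner_commute[of "v (fst w)"] inner_commute[of ?f "snd w"] algebra_simps add_divide_distrib diff_divide_distrib)
  have "smooth_fun (\<lambda>w. exp (- damp \<xi> \<eta> r) * cos ((\<xi>, freq \<xi> \<eta> r) \<bullet> w + \<phi>))"
    by (intro smooth_fun_mult smooth_fun_const smooth_fun_comp[OF smooth_fun_cos] smooth_fun_add
        smooth_fun_bounded_linear bounded_linear_inner_right)
  then show ?S by (simp add: plane_wave_def[abs_def])
qed

lemma plane_wave_time:
  "((\<lambda>r. plane_wave \<xi> \<eta> \<phi> r w) has_real_derivative
     - exp (- damp \<xi> \<eta> r) * (\<sigma>\<^sup>2 / (2 * \<tau>) * (freq \<xi> \<eta> r \<bullet> freq \<xi> \<eta> r) * cos ((\<xi>, freq \<xi> \<eta> r) \<bullet> w + \<phi>)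
      + sin ((\<xi>, freq \<xi> \<eta> r) \<bullet> w + \<phi>) * ((1 / \<tau>) * ((sqrt \<tau> *\<^sub>R \<xi> - freq \<xi> \<eta> r) \<bullet> snd w)))) (at r)"
proof -
  let ?t = "\<lambda>r. (\<xi>, freq \<xi> \<eta> r) \<bullet> w + \<phi>"
  have "((\<lambda>r. freq \<xi> \<eta> r \<bullet> snd w) has_real_derivative ((1 / \<tau>) *\<^sub>R (sqrt \<tau> *\<^sub>R \<xi> - freq \<xi> \<eta> r)) \<bullet> snd w) (at r)"
    using bounded_linear.has_vector_derivative[OF bounded_linear_inner_left freq_derivative]
    by (simp add: has_real_derivative_iff_has_vector_derivative)
  then have d: "(?t has_real_derivative (1 / \<tau>) * ((sqrt \<tau> *\<^sub>R \<xi> - freq \<xi> \<eta> r) \<bullet> snd w)) (at r)"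
    by (auto intro!: derivative_eq_intros simp: inner_prod_def)
  show ?thesis
    unfolding plane_wave_def
    by (rule DERIV_cong[OF DERIV_mult'[OF DERIV_chain2[OF DERIV_exp DERIV_minus[OF damp_derivative]]
          DERIV_chain2[OF DERIV_cos d]]]) (simp add: algebra_simps)
qed

lemma continuous_on_freq: "continuous_on UNIV (\<lambda>p. freq \<xi> \<eta> (h p))" if "continuous_on UNIV h"
  unfolding freq_def using \<tau>_pos by (intro continuous_intros that) auto

lemma continuous_on_damp: "continuous_on UNIV (\<lambda>p. damp \<xi> \<eta> (h p))" if "continuous_on UNIV h"
  unfolding damp_def using \<tau>_pos by (intro continuous_intros that) auto

text \<open>The backward equation of the Gaussian process up to time \<open>t\<close>: everything in
  the generator except the \<open>v\<close>-term cancels against the time derivative.\<close>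

definition backward :: "real \<Rightarrow> (real \<Rightarrow> 'n state \<Rightarrow> real) \<Rightarrow> bool" where
  "backward t u \<longleftrightarrow> obs t u (\<lambda>s w. (1 / sqrt \<tau>) * (v (fst w) \<bullet> grad_y (u s) w))"

lemma backward_plane_wave: "backward t (\<lambda>s. plane_wave \<xi> \<eta> \<phi> (t - s))"
proof -
  let ?A = "\<lambda>s. exp (- damp \<xi> \<eta> (t - s))" and ?f = "\<lambda>s. freq \<xi> \<eta> (t - s)"
  let ?\<theta> = "\<lambda>s w. (\<xi>, ?f s) \<bullet> w + \<phi>"
  let ?F' = "\<lambda>s w. ?A s * (\<sigma>\<^sup>2 / (2 * \<tau>) * (?f s \<bullet> ?f s) * cos (?\<theta> s w)
      + sin (?\<theta> s w) * ((1 / \<tau>) * ((sqrt \<tau> *\<^sub>R \<xi> - ?f s) \<bullet> snd w)))"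
  have "bounded (?A ` {0..t})" "bounded (?f ` {0..t})"
    by (intro compact_imp_bounded compact_continuous_image continuous_on_exp continuous_on_minus compact_Icc
        continuous_on_subset[OF continuous_on_damp] continuous_on_subset[OF continuous_on_freq] continuous_intros; simp)+
  then obtain a b where "\<forall>x\<in>?A ` {0..t}. norm x \<le> a" "\<forall>x\<in>?f ` {0..t}. norm x \<le> b"
    unfolding bounded_iff by blast
  then have ab: "\<bar>?A s\<bar> \<le> a" "norm (?f s) \<le> b" if "s \<in> {0..t}" for s using that by auto
  define C where "C = max 0 (max a (max (a * b) (1 / sqrt \<tau> * (B\<^sub>v * (a * b)))))"
  have g: "norm (grad_y (plane_wave \<xi> \<eta> \<phi> (t - s)) w) \<le> a * b" if "s \<in> {0..t}" for s w
  proof -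
    have a0: "0 \<le> a" using order_trans[OF abs_ge_zero ab(1)[OF that]] .
    then have "?A s * \<bar>sin (?\<theta> s w)\<bar> \<le> a * 1" using ab(1)[OF that] by (intro mult_mono) auto
    then have "?A s * \<bar>sin (?\<theta> s w)\<bar> * norm (?f s) \<le> a * b"
      using ab[OF that] order_trans[OF abs_ge_zero ab(1)[OF that]] by (intro mult_mono) auto
    then show ?thesis by (simp add: plane_wave_space(1) abs_mult)
  qed
  show ?thesis
    unfolding backward_def
  proof (rule obsI[where F' = ?F' and C = C])
    show "smooth_fun (plane_wave \<xi> \<eta> \<phi> (t - s))" for s by (rule plane_wave_space(3))
    show "((\<lambda>s. plane_wave \<xi> \<eta> \<phi> (t - s) w) has_real_derivative ?F' s w) (at s)" for s w
      by (rule DERIV_cong[OF DERIV_chain2[OF plane_wave_time, where g = "\<lambda>s. t - s" and Db = "- 1"]])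
        (auto intro!: derivative_eq_intros)
    have c1: "continuous_on UNIV (\<lambda>p::real \<times> 'n state. damp \<xi> \<eta> (t - fst p))"
      "continuous_on UNIV (\<lambda>p::real \<times> 'n state. freq \<xi> \<eta> (t - fst p))"
      by (intro continuous_on_damp continuous_on_freq continuous_intros)+
    then show "continuous_on UNIV (\<lambda>p. plane_wave \<xi> \<eta> \<phi> (t - fst p) (snd p))"
      "continuous_on UNIV (\<lambda>p. ?F' (fst p) (snd p))"
      unfolding plane_wave_def by (intro continuous_intros; simp)+
    show "(1 / sqrt \<tau>) * (v (fst w) \<bullet> grad_y (plane_wave \<xi> \<eta> \<phi> (t - s)) w) = ?F' s w + L (plane_wave \<xi> \<eta> \<phi> (t - s)) w" for s w
    proof -
      have "sqrt \<tau> / \<tau> = 1 / sqrt \<tau>" using \<tau>_pos by (simp add: field_simps)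
      then have "sqrt \<tau> * x / \<tau> = x / sqrt \<tau>" for x
        by (metis mult.commute mult_1 times_divide_eq_left)
      then have "(1 / \<tau>) * ((sqrt \<tau> *\<^sub>R \<xi> - ?f s) \<bullet> snd w) = (\<xi> \<bullet> snd w) / sqrt \<tau> - (?f s \<bullet> snd w) / \<tau>"
        using \<tau>_pos by (simp add: inner_diff_left diff_divide_distrib)
      then show ?thesis unfolding plane_wave_space(2) by (simp add: algebra_simps)
    qed
    show "0 \<le> C" by (simp add: C_def)
    fix s w assume s: "s \<in> {0..t}"
    have "\<bar>plane_wave \<xi> \<eta> \<phi> (t - s) w\<bar> \<le> a * 1"
      unfolding plane_wave_def abs_mult
      using ab(1)[OF s] order_trans[OF abs_ge_zero ab(1)[OF s]] by (intro mult_mono) auto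
    then show "\<bar>plane_wave \<xi> \<eta> \<phi> (t - s) w\<bar> \<le> C" by (simp add: C_def)
    show "norm (grad_y (plane_wave \<xi> \<eta> \<phi> (t - s)) w) \<le> C" using g[OF s, of w] by (simp add: C_def)
    have "\<bar>v (fst w) \<bullet> grad_y (plane_wave \<xi> \<eta> \<phi> (t - s)) w\<bar> \<le> B\<^sub>v * (a * b)"
      by (intro order_trans[OF Cauchy_Schwarz_ineq2] mult_mono v_bound g s norm_ge_zero) (use B\<^sub>v_ge_1 in auto)
    then have "\<bar>(1 / sqrt \<tau>) * (v (fst w) \<bullet> grad_y (plane_wave \<xi> \<eta> \<phi> (t - s)) w)\<bar> \<le> 1 / sqrt \<tau> * (B\<^sub>v * (a * b))"
      unfolding abs_mult using \<tau>_pos by (intro mult_mono) auto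
    then show "\<bar>(1 / sqrt \<tau>) * (v (fst w) \<bullet> grad_y (plane_wave \<xi> \<eta> \<phi> (t - s)) w)\<bar> \<le> C"
      by (simp add: C_def)
  qed
qed

text \<open>The relation \<open>Z\<close> between the final value and the initial value is carried
  along by linearity. Uniqueness takes it trivial; the comparison with the Gaussian process takes it
  to say that \<open>u 0\<close> is the Gaussian expectation of \<open>f\<close>.\<close>

lemma backward_exists:
  assumes "trig_poly f"
    and wave: "\<And>c \<xi> \<eta> \<phi>. Z (\<lambda>w. c * cos ((\<xi>, \<eta>) \<bullet> w + \<phi>)) (\<lambda>z. c * plane_wave \<xi> \<eta> \<phi> t z)"
    and add: "\<And>f g f' g'. trig_poly f \<Longrightarrow> trig_poly g \<Longrightarrow> Z f f' \<Longrightarrow> Z g g' \<Longrightarrow> Z (\<lambda>w. f w + g w) (\<lambda>z. f' z + g' z)"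
  obtains u where "backward t u" "u t = f" "Z f (u 0)"
proof -
  from assms(1) have "\<exists>u. backward t u \<and> u t = f \<and> Z f (u 0)"
  proof induction
    case (wave c \<zeta> \<phi>)
    obtain \<xi> \<eta> where \<zeta>: "\<zeta> = (\<xi>, \<eta>)" by (cases \<zeta>)
    let ?u = "\<lambda>s w. c * plane_wave \<xi> \<eta> \<phi> (t - s) w"
    have "backward t ?u"
      using obs_cmult[OF backward_plane_wave[unfolded backward_def], of t c \<xi> \<eta> \<phi>]
      unfolding backward_def by (simp add: grad_y_cmult[OF plane_wave_space(3)] mult_ac)
    moreover have "?u t = (\<lambda>w. c * cos (\<zeta> \<bullet> w + \<phi>))"
      by (simp add: plane_wave_def damp_def freq_def \<zeta> fun_eq_iff)
    moreover have "Z (\<lambda>w. c * cos (\<zeta> \<bullet> w + \<phi>)) (?u 0)" using assms(2) by (simp add: \<zeta>)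
    ultimately show ?case by blast
  next
    case (add f g)
    then obtain a b where a: "backward t a" "a t = f" "Z f (a 0)" and b: "backward t b" "b t = g" "Z g (b 0)" by blast
    have "backward t (\<lambda>s w. a s w + b s w)"
      using obs_add[OF a(1)[unfolded backward_def] b(1)[unfolded backward_def]]
      unfolding backward_def
      by (simp add: grad_y_add[OF obs_smooth[OF a(1)[unfolded backward_def]] obs_smooth[OF b(1)[unfolded backward_def]]]
          inner_add_right distrib_left)
    with a b assms(3)[OF add.hyps(1,2) a(3) b(3)] show ?case
      by (intro exI[of _ "\<lambda>s w. a s w + b s w"]) auto
  qed
  with that show ?thesis by blast
qed

text \<open>The weight in time contributes \<open>c * (u s w)\<^sup>2\<close>, which together with
  the carre du champ dominates the cross term between \<open>u\<close> and the drift once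
  \<open>c\<close> is large enough.\<close>

lemma backward_square:
  assumes u: "backward t u"
  shows "obs t (\<lambda>s w. exp (c * s) * (u s w)\<^sup>2)
    (\<lambda>s w. exp (c * s) * (c * (u s w)\<^sup>2 + 2 * u s w * ((1 / sqrt \<tau>) * (v (fst w) \<bullet> grad_y (u s) w))
      + \<sigma>\<^sup>2 / \<tau> * (grad_y (u s) w \<bullet> grad_y (u s) w)))"
proof -
  note o = u[unfolded backward_def]
  have e: "obs t (\<lambda>s w. exp (c * s)) (\<lambda>s w. c * exp (c * s))"
    by (rule obs_time) (auto intro!: derivative_eq_intros continuous_intros)
  from obs_mult[OF e obs_mult[OF o o]]
  show ?thesis by (simp add: grad_y_const power2_eq_square algebra_simps)
qed

end

section \<open>Uniqueness\<close>

lemma abs_power2_le: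
  fixes x :: real
  assumes "\<bar>x\<bar> \<le> B" shows "\<bar>x\<^sup>2\<bar> \<le> B\<^sup>2"
  using power_mono[OF assms, of 2] by simp

lemma integral_bounded_lim:
  fixes F :: "nat \<Rightarrow> 'a::topological_space \<Rightarrow> real"
  assumes "prob_space M" "sets M = sets borel" "\<And>k. F k \<in> borel_measurable borel"
    and B: "\<And>k w. \<bar>F k w\<bar> \<le> B" and lim: "\<And>w. (\<lambda>k. F k w) \<longlonglongrightarrow> f w"
  shows "(\<lambda>k. \<integral>w. F k w \<partial>M) \<longlonglongrightarrow> (\<integral>w. f w \<partial>M)"
proof -
  interpret prob_space M by fact
  note m = measurable_cong_sets[OF assms(2) refl, of borel]
  have "f \<in> borel_measurable borel" using assms(3) lim by (rule borel_measurable_LIMSEQ_real[rotated])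
  then show ?thesis
    by (intro integral_dominated_convergence[where w = "\<lambda>_. B"]) (use assms in \<open>auto simp: m\<close>)
qed

lemma integral_bounded_lim_square:
  fixes F :: "nat \<Rightarrow> 'a::topological_space \<Rightarrow> real"
  assumes "prob_space M" "sets M = sets borel" "\<And>k. F k \<in> borel_measurable borel"
    and B: "\<And>k w. \<bar>F k w\<bar> \<le> B" and lim: "\<And>w. (\<lambda>k. F k w) \<longlonglongrightarrow> f w"
  shows "(\<lambda>k. \<integral>w. (F k w)\<^sup>2 \<partial>M) \<longlonglongrightarrow> (\<integral>w. (f w)\<^sup>2 \<partial>M)"
proof (rule integral_bounded_lim[OF assms(1,2)])
  show "(\<lambda>w. (F k w)\<^sup>2) \<in> borel_measurable borel" for k using assms(3) by auto
  show "\<bar>(F k w)\<^sup>2\<bar> \<le> B\<^sup>2" for k w by (rule abs_power2_le[OF B])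
  show "(\<lambda>k. (F k w)\<^sup>2) \<longlonglongrightarrow> (f w)\<^sup>2" for w by (intro tendsto_power lim)
qed

lemma measure_eq_bounded_integrals:
  fixes M N :: "'a::topological_space measure"
  assumes "prob_space M" "sets M = sets borel" "prob_space N" "sets N = sets borel"
    and eq: "\<And>f::'a \<Rightarrow> real. f \<in> borel_measurable borel \<Longrightarrow> (\<And>w. \<bar>f w\<bar> \<le> 1) \<Longrightarrow> (\<integral>w. f w \<partial>M) = (\<integral>w. f w \<partial>N)"
  shows "M = N"
proof (rule measure_eqI)
  interpret M: prob_space M by fact
  interpret N: prob_space N by fact
  show "sets M = sets N" using assms by simp
  fix A assume A: "A \<in> sets M"
  then have "(\<integral>w. indicator A w \<partial>M) = (\<integral>w. indicator A w \<partial>N :: real)"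
    using assms(2) by (intro eq) (auto simp: indicator_def)
  then show "emeasure M A = emeasure N A"
    using A assms sets_eq_imp_space_eq[OF assms(2)] sets_eq_imp_space_eq[OF assms(4)]
    by (simp add: M.emeasure_eq_measure N.emeasure_eq_measure)
qed

context kinetic begin

text \<open>Young's inequality. The free weight \<open>k\<close> decides how much of the carre du
  champ is spent on the drift: all of it in the Gaussian comparison, half of it in the uniqueness
  proof.\<close>

lemma drift_bound:
  fixes g :: "real ^ 'n" and u :: real
  assumes k: "k > 0"
  shows "- (k * (g \<bullet> g) + B\<^sub>v\<^sup>2 / (\<tau> * k) * u\<^sup>2) \<le> 2 * u * ((1 / sqrt \<tau>) * (v x \<bullet> g))"
proof -
  define q where "q = norm g"
  have q: "q \<ge> 0" "g \<bullet> g = q\<^sup>2" by (auto simp: q_def dot_square_norm)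
  have B: "B\<^sub>v \<ge> 0" using B\<^sub>v_ge_1 by simp
  have "\<bar>v x \<bullet> g\<bar> \<le> B\<^sub>v * q"
    unfolding q_def by (intro order_trans[OF Cauchy_Schwarz_ineq2] mult_right_mono v_bound) auto
  then have "\<bar>2 * u * ((1 / sqrt \<tau>) * (v x \<bullet> g))\<bar> \<le> 2 * \<bar>u\<bar> * ((1 / sqrt \<tau>) * (B\<^sub>v * q))"
    unfolding abs_mult using \<tau>_pos by (intro mult_mono) (auto intro!: mult_nonneg_nonneg B q)
  also have "\<dots> = 2 * (sqrt k * q) * (B\<^sub>v * \<bar>u\<bar> / (sqrt \<tau> * sqrt k))"
    using k by simp
  also have "\<dots> \<le> (sqrt k * q)\<^sup>2 + (B\<^sub>v * \<bar>u\<bar> / (sqrt \<tau> * sqrt k))\<^sup>2"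
    using sum_squares_bound by blast
  also have "\<dots> = k * (g \<bullet> g) + B\<^sub>v\<^sup>2 / (\<tau> * k) * u\<^sup>2"
    using k \<tau>_pos by (simp add: q power_mult_distrib power_divide)
  finally show ?thesis by (subst minus_le_iff) (rule abs_le_D2)
qed

lemma drift_square:
  fixes g :: "real ^ 'n"
  shows "((1 / sqrt \<tau>) * (v x \<bullet> g))\<^sup>2 \<le> B\<^sub>v\<^sup>2 / \<tau> * (g \<bullet> g)"
proof -
  have "\<bar>v x \<bullet> g\<bar> \<le> B\<^sub>v * norm g"
    by (intro order_trans[OF Cauchy_Schwarz_ineq2] mult_right_mono v_bound) auto
  from abs_power2_le[OF this] have "(v x \<bullet> g)\<^sup>2 \<le> (B\<^sub>v * norm g)\<^sup>2" by simp
  then show ?thesis using \<tau>_pos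
    by (simp add: power_mult_distrib power_divide dot_square_norm divide_right_mono)
qed

text \<open>Optimizing over \<open>\<kappa>\<close>, this says \<open>(Q\<^sub>s g - Q'\<^sub>s g)\<^sup>2 \<le> D (Q\<^sub>s g\<^sup>2 + Q'\<^sub>s g\<^sup>2)\<close>; the form with
  \<open>\<kappa>\<close> is linear in the measures and can be integrated in time.\<close>

definition gap :: "(real \<Rightarrow> 'n state measure) \<Rightarrow> (real \<Rightarrow> 'n state measure) \<Rightarrow> real \<Rightarrow> real \<Rightarrow> bool" where
  "gap Q Q' T D \<longleftrightarrow> (\<forall>s\<in>{0..T}. \<forall>\<kappa>>0. \<forall>g\<in>borel_measurable borel. bounded (range g) \<longrightarrow>
     (\<integral>w. g w \<partial>Q s) - (\<integral>w. g w \<partial>Q' s)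
       \<le> 1 / 2 * (\<kappa> * D + ((\<integral>w. (g w)\<^sup>2 \<partial>Q s) + (\<integral>w. (g w)\<^sup>2 \<partial>Q' s)) / \<kappa>))"

lemma gapD:
  fixes g :: "'n state \<Rightarrow> real"
  assumes "gap Q Q' T D" "s \<in> {0..T}" "\<kappa> > 0" "g \<in> borel_measurable borel" "\<And>w. \<bar>g w\<bar> \<le> B"
  shows "(\<integral>w. g w \<partial>Q s) - (\<integral>w. g w \<partial>Q' s)
       \<le> 1 / 2 * (\<kappa> * D + ((\<integral>w. (g w)\<^sup>2 \<partial>Q s) + (\<integral>w. (g w)\<^sup>2 \<partial>Q' s)) / \<kappa>)"
proof -
  have "bounded (range g)" using assms(5) by (auto simp: bounded_iff)
  then show ?thesis using assms unfolding gap_def by blast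
qed

text \<open>Under each of the two probability measures, |x| is at most half of \<kappa> + x^2 /
  \<kappa>; the two copies of \<kappa> give the starting value 2.\<close>

lemma gap_base:
  assumes Q: "evol Q" and Q': "evol Q'" and "T \<ge> 0"
  shows "gap Q Q' T 2"
  unfolding gap_def
proof (intro ballI allI impI)
  fix s \<kappa> :: real and g :: "'n state \<Rightarrow> real"
  assume s: "s \<in> {0..T}" and l: "0 < \<kappa>" and g: "g \<in> borel_measurable borel" and b: "bounded (range g)"
  from b obtain B where B: "\<And>w. \<bar>g w\<bar> \<le> B" by (auto simp: bounded_iff)
  have B2: "\<bar>(g w)\<^sup>2\<bar> \<le> B\<^sup>2" for w by (rule abs_power2_le[OF B])
  have am: "\<bar>x\<bar> \<le> 1 / 2 * (\<kappa> + x\<^sup>2 / \<kappa>)" for x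
  proof -
    have "2 * \<bar>x\<bar> * \<kappa> \<le> x\<^sup>2 + \<kappa>\<^sup>2" using sum_squares_bound[of "\<bar>x\<bar>" \<kappa>] by simp
    then show ?thesis using l by (simp add: field_simps power2_eq_square)
  qed
  have bd: "\<bar>\<integral>w. g w \<partial>R s\<bar> \<le> 1 / 2 * (\<kappa> + (\<integral>w. (g w)\<^sup>2 \<partial>R s) / \<kappa>)" if R: "evol R" for R
  proof -
    have s0: "0 \<le> s" using s by simp
    interpret prob_space "R s" by (rule evol_prob[OF R s0])
    have i: "integrable (R s) g" "integrable (R s) (\<lambda>w. (g w)\<^sup>2)"
      by (rule evol_integrable[OF R s0 g B] evol_integrable[OF R s0 borel_measurable_power[OF g] B2])+
    have "\<bar>\<integral>w. g w \<partial>R s\<bar> \<le> (\<integral>w. \<bar>g w\<bar> \<partial>R s)" by (rule integral_abs_bound)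
    also have "\<dots> \<le> (\<integral>w. 1 / 2 * (\<kappa> + (g w)\<^sup>2 / \<kappa>) \<partial>R s)"
      using i am by (intro integral_mono) auto
    also have "\<dots> = 1 / 2 * (\<kappa> + (\<integral>w. (g w)\<^sup>2 \<partial>R s) / \<kappa>)"
      using i by (simp add: prob_space)
    finally show ?thesis .
  qed
  from bd[OF Q] bd[OF Q']
  show "(\<integral>w. g w \<partial>Q s) - (\<integral>w. g w \<partial>Q' s)
       \<le> 1 / 2 * (\<kappa> * 2 + ((\<integral>w. (g w)\<^sup>2 \<partial>Q s) + (\<integral>w. (g w)\<^sup>2 \<partial>Q' s)) / \<kappa>)"
    by (simp add: add_divide_distrib)
qed

text \<open>The length for which, in \<open>gap_step_trig\<close>, \<open>c * t\<close> is at most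
  1/4 and \<open>\<mu> * t\<close> at most \<open>\<kappa> / 2\<close>. It does not depend on the
  initial law.\<close>

definition short_time :: real where "short_time = \<sigma>\<^sup>2 / (8 * B\<^sub>v\<^sup>2)"

lemma short_time_pos: "short_time > 0"
  unfolding short_time_def using \<sigma>_pos B\<^sub>v_ge_1 by auto

text \<open>Let \<open>u\<close> solve the backward equation ending in \<open>f\<close>. Along the
  two flows the quantity Q(u - \<beta> e u^2) - Q'(u + \<beta> e u^2), with e the exponential
  weight, starts nonpositive because the initial laws agree. Its growth rate is the gap of the drift
  term X minus \<beta> times the integrals of \<open>S\<close>. The assumed gap inequality at level
  \<mu> bounds the former by \<open>\<mu> * D / 2\<close> plus a multiple of the integrals of X^2,
  and these are absorbed by \<open>S\<close>. The short time makes the accumulated bound half of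
  what was assumed.\<close>

lemma gap_step_trig:
  assumes Q: "evol Q" and Q': "evol Q'" and init: "Q 0 = Q' 0" and D: "D \<ge> 0" and gap: "gap Q Q' short_time D"
    and t: "t \<in> {0..short_time}" and l: "\<kappa> > 0" and f: "trig_poly f"
  shows "(\<integral>w. f w \<partial>Q t) - (\<integral>w. f w \<partial>Q' t)
       \<le> 1 / 2 * (\<kappa> * (D / 2) + ((\<integral>w. (f w)\<^sup>2 \<partial>Q t) + (\<integral>w. (f w)\<^sup>2 \<partial>Q' t)) / \<kappa>)"
proof -
  have Bp: "B\<^sub>v > 0" using B\<^sub>v_ge_1 by simp
  obtain u where u: "backward t u" and ut: "u t = f"
    by (rule backward_exists[OF f, of "\<lambda>_ _. True" t]) auto
  \<comment> \<open>Three tuned constants: \<open>c\<close> lets half of the carre du champ absorb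
    the cross term; \<beta> gives the coefficient 1 / (2 \<kappa>) once the exponential weight is
    bounded by 2; \<mu> is then exactly what makes X^2 / (2 \<mu>) absorbable by the other
    half.\<close>
  define c where "c = 2 * B\<^sub>v\<^sup>2 / \<sigma>\<^sup>2"
  define \<mu> where "\<mu> = 4 * \<kappa> * B\<^sub>v\<^sup>2 / \<sigma>\<^sup>2"
  define \<beta> where "\<beta> = 1 / (4 * \<kappa>)"
  have pos: "\<mu> > 0" "\<beta> > 0" "c > 0" using l Bp \<sigma>_pos by (auto simp: \<mu>_def \<beta>_def c_def)
  let ?g = "\<lambda>s. grad_y (u s)"
  define X where "X s w = (1 / sqrt \<tau>) * (v (fst w) \<bullet> ?g s w)" for s w
  define S where "S s w = exp (c * s) * (c * (u s w)\<^sup>2 + 2 * u s w * X s w + \<sigma>\<^sup>2 / \<tau> * (?g s w \<bullet> ?g s w))" for s w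
  have oS: "obs t (\<lambda>s w. exp (c * s) * (u s w)\<^sup>2) S"
    using backward_square[OF u, of c] unfolding S_def[abs_def] X_def .
  have oX: "obs t u X" using u unfolding backward_def X_def[abs_def] .
  have lower: "(X s w)\<^sup>2 / (2 * \<mu>) \<le> \<beta> * S s w" if "0 \<le> s" for s w
  proof -
    define k where "k = \<sigma>\<^sup>2 / (2 * \<tau>)"
    have k: "k > 0" using \<sigma>_pos \<tau>_pos by (simp add: k_def)
    have kc: "B\<^sub>v\<^sup>2 / (\<tau> * k) = c" using \<tau>_pos by (simp add: k_def c_def)
    have k2: "\<sigma>\<^sup>2 / \<tau> = k + k" by (simp add: k_def)
    have "k * (?g s w \<bullet> ?g s w) \<le> c * (u s w)\<^sup>2 + 2 * u s w * X s w + \<sigma>\<^sup>2 / \<tau> * (?g s w \<bullet> ?g s w)" (is "_ \<le> ?R")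
      using drift_bound[OF k, of "?g s w" "u s w" "fst w"] unfolding kc k2 distrib_right X_def by linarith
    moreover have "?R \<le> exp (c * s) * ?R"
    proof -
      have "0 \<le> k * (?g s w \<bullet> ?g s w)" using k by simp
      then have "0 \<le> ?R" using calculation by (rule order_trans)
      moreover have "r \<le> exp (c * s) * r" if "0 \<le> r" for r :: real
        using mult_right_mono[OF _ that, of 1 "exp (c * s)"] pos \<open>0 \<le> s\<close> by simp
      ultimately show ?thesis by blast
    qed
    ultimately have kS: "k * (?g s w \<bullet> ?g s w) \<le> S s w" by (simp add: S_def)
    have "(X s w)\<^sup>2 / (2 * \<mu>) \<le> B\<^sub>v\<^sup>2 / \<tau> * (?g s w \<bullet> ?g s w) / (2 * \<mu>)"
      using drift_square[of "fst w" "?g s w"] pos unfolding X_def by (intro divide_right_mono) auto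
    also have "\<dots> = \<beta> * (k * (?g s w \<bullet> ?g s w))"
      using Bp \<sigma>_pos \<tau>_pos l by (simp add: \<mu>_def \<beta>_def k_def field_simps)
    also have "\<dots> \<le> \<beta> * S s w" using kS pos by (intro mult_left_mono) auto
    finally show ?thesis .
  qed
  let ?F1 = "\<lambda>s w. u s w + (- \<beta>) * (exp (c * s) * (u s w)\<^sup>2)"
  let ?F2 = "\<lambda>s w. u s w + \<beta> * (exp (c * s) * (u s w)\<^sup>2)"
  have t0: "0 \<le> t" using t by simp
  have I1: "((\<lambda>s. \<integral>w. X s w + (- \<beta>) * S s w \<partial>Q s) has_integral
      ((\<integral>w. ?F1 t w \<partial>Q t) - (\<integral>w. ?F1 0 w \<partial>Q 0))) {0..t}"
    by (rule obs_has_integral[OF Q t0 obs_add[OF oX obs_cmult[OF oS]]])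
  have I2: "((\<lambda>s. \<integral>w. X s w + \<beta> * S s w \<partial>Q' s) has_integral
      ((\<integral>w. ?F2 t w \<partial>Q' t) - (\<integral>w. ?F2 0 w \<partial>Q' 0))) {0..t}"
    by (rule obs_has_integral[OF Q' t0 obs_add[OF oX obs_cmult[OF oS]]])
  obtain C1 where C1: "\<And>s w. s \<in> {0..t} \<Longrightarrow> \<bar>X s w\<bar> \<le> C1 \<and> \<bar>u s w\<bar> \<le> C1"
    using oX unfolding obs_def obs_with_def by blast
  obtain C2 where C2: "\<And>s w. s \<in> {0..t} \<Longrightarrow> \<bar>S s w\<bar> \<le> C2"
    using oS unfolding obs_def obs_with_def by blast
  note mX = obs_measurable(1,2)[OF oX] and mS = obs_measurable(2)[OF oS]
  have X2: "\<bar>(X s w)\<^sup>2\<bar> \<le> C1\<^sup>2" if "s \<in> {0..t}" for s w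
    using C1[OF that, of w] by (intro abs_power2_le) auto
  have u2: "\<bar>(u s w)\<^sup>2\<bar> \<le> C1\<^sup>2" if "s \<in> {0..t}" for s w
    using C1[OF that, of w] by (intro abs_power2_le) auto
  have int: "integrable (R s) (X s)" "integrable (R s) (S s)" "integrable (R s) (\<lambda>w. (X s w)\<^sup>2)"
    "integrable (R s) (u s)" "integrable (R s) (\<lambda>w. (u s w)\<^sup>2)"
    if R: "evol R" and s: "s \<in> {0..t}" for R s
  proof -
    have s0: "0 \<le> s" using s by simp
    show "integrable (R s) (X s)" using C1[OF s] by (intro evol_integrable[OF R s0 mX(2)]) blast
    show "integrable (R s) (u s)" using C1[OF s] by (intro evol_integrable[OF R s0 mX(1)]) blast
    show "integrable (R s) (S s)" by (rule evol_integrable[OF R s0 mS C2[OF s]])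
    show "integrable (R s) (\<lambda>w. (X s w)\<^sup>2)"
      by (rule evol_integrable[OF R s0 borel_measurable_power[OF mX(2)] X2[OF s]])
    show "integrable (R s) (\<lambda>w. (u s w)\<^sup>2)"
      by (rule evol_integrable[OF R s0 borel_measurable_power[OF mX(1)] u2[OF s]])
  qed
  have le: "(\<integral>w. X s w + (- \<beta>) * S s w \<partial>Q s) - (\<integral>w. X s w + \<beta> * S s w \<partial>Q' s) \<le> \<mu> * D / 2"
    if s: "s \<in> {0..t}" for s
  proof -
    have s': "s \<in> {0..short_time}" using s t by auto
    have "(\<integral>w. X s w \<partial>Q s) - (\<integral>w. X s w \<partial>Q' s)
       \<le> 1 / 2 * (\<mu> * D + ((\<integral>w. (X s w)\<^sup>2 \<partial>Q s) + (\<integral>w. (X s w)\<^sup>2 \<partial>Q' s)) / \<mu>)"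
      using C1[OF s] by (intro gapD[OF gap s' pos(1) mX(2)]) blast
    moreover have Xle: "(\<integral>w. (X s w)\<^sup>2 \<partial>R s) / (2 * \<mu>) \<le> \<beta> * (\<integral>w. S s w \<partial>R s)" if R: "evol R" for R
    proof -
      have "(\<integral>w. (X s w)\<^sup>2 / (2 * \<mu>) \<partial>R s) \<le> (\<integral>w. \<beta> * S s w \<partial>R s)"
        using int[OF R s] lower s by (intro integral_mono integrable_divide) auto
      then show ?thesis by simp
    qed
    note Xle[OF Q] Xle[OF Q']
    moreover have "(\<integral>w. X s w + (- \<beta>) * S s w \<partial>Q s) = (\<integral>w. X s w \<partial>Q s) - \<beta> * (\<integral>w. S s w \<partial>Q s)"
      "(\<integral>w. X s w + \<beta> * S s w \<partial>Q' s) = (\<integral>w. X s w \<partial>Q' s) + \<beta> * (\<integral>w. S s w \<partial>Q' s)"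
      using int[OF Q s] int[OF Q' s] by simp_all
    moreover have "1 / 2 * (\<mu> * D + (a + b) / \<mu>) = \<mu> * D / 2 + a / (2 * \<mu>) + b / (2 * \<mu>)" for a b
      using pos by (simp add: field_simps)
    ultimately show ?thesis by (smt (verit))
  qed
  have "((\<integral>w. ?F1 t w \<partial>Q t) - (\<integral>w. ?F1 0 w \<partial>Q 0)) - ((\<integral>w. ?F2 t w \<partial>Q' t) - (\<integral>w. ?F2 0 w \<partial>Q' 0))
      \<le> (\<mu> * D / 2) * t"
  proof (rule has_integral_le[OF has_integral_diff[OF I1 I2]])
    show "((\<lambda>s. \<mu> * D / 2) has_integral (\<mu> * D / 2) * t) {0..t}"
      using has_integral_const_real[of "\<mu> * D / 2" 0 t] t0 by (simp add: mult.commute)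
  qed (use le in auto)
  \<comment> \<open>Equality of the initial laws enters only here: under a common measure the linear
    parts cancel and the quadratic parts have the right sign.\<close>
  moreover have "(\<integral>w. ?F1 0 w \<partial>Q 0) \<le> (\<integral>w. ?F2 0 w \<partial>Q' 0)"
    unfolding init[symmetric] using int[OF Q, of 0] t0 pos by (intro integral_mono) auto
  ultimately have *: "(\<integral>w. ?F1 t w \<partial>Q t) - (\<integral>w. ?F2 t w \<partial>Q' t) \<le> (\<mu> * D / 2) * t" by linarith
  have tt: "t \<in> {0..t}" using t0 by simp
  have "(\<integral>w. ?F1 t w \<partial>Q t) = (\<integral>w. f w \<partial>Q t) - \<beta> * exp (c * t) * (\<integral>w. (f w)\<^sup>2 \<partial>Q t)"
    using int[OF Q tt] by (simp add: ut)
  moreover have "(\<integral>w. ?F2 t w \<partial>Q' t) = (\<integral>w. f w \<partial>Q' t) + \<beta> * exp (c * t) * (\<integral>w. (f w)\<^sup>2 \<partial>Q' t)"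
    using int[OF Q' tt] by (simp add: ut)
  ultimately have main: "(\<integral>w. f w \<partial>Q t) - (\<integral>w. f w \<partial>Q' t)
     \<le> (\<mu> * D / 2) * t + \<beta> * exp (c * t) * ((\<integral>w. (f w)\<^sup>2 \<partial>Q t) + (\<integral>w. (f w)\<^sup>2 \<partial>Q' t))" (is "_ \<le> _ + _ * ?N")
    using * by (simp add: algebra_simps)
  have "t \<le> \<sigma>\<^sup>2 / (8 * B\<^sub>v\<^sup>2)" using t by (simp add: short_time_def)
  then have tB: "8 * B\<^sub>v\<^sup>2 * t \<le> \<sigma>\<^sup>2" using Bp by (simp add: field_simps)
  have "c * t \<le> 1 / 4" using tB \<sigma>_pos by (simp add: c_def field_simps)
  then have "exp (c * t) \<le> exp (1 / 2)" by simp
  also have "\<dots> \<le> 2" using exp_half_le2 by simp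
  finally have e: "exp (c * t) \<le> 2" .
  have N: "0 \<le> ?N" by (intro add_nonneg_nonneg integral_nonneg) auto
  have "\<beta> * exp (c * t) * ?N \<le> \<beta> * 2 * ?N"
    using e pos N by (intro mult_right_mono mult_left_mono) auto
  also have "\<dots> = 1 / 2 * (?N / \<kappa>)" using l by (simp add: \<beta>_def)
  finally have 1: "\<beta> * exp (c * t) * ?N \<le> 1 / 2 * (?N / \<kappa>)" .
  have "\<mu> * t \<le> \<kappa> / 2"
  proof -
    have "\<mu> * t = \<kappa> * (8 * B\<^sub>v\<^sup>2 * t) / (2 * \<sigma>\<^sup>2)" using \<sigma>_pos by (simp add: \<mu>_def)
    also have "\<dots> \<le> \<kappa> * \<sigma>\<^sup>2 / (2 * \<sigma>\<^sup>2)" using tB l by (intro divide_right_mono mult_left_mono) auto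
    finally show ?thesis using \<sigma>_pos by simp
  qed
  then have "(\<mu> * D / 2) * t \<le> 1 / 2 * (\<kappa> * (D / 2))"
    using mult_right_mono[of "\<mu> * t" "\<kappa> / 2" "D / 2"] D by (simp add: mult_ac)
  then show ?thesis unfolding distrib_left[of "1 / 2"] by (intro order_trans[OF main add_mono[OF _ 1]])
qed

lemma gap_step:
  assumes Q: "evol Q" and Q': "evol Q'" and init: "Q 0 = Q' 0" and D: "D \<ge> 0" and gap: "gap Q Q' short_time D"
  shows "gap Q Q' short_time (D / 2)"
  unfolding gap_def
proof (intro ballI allI impI)
  fix t \<kappa> :: real and g :: "'n state \<Rightarrow> real"
  assume t: "t \<in> {0..short_time}" and l: "0 < \<kappa>" and g: "g \<in> borel_measurable borel" and b: "bounded (range g)"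
  from b obtain B where "\<And>w. \<bar>g w\<bar> \<le> B" by (auto simp: bounded_iff)
  from trig_closure_borel[OF g this]
  show "(\<integral>w. g w \<partial>Q t) - (\<integral>w. g w \<partial>Q' t)
       \<le> 1 / 2 * (\<kappa> * (D / 2) + ((\<integral>w. (g w)\<^sup>2 \<partial>Q t) + (\<integral>w. (g w)\<^sup>2 \<partial>Q' t)) / \<kappa>)"
  proof (induction rule: trig_closure.induct)
    case (base f)
    then show ?case by (rule gap_step_trig[OF Q Q' init D gap t l])
  next
    case (lim F B f)
    have t0: "0 \<le> t" using t by simp
    note m = trig_closure_measurable[OF lim(1)]
    note l1 = integral_bounded_lim[OF evol_prob[OF _ t0] evol_sets[OF _ t0] m lim(2,3)]
    note l2 = integral_bounded_lim_square[OF evol_prob[OF _ t0] evol_sets[OF _ t0] m lim(2,3)]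
    show ?case
    proof (rule LIMSEQ_le)
      show "(\<lambda>k. (\<integral>w. F k w \<partial>Q t) - (\<integral>w. F k w \<partial>Q' t)) \<longlonglongrightarrow> (\<integral>w. f w \<partial>Q t) - (\<integral>w. f w \<partial>Q' t)"
        by (intro tendsto_diff l1 Q Q')
      show "(\<lambda>k. 1 / 2 * (\<kappa> * (D / 2) + ((\<integral>w. (F k w)\<^sup>2 \<partial>Q t) + (\<integral>w. (F k w)\<^sup>2 \<partial>Q' t)) / \<kappa>))
        \<longlonglongrightarrow> 1 / 2 * (\<kappa> * (D / 2) + ((\<integral>w. (f w)\<^sup>2 \<partial>Q t) + (\<integral>w. (f w)\<^sup>2 \<partial>Q' t)) / \<kappa>)"
        by (intro tendsto_mult tendsto_add tendsto_divide tendsto_const l2 Q Q') (use l in auto)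
    qed (use lim.IH in auto)
  qed
qed

text \<open>Two limits in a fixed order: halving drives \<open>D\<close> to 0 while \<kappa> is
  fixed, and afterwards \<kappa> tends to infinity to remove the quadratic term. Applying the
  one-sided result to f and -f gives equality.\<close>

lemma evol_unique_short:
  assumes Q: "evol Q" and Q': "evol Q'" and init: "Q 0 = Q' 0" and t: "t \<in> {0..short_time}"
  shows "Q t = Q' t"
proof -
  have gap: "gap Q Q' short_time (2 / 2 ^ n)" for n
  proof (induction n)
    case 0
    then show ?case using gap_base[OF Q Q', of short_time] short_time_pos by simp
  next
    case (Suc n)
    then show ?case using gap_step[OF Q Q' init _ Suc] by (simp add: mult.commute)
  qed
  have le: "(\<integral>w. g w \<partial>Q t) - (\<integral>w. g w \<partial>Q' t) \<le> 0"
    if g: "g \<in> borel_measurable borel" and B: "\<And>w. \<bar>g w\<bar> \<le> B" for g :: "'n state \<Rightarrow> real" and B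
  proof -
    let ?N = "(\<integral>w. (g w)\<^sup>2 \<partial>Q t) + (\<integral>w. (g w)\<^sup>2 \<partial>Q' t)" and ?d = "(\<integral>w. g w \<partial>Q t) - (\<integral>w. g w \<partial>Q' t)"
    have 1: "?d \<le> 1 / 2 * (?N / \<kappa>)" if l: "\<kappa> > 0" for \<kappa>
    proof (rule LIMSEQ_le_const)
      have "(\<lambda>n. 2 / 2 ^ n :: real) \<longlonglongrightarrow> 0"
        using tendsto_mult[OF tendsto_const LIMSEQ_inverse_realpow_zero[of 2], of 2] by (simp add: divide_inverse)
      then have "(\<lambda>n. 1 / 2 * (\<kappa> * (2 / 2 ^ n) + ?N / \<kappa>)) \<longlonglongrightarrow> 1 / 2 * (\<kappa> * 0 + ?N / \<kappa>)"
        by (intro tendsto_mult tendsto_add tendsto_const)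
      then show "(\<lambda>n. 1 / 2 * (\<kappa> * (2 / 2 ^ n) + ?N / \<kappa>)) \<longlonglongrightarrow> 1 / 2 * (?N / \<kappa>)" by simp
      show "\<exists>N. \<forall>n\<ge>N. ?d \<le> 1 / 2 * (\<kappa> * (2 / 2 ^ n) + ?N / \<kappa>)"
        using gapD[OF gap t l g B] by blast
    qed
    show ?thesis
    proof (rule LIMSEQ_le_const)
      show "(\<lambda>k. 1 / 2 * ?N * inverse (real (Suc k))) \<longlonglongrightarrow> 0"
        by (rule tendsto_mult_right_zero[OF LIMSEQ_inverse_real_of_nat])
      have "?d \<le> 1 / 2 * ?N * inverse (real (Suc n))" for n
        using 1[of "real (Suc n)"] unfolding divide_inverse[of ?N] mult.assoc by simp
      then show "\<exists>N. \<forall>n\<ge>N. ?d \<le> 1 / 2 * ?N * inverse (real (Suc n))" by blast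
    qed
  qed
  have t0: "0 \<le> t" using t by simp
  show ?thesis
  proof (rule measure_eq_bounded_integrals[OF evol_prob[OF Q t0] evol_sets[OF Q t0] evol_prob[OF Q' t0] evol_sets[OF Q' t0]])
    fix f :: "'n state \<Rightarrow> real" assume f: "f \<in> borel_measurable borel" "\<And>w. \<bar>f w\<bar> \<le> 1"
    have "(\<integral>w. f w \<partial>Q t) - (\<integral>w. f w \<partial>Q' t) \<le> 0" by (rule le[OF f])
    moreover have "(\<integral>w. - f w \<partial>Q t) - (\<integral>w. - f w \<partial>Q' t) \<le> 0"
      by (rule le[of _ 1]) (use f in auto)
    ultimately show "(\<integral>w. f w \<partial>Q t) = (\<integral>w. f w \<partial>Q' t)" by simp
  qed
qed

section \<open>From short times to all times\<close>

lemma evol_shift: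
  assumes Q: "evol Q" and a: "0 \<le> a"
  shows "evol (\<lambda>s. Q (a + s))"
  unfolding evol_def
proof (intro conjI allI impI)
  fix t :: real assume "0 \<le> t"
  then show "prob_space (Q (a + t))" "sets (Q (a + t)) = sets borel"
    using evol_prob[OF Q] evol_sets[OF Q] a by auto
next
  fix f :: "'n state \<Rightarrow> real" and t :: real assume f: "test_fun f" and t: "0 \<le> t"
  have "((\<lambda>r. \<integral>w. L f w \<partial>Q r) has_integral ((\<integral>w. f w \<partial>Q (a + t)) - (\<integral>w. f w \<partial>Q a))) {0 + a..t + a}"
    using evol_has_integral_between[OF Q f a, of "a + t"] t by (simp add: add.commute)
  then have "((\<lambda>r. \<integral>w. L f w \<partial>Q r) \<circ> ((+) a) has_integral ((\<integral>w. f w \<partial>Q (a + t)) - (\<integral>w. f w \<partial>Q a))) {0..t}"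
    by (simp only: has_integral_shift_Icc_real)
  then show "((\<lambda>s. \<integral>w. L f w \<partial>Q (a + s)) has_integral ((\<integral>w. f w \<partial>Q (a + t)) - (\<integral>w. f w \<partial>Q (a + 0)))) {0..t}"
    by (simp add: o_def)
qed

text \<open>The uniqueness interval has the same length for every initial law, so shifted solutions
  can be compared again from each multiple of \<open>short_time\<close>; a remainder shorter than
  one step is left.\<close>

theorem evol_unique:
  assumes "evol Q" "evol Q'" "Q 0 = Q' 0" "0 \<le> t"
  shows "Q t = Q' t"
proof -
  have eq: "Q (real n * short_time) = Q' (real n * short_time)" for n
  proof (induction n)
    case (Suc n)
    have a: "0 \<le> real n * short_time" using short_time_pos by simp
    have "Q (real n * short_time + short_time) = Q' (real n * short_time + short_time)"
      by (rule evol_unique_short[OF evol_shift[OF assms(1) a] evol_shift[OF assms(2) a]])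
        (use Suc short_time_pos in auto)
    then show ?case by (simp add: algebra_simps)
  qed (use assms in simp)
  define n where "n = nat \<lfloor>t / short_time\<rfloor>"
  have n: "real n * short_time \<le> t" "t \<le> real n * short_time + short_time"
  proof -
    have "real n = of_int \<lfloor>t / short_time\<rfloor>" using assms(4) short_time_pos by (simp add: n_def)
    then have "real n \<le> t / short_time" "t / short_time \<le> real n + 1" by linarith+
    then show "real n * short_time \<le> t" "t \<le> real n * short_time + short_time"
      using short_time_pos by (simp_all add: field_simps)
  qed
  have a: "0 \<le> real n * short_time" using short_time_pos by simp
  have "Q (real n * short_time + (t - real n * short_time)) = Q' (real n * short_time + (t - real n * short_time))"
    by (rule evol_unique_short[OF evol_shift[OF assms(1) a] evol_shift[OF assms(2) a]]) (use eq n in auto)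
  then show ?thesis by simp
qed

end

section \<open>The Markov property\<close>

locale kinetic_diffusion = kinetic \<sigma> \<tau> B\<^sub>v v
  for \<sigma> \<tau> B\<^sub>v :: real and v :: "real ^ ('n::finite) \<Rightarrow> real ^ 'n" +
  fixes K :: "real \<Rightarrow> 'n state \<Rightarrow> 'n state measure"
  assumes v_periodic: "int_vec k \<Longrightarrow> v (x + k) = v x"
    and K: "diffusion_law \<sigma> \<tau> v K"
begin

lemma K_0: "K 0 z = return borel z"
  using K unfolding diffusion_law_def by blast

lemma K_evol: "evol (\<lambda>t. K t z)"
  unfolding evol_def
proof (intro conjI allI impI)
  fix t :: real assume "0 \<le> t"
  with K show "prob_space (K t z)" "sets (K t z) = sets borel"
    unfolding diffusion_law_def by blast+
next
  fix f :: "'n state \<Rightarrow> real" and t :: real assume f: "test_fun f" and t: "0 \<le> t"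
  have "f \<in> borel_measurable borel"
    using f unfolding test_fun_def by (intro borel_measurable_continuous_onI smooth_fun_continuous) blast
  then have "(\<integral>w. f w \<partial>K 0 z) = f z" by (simp add: K_0 integral_return)
  moreover have "((\<lambda>s. \<integral>w. L f w \<partial>K s z) has_integral ((\<integral>w. f w \<partial>K t z) - f z)) {0..t}"
    using K f t unfolding diffusion_law_def by blast
  ultimately show "((\<lambda>s. \<integral>w. L f w \<partial>K s z) has_integral ((\<integral>w. f w \<partial>K t z) - (\<integral>w. f w \<partial>K 0 z))) {0..t}"
    by simp
qed

lemmas K_prob = evol_prob[OF K_evol] and K_sets = evol_sets[OF K_evol] and K_integrable = evol_integrable[OF K_evol]

lemma K_measurable:
  assumes "0 \<le> t"
  shows "K t \<in> borel \<rightarrow>\<^sub>M subprob_algebra borel"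
  using K assms unfolding diffusion_law_def by (blast intro: measurable_prob_algebraD)

lemma K_integral_measurable:
  fixes f :: "'n state \<Rightarrow> real"
  assumes "0 \<le> t" "f \<in> borel_measurable borel"
  shows "(\<lambda>z. \<integral>w. f w \<partial>K t z) \<in> borel_measurable borel"
  by (rule measurable_compose[OF K_measurable[OF assms(1)] integral_measurable_subprob_algebra[OF assms(2)]])

section \<open>Invariance under integer translations of the position\<close>

lemma gen_translate:
  assumes "int_vec k" "smooth_fun f"
  shows "L (\<lambda>w. f (w + (k, 0))) z = L f (z + (k, 0))"
proof -
  have D: "frechet_derivative (\<lambda>w. g (w + a)) (at z) = frechet_derivative g (at (z + a))"
    if "smooth_fun g" for g :: "'n state \<Rightarrow> real" and a z :: "'n state"
    by (rule frechet_derivative_at[symmetric])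
      (use has_derivative_compose[OF _ smooth_fun_has_derivative[OF that], of "\<lambda>x::'n state. x + a" "\<lambda>x. x" z UNIV]
        in \<open>simp add: has_derivative_add_const\<close>)
  show ?thesis
    by (simp add: gen_def Let_def D[OF assms(2)] D[OF smooth_fun_frechet[OF assms(2)]] v_periodic[OF assms(1)])
qed

lemma test_fun_translate:
  fixes f :: "'n state \<Rightarrow> real"
  assumes "test_fun f" shows "test_fun (\<lambda>w. f (w + a))"
proof -
  have "bounded (closure {z. f z \<noteq> 0})" using assms unfolding test_fun_def by (blast intro: compact_imp_bounded)
  then have "bounded {z. f z \<noteq> 0}" by (rule bounded_subset[OF _ closure_subset])
  then obtain R where R: "\<And>z. f z \<noteq> 0 \<Longrightarrow> norm z \<le> R" unfolding bounded_iff by blast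
  show ?thesis
  proof (rule test_funI)
    show "smooth_fun (\<lambda>w. f (w + a))" using assms unfolding test_fun_def by (blast intro: smooth_fun_translate)
    fix w :: "'n state" assume "R + norm a + 1 \<le> norm w"
    then have "R < norm (w + a)" using norm_diff_ineq[of w a] by linarith
    then show "f (w + a) = 0" using R[of "w + a"] by force
  qed
qed

text \<open>The translated law solves the same Kolmogorov equation, because the generator commutes
  with integer shifts of x, and it has the right Dirac mass at time 0; uniqueness does the
  rest.\<close>

lemma K_translate:
  assumes k: "int_vec k" and t: "0 \<le> t"
  shows "K t (z + (k, 0)) = distr (K t z) borel (\<lambda>w. w + (k, 0))"
proof (rule evol_unique[OF K_evol _ _ t])
  let ?T = "\<lambda>w::'n state. w + (k, 0)"
  have T: "?T \<in> borel \<rightarrow>\<^sub>M borel" by simp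
  have T': "?T \<in> K s z \<rightarrow>\<^sub>M borel" if "0 \<le> s" for s using T measurable_cong_sets[OF K_sets[OF that] refl] by blast
  show "evol (\<lambda>t. distr (K t z) borel ?T)"
    unfolding evol_def
  proof (intro conjI allI impI)
    fix s :: real assume s: "0 \<le> s"
    show "prob_space (distr (K s z) borel ?T)" by (rule prob_space.prob_space_distr[OF K_prob[OF s] T'[OF s]])
    show "sets (distr (K s z) borel ?T) = sets borel" by simp
  next
    fix f :: "'n state \<Rightarrow> real" and t :: real assume f: "test_fun f" and t: "0 \<le> t"
    have sf: "smooth_fun f" using f by (simp add: test_fun_def)
    have 1: "(\<integral>w. g w \<partial>distr (K s z) borel ?T) = (\<integral>w. g (?T w) \<partial>K s z)"
      if "continuous_on UNIV g" "0 \<le> s" for s and g :: "'n state \<Rightarrow> real"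
      by (rule integral_distr[OF T'[OF that(2)] borel_measurable_continuous_onI[OF that(1)]])
    have "((\<lambda>s. \<integral>w. L (\<lambda>w. f (?T w)) w \<partial>K s z) has_integral ((\<integral>w. f (?T w) \<partial>K t z) - (\<integral>w. f (?T w) \<partial>K 0 z))) {0..t}"
      by (rule evol_has_integral[OF K_evol test_fun_translate[OF f] t])
    then have "((\<lambda>s. \<integral>w. L f (?T w) \<partial>K s z) has_integral
        ((\<integral>w. f w \<partial>distr (K t z) borel ?T) - (\<integral>w. f w \<partial>distr (K 0 z) borel ?T))) {0..t}"
      unfolding gen_translate[OF k sf] 1[OF smooth_fun_continuous[OF sf] t] 1[OF smooth_fun_continuous[OF sf] order_refl] .
    then show "((\<lambda>s. \<integral>w. L f w \<partial>distr (K s z) borel ?T) has_integral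
        ((\<integral>w. f w \<partial>distr (K t z) borel ?T) - (\<integral>w. f w \<partial>distr (K 0 z) borel ?T))) {0..t}"
      by (rule has_integral_eq[rotated]) (use 1[OF continuous_on_gen[OF sf v_cont]] in auto)
  qed
  show "K 0 (z + (k, 0)) = distr (K 0 z) borel ?T"
    by (simp add: K_0 distr_return)
qed

lemma periodic_K_integral:
  fixes f :: "'n state \<Rightarrow> real"
  assumes "f \<in> borel_measurable borel" "periodic_x f" "0 \<le> t"
  shows "periodic_x (\<lambda>z. \<integral>w. f w \<partial>K t z)"
  unfolding periodic_x_def
proof (intro allI impI)
  fix x y k :: "real ^ 'n" assume k: "int_vec k"
  have "(\<lambda>w::'n state. w + (k, 0)) \<in> borel \<rightarrow>\<^sub>M borel" by simp
  then have T: "(\<lambda>w::'n state. w + (k, 0)) \<in> K t (x, y) \<rightarrow>\<^sub>M borel"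
    using measurable_cong_sets[OF K_sets[OF assms(3)] refl] by blast
  have "K t (x + k, y) = distr (K t (x, y)) borel (\<lambda>w. w + (k, 0))"
    using K_translate[OF k assms(3), of "(x, y)"] by simp
  then have "(\<integral>w. f w \<partial>K t (x + k, y)) = (\<integral>w. f (w + (k, 0)) \<partial>K t (x, y))"
    using integral_distr[OF T assms(1)] by simp
  also have "\<dots> = (\<integral>w. f w \<partial>K t (x, y))"
    using assms(2) k unfolding periodic_x_def by (intro Bochner_Integration.integral_cong refl) (auto simp: add_Pair)
  finally show "(\<integral>w. f w \<partial>K t (x + k, y)) = (\<integral>w. f w \<partial>K t (x, y))" .
qed

section \<open>Mixtures of initial laws and the semigroup property\<close>

lemma K_bind_integral:
  fixes f :: "'n state \<Rightarrow> real"
  assumes Q: "prob_space Q" "sets Q = sets borel" and t: "0 \<le> t"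
    and f: "f \<in> borel_measurable borel" "\<And>w. \<bar>f w\<bar> \<le> B"
  shows "(\<integral>w. f w \<partial>(Q \<bind> K t)) = (\<integral>z. (\<integral>w. f w \<partial>K t z) \<partial>Q)"
proof (rule integral_bind)
  show "K t \<in> Q \<rightarrow>\<^sub>M subprob_algebra borel"
    using K_measurable[OF t] measurable_cong_sets[OF Q(2) refl] by blast
  show "finite_measure Q" using Q(1) by (simp add: prob_space.axioms)
  show "AE z in Q. emeasure (K t z) (space (K t z)) \<le> ennreal 1"
    using prob_space.emeasure_space_1[OF K_prob[OF t]] by simp
qed (use f in auto)

text \<open>The equation is differentiated under the integral over the starting point instead of
  exchanging two integrals, so that measurability in \<open>z\<close> at each fixed time suffices.
  Difference quotients are dominated by the Lipschitz bound of
  \<open>evol_lipschitz\<close>.\<close>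

lemma K_bind_evol:
  assumes Q: "prob_space Q" "sets Q = sets borel"
  shows "evol (\<lambda>t. Q \<bind> K t)"
  unfolding evol_def
proof (intro conjI allI impI)
  fix t :: real assume t: "0 \<le> t"
  have m: "K t \<in> Q \<rightarrow>\<^sub>M subprob_algebra borel"
    using K_measurable[OF t] measurable_cong_sets[OF Q(2) refl] by blast
  show "prob_space (Q \<bind> K t)"
    by (rule prob_space.prob_space_bind[OF Q(1) _ m]) (simp add: K_prob[OF t])
  have "space Q \<noteq> {}" using prob_space.not_empty[OF Q(1)] .
  then show "sets (Q \<bind> K t) = sets borel"
    by (intro sets_bind K_sets[OF t])
next
  fix f :: "'n state \<Rightarrow> real" and T :: real assume f: "test_fun f" and T: "0 \<le> T"
  obtain B where B: "\<And>w. \<bar>L f w\<bar> \<le> B" "\<And>w. \<bar>f w\<bar> \<le> B" using test_fun_gen_bounded[OF f v_cont, of \<sigma> \<tau>] by blast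
  have sf: "smooth_fun f" using f by (simp add: test_fun_def)
  have fm: "f \<in> borel_measurable borel" "L f \<in> borel_measurable borel"
    by (intro borel_measurable_continuous_onI smooth_fun_continuous sf continuous_on_gen v_cont)+
  interpret prob_space Q by fact
  let ?\<phi> = "\<lambda>t. \<integral>z. (\<integral>w. f w \<partial>K t z) \<partial>Q"
  have int: "integrable Q (\<lambda>z. \<integral>w. f w \<partial>K t z)" if "0 \<le> t" for t
    by (rule prob_space_integrable_borel[OF Q K_integral_measurable[OF that fm(1)]
          prob_space.integral_abs_le[OF K_prob[OF that] B(2)]])
  have "(?\<phi> has_real_derivative (\<integral>z. (\<integral>w. L f w \<partial>K s z) \<partial>Q)) (at s within {0..T})" if s: "s \<in> {0..T}" for s
    unfolding has_field_derivative_iff tendsto_at_iff_sequentially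
  proof (intro allI impI)
    fix X :: "nat \<Rightarrow> real" assume X: "\<forall>i. X i \<in> {0..T} - {s}" "X \<longlonglongrightarrow> s"
    have X0: "0 \<le> X i" "X i \<noteq> s" for i using X(1)[rule_format, of i] by auto
    have s0: "0 \<le> s" using s by simp
    let ?F = "\<lambda>i z. ((\<integral>w. f w \<partial>K (X i) z) - (\<integral>w. f w \<partial>K s z)) / (X i - s)"
    have "(\<lambda>i. \<integral>z. ?F i z \<partial>Q) \<longlonglongrightarrow> (\<integral>z. (\<integral>w. L f w \<partial>K s z) \<partial>Q)"
    proof (rule integral_bounded_lim[OF Q])
      show "?F i \<in> borel_measurable borel" for i
        by (intro borel_measurable_divide borel_measurable_diff borel_measurable_const K_integral_measurable fm X0 s0)
      show "\<bar>?F i z\<bar> \<le> B" for i z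
        using evol_lipschitz[OF K_evol f B(1) s0 X0(1), of i z] X0(2)[of i] by (simp add: abs_divide divide_le_eq)
      show "(\<lambda>i. ?F i z) \<longlonglongrightarrow> (\<integral>w. L f w \<partial>K s z)" for z
        using evol_has_derivative[OF K_evol f s, of z] X
        unfolding has_field_derivative_iff tendsto_at_iff_sequentially comp_def by blast
    qed
    then show "((\<lambda>y. (?\<phi> y - ?\<phi> s) / (y - s)) \<circ> X) \<longlonglongrightarrow> (\<integral>z. (\<integral>w. L f w \<partial>K s z) \<partial>Q)"
      using int[OF X0(1)] int[OF s0] by (simp add: o_def)
  qed
  then have "((\<lambda>s. \<integral>z. (\<integral>w. L f w \<partial>K s z) \<partial>Q) has_integral (?\<phi> T - ?\<phi> 0)) {0..T}"
    by (intro fundamental_theorem_of_calculus T) (simp add: has_real_derivative_iff_has_vector_derivative)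
  then show "((\<lambda>s. \<integral>w. L f w \<partial>(Q \<bind> K s)) has_integral
      ((\<integral>w. f w \<partial>(Q \<bind> K T)) - (\<integral>w. f w \<partial>(Q \<bind> K 0)))) {0..T}"
    unfolding K_bind_integral[OF Q T fm(1) B(2)] K_bind_integral[OF Q order_refl fm(1) B(2)]
    by (rule has_integral_eq[rotated]) (simp add: K_bind_integral[OF Q _ fm(2) B(1)])
qed

text \<open>The law restarted at time \<open>s\<close> and the mixture of kernels over
  \<open>K s z\<close> both solve the Kolmogorov equation from the initial law
  \<open>K s z\<close>.\<close>

theorem chapman_kolmogorov:
  fixes f :: "'n state \<Rightarrow> real"
  assumes s: "0 \<le> s" and t: "0 \<le> t" and f: "f \<in> borel_measurable borel" "\<And>w. \<bar>f w\<bar> \<le> B"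
  shows "(\<integral>w. f w \<partial>K (s + t) z) = (\<integral>x. (\<integral>w. f w \<partial>K t x) \<partial>K s z)"
proof -
  have "K (s + t) z = K s z \<bind> K t"
  proof (rule evol_unique[OF evol_shift[OF K_evol s] K_bind_evol[OF K_prob[OF s] K_sets[OF s]] _ t])
    have "K 0 = return borel" by (simp add: fun_eq_iff K_0)
    then show "K (s + 0) z = K s z \<bind> K 0"
      using bind_return''[OF K_sets[OF s]] by simp
  qed
  then show ?thesis by (simp add: K_bind_integral[OF K_prob[OF s] K_sets[OF s] t f])
qed

end

section \<open>Comparison with the Gaussian process\<close>

context kinetic begin

text \<open>The Gaussian law of (x, y) is built from independent pieces: first the y-noise, with
  deviation \<open>ou_sd_y\<close>, then x given y. \<open>ou_shear\<close> is the regression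
  coefficient of the x-noise on the y-noise, equal to sqrt \<tau> (1 - e) / (1 + e) with e = exp(-t
  / \<tau>), and \<open>ou_sd_x\<close> is the residual deviation of x given y.\<close>

definition ou_shear :: "real \<Rightarrow> real" where
  "ou_shear t = 2 * sqrt \<tau> / (1 + exp (- t / \<tau>)) - sqrt \<tau>"

definition ou_sd_y :: "real \<Rightarrow> real" where
  "ou_sd_y t = \<sigma> * sqrt ((1 - exp (- t / \<tau>) * exp (- t / \<tau>)) / 2)"

definition ou_sd_x :: "real \<Rightarrow> real" where
  "ou_sd_x t = \<sigma> * sqrt (t - 2 * \<tau> * (1 - exp (- t / \<tau>)) / (1 + exp (- t / \<tau>)))"

definition ou_mean_x :: "real \<Rightarrow> 'n state \<Rightarrow> real ^ 'n" where
  "ou_mean_x t z = fst z + (sqrt \<tau> * (1 - exp (- t / \<tau>))) *\<^sub>R snd z"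

definition ou_mean_y :: "real \<Rightarrow> 'n state \<Rightarrow> real ^ 'n" where
  "ou_mean_y t z = exp (- t / \<tau>) *\<^sub>R snd z"

definition ou_map :: "real \<Rightarrow> 'n state \<Rightarrow> 'n state \<Rightarrow> 'n state" where
  "ou_map t z q =
     (let dy = ou_sd_y t *\<^sub>R fst q in (ou_mean_x t z + ou_shear t *\<^sub>R dy + ou_sd_x t *\<^sub>R snd q, ou_mean_y t z + dy))"

definition ou_law :: "real \<Rightarrow> 'n state \<Rightarrow> 'n state measure" where
  "ou_law t z = distr (gauss \<Otimes>\<^sub>M gauss) borel (ou_map t z)"

lemma sets_gauss_pair: "sets (gauss \<Otimes>\<^sub>M gauss :: 'n state measure) = sets borel"
  unfolding sets_pair_measure_cong[OF sets_gauss sets_gauss] borel_prod ..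

lemma ou_map_measurable: "ou_map t z \<in> (gauss \<Otimes>\<^sub>M gauss) \<rightarrow>\<^sub>M borel"
proof -
  have "continuous_on UNIV (ou_map t z)"
    unfolding ou_map_def[abs_def] Let_def by (intro continuous_intros)
  then have "ou_map t z \<in> borel \<rightarrow>\<^sub>M borel" by (rule borel_measurable_continuous_onI)
  then show ?thesis using measurable_cong_sets[OF sets_gauss_pair refl] by blast
qed

lemma prob_space_gauss_pair: "prob_space (gauss \<Otimes>\<^sub>M gauss :: 'n state measure)"
proof -
  interpret G: prob_space "gauss :: (real ^ 'n) measure" by (rule prob_space_gauss)
  interpret pair_prob_space "gauss :: (real ^ 'n) measure" "gauss :: (real ^ 'n) measure" ..
  show ?thesis by unfold_locales
qed

lemma prob_space_ou_law: "prob_space (ou_law t z)"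
  unfolding ou_law_def by (rule prob_space.prob_space_distr[OF prob_space_gauss_pair ou_map_measurable])

lemma sets_ou_law: "sets (ou_law t z) = sets borel"
  by (simp add: ou_law_def)

text \<open>The term subtracted under the root in \<open>ou_sd_x\<close> is at most
  \<open>2 * \<tau>\<close>, so the assumed lower bound on \<open>t\<close> is a simple way to keep
  the residual nondegenerate.\<close>

lemma ou_sd_pos:
  assumes "t > 2 * \<tau>"
  shows "ou_sd_x t > 0" "ou_sd_y t > 0"
proof -
  define e where "e = exp (- t / \<tau>)"
  have e: "0 < e" "e < 1" using assms \<tau>_pos by (auto simp: e_def)
  have "e * e < 1 * 1" using e by (intro mult_strict_mono) auto
  then show "ou_sd_y t > 0" using \<sigma>_pos unfolding ou_sd_y_def e_def[symmetric] by simp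
  have "2 * \<tau> * (1 - e) / (1 + e) \<le> 2 * \<tau> * 1 / 1"
    using e \<tau>_pos by (intro frac_le mult_left_mono) auto
  then have "0 < t - 2 * \<tau> * (1 - e) / (1 + e)" using assms by simp
  then show "ou_sd_x t > 0" using \<sigma>_pos unfolding ou_sd_x_def e_def[symmetric] by simp
qed

text \<open>Completing the square in \<eta>. Twice \<open>damp\<close> is the variance of the phase,
  and the two squares correspond to the two independent Gaussian variables in
  \<open>ou_map\<close>.\<close>

lemma damp_sum_of_squares:
  fixes \<xi> \<eta> :: "real ^ 'n"
  assumes t: "t > 2 * \<tau>"
  defines "\<zeta> \<equiv> \<eta> + ou_shear t *\<^sub>R \<xi>"
  shows "damp \<xi> \<eta> t = ((ou_sd_x t)\<^sup>2 * (\<xi> \<bullet> \<xi>) + (ou_sd_y t)\<^sup>2 * (\<zeta> \<bullet> \<zeta>)) / 2"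
proof -
  define e where "e = exp (- t / \<tau>)"
  define d where "d = \<eta> - sqrt \<tau> *\<^sub>R \<xi>"
  define k where "k = 2 * sqrt \<tau> / (1 + e)"
  have e: "0 < e" "e < 1" using t \<tau>_pos by (auto simp: e_def)
  have e2: "exp (- 2 * t / \<tau>) = e * e" by (simp add: e_def flip: exp_add)
  have "e * e < 1 * 1" using e by (intro mult_strict_mono) auto
  then have p2: "(ou_sd_y t)\<^sup>2 = \<sigma>\<^sup>2 * ((1 - e * e) / 2)"
    unfolding ou_sd_y_def e_def[symmetric] by (simp add: power_mult_distrib)
  have "2 * \<tau> * (1 - e) / (1 + e) \<le> 2 * \<tau> * 1 / 1"
    using e \<tau>_pos by (intro frac_le mult_left_mono) auto
  then have r2: "(ou_sd_x t)\<^sup>2 = \<sigma>\<^sup>2 * (t - 2 * \<tau> * (1 - e) / (1 + e))"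
    using t unfolding ou_sd_x_def e_def[symmetric] by (simp add: power_mult_distrib)
  have "\<zeta> = d + k *\<^sub>R \<xi>"
    by (simp add: \<zeta>_def d_def k_def ou_shear_def e_def algebra_simps)
  then have z2: "\<zeta> \<bullet> \<zeta> = d \<bullet> d + 2 * k * (\<xi> \<bullet> d) + k * k * (\<xi> \<bullet> \<xi>)"
    by (simp add: inner_add_left inner_add_right inner_commute[of d \<xi>] distrib_left)
  have f: "1 - e * e = (1 - e) * (1 + e)" by (simp add: algebra_simps)
  have k1: "(1 - e * e) * k = 2 * sqrt \<tau> * (1 - e)" using e by (simp add: f k_def)
  have "(1 - e * e) * (k * k) = ((1 - e * e) * k) * k" by simp
  also have "\<dots> = 4 * (sqrt \<tau> * sqrt \<tau>) * (1 - e) / (1 + e)" unfolding k1 by (simp add: k_def)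
  finally have k2: "(1 - e * e) * (k * k) = 4 * \<tau> * (1 - e) / (1 + e)" using \<tau>_pos by simp
  have "(ou_sd_y t)\<^sup>2 * (\<zeta> \<bullet> \<zeta>) = \<sigma>\<^sup>2 / 2 * ((1 - e * e) * (d \<bullet> d) + 2 * ((1 - e * e) * k) * (\<xi> \<bullet> d) + ((1 - e * e) * (k * k)) * (\<xi> \<bullet> \<xi>))"
    unfolding p2 z2 by (simp add: algebra_simps diff_divide_distrib add_divide_distrib)
  also have "\<dots> = \<sigma>\<^sup>2 / 2 * ((1 - e * e) * (d \<bullet> d) + 4 * sqrt \<tau> * (1 - e) * (\<xi> \<bullet> d) + 4 * \<tau> * (1 - e) / (1 + e) * (\<xi> \<bullet> \<xi>))"
    unfolding k1 k2 by simp
  finally have y: "(ou_sd_y t)\<^sup>2 * (\<zeta> \<bullet> \<zeta>) = \<dots>" .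
  have x: "(ou_sd_x t)\<^sup>2 * (\<xi> \<bullet> \<xi>) = \<sigma>\<^sup>2 * (t * (\<xi> \<bullet> \<xi>)) - \<sigma>\<^sup>2 / 2 * (4 * \<tau> * (1 - e) / (1 + e) * (\<xi> \<bullet> \<xi>))"
    unfolding r2 by (simp add: algebra_simps)
  show ?thesis
    unfolding x y damp_def d_def[symmetric] e2 e_def[symmetric]
    by (simp add: algebra_simps diff_divide_distrib add_divide_distrib)
qed

text \<open>Two applications of the Gaussian characteristic function, first to the residual x-noise
  and then to the y-noise. This identifies the explicit backward solution at its initial time with
  an expectation, which is what makes positivity and densities available.\<close>

lemma ou_law_wave:
  assumes t: "t > 2 * \<tau>"
  shows "(\<integral>w. c * cos ((\<xi>, \<eta>) \<bullet> w + \<phi>) \<partial>ou_law t z) = c * plane_wave \<xi> \<eta> \<phi> t z"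
proof -
  interpret G: prob_space "gauss :: (real ^ 'n) measure" by (rule prob_space_gauss)
  interpret P: pair_prob_space "gauss :: (real ^ 'n) measure" "gauss :: (real ^ 'n) measure" ..
  define \<zeta> where "\<zeta> = \<eta> + ou_shear t *\<^sub>R \<xi>"
  define \<theta> where "\<theta> = \<xi> \<bullet> ou_mean_x t z + \<eta> \<bullet> ou_mean_y t z + \<phi>"
  have phase: "(\<xi>, \<eta>) \<bullet> ou_map t z (g, h) + \<phi> = (ou_sd_x t *\<^sub>R \<xi>) \<bullet> h + ((ou_sd_y t *\<^sub>R \<zeta>) \<bullet> g + \<theta>)" for g h
    by (simp add: ou_map_def Let_def \<zeta>_def \<theta>_def inner_add_left inner_add_right distrib_left distrib_right)
  have m: "(\<lambda>q. cos ((\<xi>, \<eta>) \<bullet> ou_map t z q + \<phi>)) \<in> borel_measurable (gauss \<Otimes>\<^sub>M gauss)"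
  proof -
    have "(\<lambda>w. cos ((\<xi>, \<eta>) \<bullet> w + \<phi>)) \<in> borel \<rightarrow>\<^sub>M borel"
      by (intro borel_measurable_continuous_onI continuous_intros)
    from measurable_compose[OF ou_map_measurable this] show ?thesis .
  qed
  have int: "integrable (gauss \<Otimes>\<^sub>M gauss) (\<lambda>q. cos ((\<xi>, \<eta>) \<bullet> ou_map t z q + \<phi>))"
    by (rule P.P.integrable_const_bound[of _ 1]) (use m in auto)
  have "(\<integral>w. cos ((\<xi>, \<eta>) \<bullet> w + \<phi>) \<partial>ou_law t z) = (\<integral>q. cos ((\<xi>, \<eta>) \<bullet> ou_map t z q + \<phi>) \<partial>(gauss \<Otimes>\<^sub>M gauss))"
    unfolding ou_law_def
    by (rule integral_distr[OF ou_map_measurable]) (intro borel_measurable_continuous_onI continuous_intros)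
  also have "\<dots> = (\<integral>g. (\<integral>h. cos ((\<xi>, \<eta>) \<bullet> ou_map t z (g, h) + \<phi>) \<partial>gauss) \<partial>gauss)"
    by (rule P.integral_fst'[OF int, symmetric])
  also have "\<dots> = (\<integral>g. exp (- ((ou_sd_x t *\<^sub>R \<xi>) \<bullet> (ou_sd_x t *\<^sub>R \<xi>)) / 2) * cos ((ou_sd_y t *\<^sub>R \<zeta>) \<bullet> g + \<theta>) \<partial>gauss)"
    unfolding phase gauss_cos ..
  also have "\<dots> = exp (- ((ou_sd_x t *\<^sub>R \<xi>) \<bullet> (ou_sd_x t *\<^sub>R \<xi>)) / 2) *
      (exp (- ((ou_sd_y t *\<^sub>R \<zeta>) \<bullet> (ou_sd_y t *\<^sub>R \<zeta>)) / 2) * cos \<theta>)"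
    unfolding integral_mult_right_zero gauss_cos ..
  also have "\<dots> = exp (- damp \<xi> \<eta> t) * cos \<theta>"
    unfolding damp_sum_of_squares[OF t] \<zeta>_def[symmetric] mult.assoc[symmetric] exp_add[symmetric]
    by (simp add: power2_eq_square add_divide_distrib)
  also have "\<theta> = (\<xi>, freq \<xi> \<eta> t) \<bullet> z + \<phi>"
    by (simp add: \<theta>_def ou_mean_x_def ou_mean_y_def freq_def inner_prod_def inner_add_left inner_add_right inner_diff_left algebra_simps)
  finally show ?thesis by (simp add: plane_wave_def)
qed

text \<open>The time derivative of \<open>exp (c s) Q\<^sub>s(u\<^sub>s\<^sup>2)\<close> is nonnegative when \<open>u\<close> solves the backward equation
  without drift \<open>v\<close>: the carre du champ absorbs the drift term. This replaces Girsanov's formula.\<close>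

lemma ou_law_le_evol_trig:
  assumes Q: "evol Q" and init: "Q 0 = return borel z" and t: "t > 2 * \<tau>" and f: "trig_poly f"
  shows "(\<integral>w. f w \<partial>ou_law t z)\<^sup>2 \<le> exp (B\<^sub>v\<^sup>2 / \<sigma>\<^sup>2 * t) * (\<integral>w. (f w)\<^sup>2 \<partial>Q t)"
proof -
  have t0: "0 \<le> t" using t \<tau>_pos by simp
  have tint: "integrable (ou_law t z) f" if f: "trig_poly f" for f :: "'n state \<Rightarrow> real" and z
  proof -
    obtain B where "\<And>w. \<bar>f w\<bar> \<le> B" using trig_poly_bounded[OF f] by blast
    then show ?thesis
      by (intro prob_space_integrable_borel[OF prob_space_ou_law sets_ou_law])
        (auto intro!: borel_measurable_continuous_onI trig_poly_continuous f)
  qed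
  obtain u where u: "backward t u" "u t = f" "u 0 = (\<lambda>z. \<integral>w. f w \<partial>ou_law t z)"
  proof (rule backward_exists[OF f, of "\<lambda>f h. h = (\<lambda>z. \<integral>w. f w \<partial>ou_law t z)" t])
    show "(\<lambda>z. c * plane_wave \<xi> \<eta> \<phi> t z) = (\<lambda>z. \<integral>w. c * cos ((\<xi>, \<eta>) \<bullet> w + \<phi>) \<partial>ou_law t z)" for c \<xi> \<eta> \<phi>
      unfolding ou_law_wave[OF t] ..
    show "(\<lambda>z. f' z + g' z) = (\<lambda>z. \<integral>w. f w + g w \<partial>ou_law t z)"
      if "trig_poly f" "trig_poly g" "f' = (\<lambda>z. \<integral>w. f w \<partial>ou_law t z)" "g' = (\<lambda>z. \<integral>w. g w \<partial>ou_law t z)"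
      for f g f' g'
      using that(3,4) Bochner_Integration.integral_add[OF tint[OF that(1)] tint[OF that(2)]] by simp
  qed (rule that)
  define c where "c = B\<^sub>v\<^sup>2 / \<sigma>\<^sup>2"
  define G where "G s w = exp (c * s) * (c * (u s w)\<^sup>2 + 2 * u s w * ((1 / sqrt \<tau>) * (v (fst w) \<bullet> grad_y (u s) w))
      + \<sigma>\<^sup>2 / \<tau> * (grad_y (u s) w \<bullet> grad_y (u s) w))" for s w
  have "((\<lambda>s. \<integral>w. G s w \<partial>Q s) has_integral
      ((\<integral>w. exp (c * t) * (u t w)\<^sup>2 \<partial>Q t) - (\<integral>w. exp (c * 0) * (u 0 w)\<^sup>2 \<partial>Q 0))) {0..t}"
    using obs_has_integral[OF Q t0 backward_square[OF u(1), of c]] unfolding G_def .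
  then have "0 \<le> (\<integral>w. exp (c * t) * (u t w)\<^sup>2 \<partial>Q t) - (\<integral>w. exp (c * 0) * (u 0 w)\<^sup>2 \<partial>Q 0)"
  proof (rule has_integral_nonneg)
    fix s assume "s \<in> {0..t}"
    have "0 \<le> G s w" for w
    proof -
      \<comment> \<open>The full carre du champ is spent on the cross term, nothing else having to
        be absorbed; hence \<open>c\<close> is half of its value in the uniqueness proof.\<close>
      have k: "\<sigma>\<^sup>2 / \<tau> > 0" using \<sigma>_pos \<tau>_pos by simp
      have kc: "B\<^sub>v\<^sup>2 / (\<tau> * (\<sigma>\<^sup>2 / \<tau>)) = c" using \<tau>_pos by (simp add: c_def)
      have "0 \<le> c * (u s w)\<^sup>2 + 2 * u s w * ((1 / sqrt \<tau>) * (v (fst w) \<bullet> grad_y (u s) w))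
          + \<sigma>\<^sup>2 / \<tau> * (grad_y (u s) w \<bullet> grad_y (u s) w)"
        using drift_bound[OF k, of "grad_y (u s) w" "u s w" "fst w"] unfolding kc by linarith
      then show ?thesis unfolding G_def by simp
    qed
    then show "0 \<le> (\<integral>w. G s w \<partial>Q s)" by (intro Bochner_Integration.integral_nonneg) auto
  qed
  moreover have "(\<integral>w. exp (c * 0) * (u 0 w)\<^sup>2 \<partial>Q 0) = (u 0 z)\<^sup>2"
  proof -
    have "(\<lambda>w. (u 0 w)\<^sup>2) \<in> borel_measurable borel"
      using obs_measurable(1)[OF u(1)[unfolded backward_def]] by (rule borel_measurable_power)
    then show ?thesis by (simp add: init integral_return)
  qed
  ultimately show ?thesis by (simp add: u c_def)
qed

lemma ou_law_le_evol:
  fixes f :: "'n state \<Rightarrow> real"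
  assumes Q: "evol Q" and init: "Q 0 = return borel z" and t: "t > 2 * \<tau>"
    and f: "f \<in> borel_measurable borel" "\<And>w. \<bar>f w\<bar> \<le> B"
  shows "(\<integral>w. f w \<partial>ou_law t z)\<^sup>2 \<le> exp (B\<^sub>v\<^sup>2 / \<sigma>\<^sup>2 * t) * (\<integral>w. (f w)\<^sup>2 \<partial>Q t)"
  using trig_closure_borel[OF f]
proof (induction rule: trig_closure.induct)
  case (base f)
  then show ?case by (rule ou_law_le_evol_trig[OF Q init t])
next
  case (lim F B f)
  have t0: "0 \<le> t" using t \<tau>_pos by simp
  note m = trig_closure_measurable[OF lim(1)]
  show ?case
  proof (rule LIMSEQ_le)
    show "(\<lambda>k. (\<integral>w. F k w \<partial>ou_law t z)\<^sup>2) \<longlonglongrightarrow> (\<integral>w. f w \<partial>ou_law t z)\<^sup>2"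
      by (intro tendsto_power integral_bounded_lim[OF prob_space_ou_law sets_ou_law m lim(2,3)])
    show "(\<lambda>k. exp (B\<^sub>v\<^sup>2 / \<sigma>\<^sup>2 * t) * (\<integral>w. (F k w)\<^sup>2 \<partial>Q t)) \<longlonglongrightarrow> exp (B\<^sub>v\<^sup>2 / \<sigma>\<^sup>2 * t) * (\<integral>w. (f w)\<^sup>2 \<partial>Q t)"
      by (intro tendsto_mult tendsto_const
          integral_bounded_lim_square[OF evol_prob[OF Q t0] evol_sets[OF Q t0] m lim(2,3)])
  qed (use lim.IH in auto)
qed

text \<open>A minorization by Lebesgue measure on a product of unit balls, uniform over starting
  points in a bounded set. It is obtained by \<open>gauss_affine_lower\<close> in x for each fixed y
  in the ball, and then once more in y.\<close>

lemma ou_law_lower: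
  assumes t: "t > 2 * \<tau>"
  obtains c where "c > 0"
    and "\<And>z (f :: 'n state \<Rightarrow> ennreal). norm (fst z) \<le> \<rho> \<Longrightarrow> norm (snd z) \<le> \<rho> \<Longrightarrow> f \<in> borel_measurable borel \<Longrightarrow>
      ennreal c * (\<integral>\<^sup>+w. indicator (cball 0 1 \<times> cball 0 1) w * f w \<partial>lborel) \<le> (\<integral>\<^sup>+w. f w \<partial>ou_law t z)"
proof -
  define e where "e = exp (- t / \<tau>)"
  define p where "p = ou_sd_y t"
  define r where "r = ou_sd_x t"
  have pos: "p > 0" "r > 0" using ou_sd_pos[OF t] by (auto simp: p_def r_def)
  have e: "0 < e" "e < 1" using t \<tau>_pos by (auto simp: e_def)
  \<comment> \<open>\<open>R2\<close> and \<open>R1\<close> bound the normalized Gaussian variables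
    that can carry a starting point of size \<rho> into the unit balls; \<open>R1\<close> also
    covers the displacement of the mean of x and the shear caused by y.\<close>
  define R2 where "R2 = (1 + \<bar>\<rho>\<bar>) / p"
  define R1 where "R1 = (1 + \<bar>\<rho>\<bar> + sqrt \<tau> * \<bar>\<rho>\<bar> + \<bar>ou_shear t\<bar> * (1 + \<bar>\<rho>\<bar>)) / r"
  define n where "n = DIM(real ^ 'n)"
  define k1 where "k1 = std_normal_density R1 ^ n / r ^ n"
  define k2 where "k2 = std_normal_density R2 ^ n / p ^ n"
  have k: "k1 > 0" "k2 > 0" using pos unfolding k1_def k2_def
    by (auto intro!: divide_pos_pos zero_less_power normal_density_pos)
  have main: "ennreal (k1 * k2) * (\<integral>\<^sup>+w. indicator (cball 0 1 \<times> cball 0 1) w * f w \<partial>lborel) \<le> (\<integral>\<^sup>+w. f w \<partial>ou_law t z)"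
    if z: "norm (fst z) \<le> \<rho>" "norm (snd z) \<le> \<rho>" and f: "f \<in> borel_measurable borel"
    for z and f :: "'n state \<Rightarrow> ennreal"
  proof -
    have \<rho>: "0 \<le> \<rho>" using z(1) norm_ge_zero order_trans by blast
    interpret G: prob_space "gauss :: (real ^ 'n) measure" by (rule prob_space_gauss)
    let ?mx = "ou_mean_x t z" and ?my = "ou_mean_y t z"
    have my: "norm ?my \<le> \<rho>"
      using mult_mono[of e 1 "norm (snd z)" \<rho>] z e \<rho> by (simp add: ou_mean_y_def e_def)
    have mx: "norm ?mx \<le> \<rho> + sqrt \<tau> * \<rho>"
    proof -
      have "sqrt \<tau> * (1 - e) * norm (snd z) \<le> sqrt \<tau> * 1 * \<rho>"
        using e z \<tau>_pos by (intro mult_mono) auto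
      then have "norm ((sqrt \<tau> * (1 - e)) *\<^sub>R snd z) \<le> sqrt \<tau> * \<rho>" using e \<tau>_pos by (simp add: abs_mult)
      then show ?thesis unfolding ou_mean_x_def e_def[symmetric]
        using z(1) by (intro order_trans[OF norm_triangle_ineq] add_mono) auto
    qed
    define H where "H y = (\<integral>\<^sup>+h. f ((?mx + ou_shear t *\<^sub>R (y - ?my)) + r *\<^sub>R h, y) \<partial>gauss)" for y
    have Hm: "H \<in> borel_measurable borel"
    proof -
      have "continuous_on UNIV (\<lambda>q. ((?mx + ou_shear t *\<^sub>R (fst q - ?my)) + r *\<^sub>R snd q, fst q))"
        by (intro continuous_intros)
      from borel_measurable_continuous_onI[OF this]
      have "(\<lambda>q. f ((?mx + ou_shear t *\<^sub>R (fst q - ?my)) + r *\<^sub>R snd q, fst q)) \<in> borel_measurable borel"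
        by (rule measurable_compose[OF _ f])
      then have "(\<lambda>q. f ((?mx + ou_shear t *\<^sub>R (fst q - ?my)) + r *\<^sub>R snd q, fst q)) \<in> borel_measurable (borel \<Otimes>\<^sub>M gauss)"
        unfolding measurable_cong_sets[OF sets_pair_measure_cong[OF refl sets_gauss] refl] borel_prod .
      from G.borel_measurable_nn_integral_fst[OF this]
      show ?thesis by (simp add: H_def[abs_def])
    qed
    have fm: "(\<lambda>x. f (x, y)) \<in> borel_measurable borel" for y
      by (rule measurable_compose[OF _ f]) (intro borel_measurable_continuous_onI continuous_intros)
    have "ennreal (k1 * k2) * (\<integral>\<^sup>+w. indicator (cball 0 1 \<times> cball 0 1) w * f w \<partial>lborel)
        = ennreal (k1 * k2) * (\<integral>\<^sup>+y. (\<integral>\<^sup>+x. indicator (cball 0 1 \<times> cball 0 1) (x, y) * f (x, y) \<partial>lborel) \<partial>lborel)"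
    proof -
      have "(\<lambda>w. indicator (cball 0 1 \<times> cball 0 1) w * f w) \<in> borel_measurable (lborel \<Otimes>\<^sub>M lborel)"
        unfolding lborel_prod using f
        by (intro borel_measurable_times_ennreal borel_measurable_indicator) (auto intro!: borel_closed closed_Times)
      from lborel_pair.nn_integral_snd[OF this] show ?thesis by (simp add: lborel_prod)
    qed
    also have "\<dots> = ennreal k2 * (\<integral>\<^sup>+y. indicator (cball 0 1) y * (ennreal k1 * (\<integral>\<^sup>+x. indicator (cball 0 1) x * f (x, y) \<partial>lborel)) \<partial>lborel)"
    proof -
      have "(\<integral>\<^sup>+x. indicator (cball 0 1 \<times> cball 0 1) (x, y) * f (x, y) \<partial>lborel)
          = indicator (cball 0 1) y * (\<integral>\<^sup>+x. indicator (cball 0 1) x * f (x, y) \<partial>lborel)" for y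
        by (cases "y \<in> cball 0 1") (simp_all add: indicator_times)
      moreover have "(\<lambda>y. indicator (cball 0 1) y * (\<integral>\<^sup>+x. indicator (cball 0 1) x * f (x, y) \<partial>lborel)) \<in> borel_measurable lborel"
      proof -
        have "(fst :: 'n state \<Rightarrow> real ^ 'n) \<in> borel \<rightarrow>\<^sub>M borel"
          by (intro borel_measurable_continuous_onI continuous_intros)
        then have m1: "(\<lambda>w. indicator (cball 0 1) (fst w) * f w) \<in> borel_measurable borel"
          using f by (intro borel_measurable_times_ennreal measurable_compose[OF _ borel_measurable_indicator, of fst borel borel]) auto
        have "(\<lambda>q::'n state. (snd q, fst q)) \<in> borel \<rightarrow>\<^sub>M borel"
          by (intro borel_measurable_continuous_onI continuous_intros)
        from measurable_compose[OF this m1]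
        have "(\<lambda>q. indicator (cball 0 1) (snd q) * f (snd q, fst q)) \<in> borel_measurable borel"
          by (simp only: fst_conv)
        then have "(\<lambda>q. indicator (cball 0 1) (snd q) * f (snd q, fst q)) \<in> borel_measurable (lborel \<Otimes>\<^sub>M lborel)"
          by (simp add: lborel_prod)
        from lborel.borel_measurable_nn_integral_fst[OF this]
        have "(\<lambda>y. \<integral>\<^sup>+x. indicator (cball 0 1) x * f (x, y) \<partial>lborel) \<in> borel_measurable lborel" by simp
        then show ?thesis by (intro borel_measurable_times_ennreal borel_measurable_indicator) auto
      qed
      ultimately show ?thesis
        using k by (simp add: ennreal_mult mult.left_commute[of _ "ennreal k1"] nn_integral_cmult mult_ac)
    qed
    also have "\<dots> \<le> ennreal k2 * (\<integral>\<^sup>+y. indicator (cball 0 1) y * H y \<partial>lborel)"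
    proof (rule mult_left_mono[OF nn_integral_mono])
      fix y :: "real ^ 'n"
      show "indicator (cball 0 1) y * (ennreal k1 * (\<integral>\<^sup>+x. indicator (cball 0 1) x * f (x, y) \<partial>lborel)) \<le> indicator (cball 0 1) y * H y"
      proof (cases "y \<in> cball 0 1")
        case True
        have "norm (x - (?mx + ou_shear t *\<^sub>R (y - ?my))) \<le> r * R1" if "norm x \<le> 1" for x
        proof -
          have "norm (y - ?my) \<le> 1 + \<rho>" using True my norm_triangle_ineq4[of y ?my] by simp
          then have "norm (ou_shear t *\<^sub>R (y - ?my)) \<le> \<bar>ou_shear t\<bar> * (1 + \<rho>)" by (simp add: mult_left_mono)
          then have "norm (x - (?mx + ou_shear t *\<^sub>R (y - ?my))) \<le> 1 + (\<rho> + sqrt \<tau> * \<rho> + \<bar>ou_shear t\<bar> * (1 + \<rho>))"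
            using that mx by (intro order_trans[OF norm_triangle_ineq4] add_mono order_trans[OF norm_triangle_ineq])
          also have "\<dots> = r * R1" using pos \<rho> by (simp add: R1_def)
          finally show ?thesis .
        qed
        from gauss_affine_lower[OF pos(2) fm[of y] this]
        show ?thesis using True by (simp add: k1_def n_def H_def)
      qed simp
    qed simp
    also have "\<dots> \<le> (\<integral>\<^sup>+g. H (?my + p *\<^sub>R g) \<partial>gauss)"
    proof -
      have "norm (y - ?my) \<le> p * R2" if "norm y \<le> 1" for y
        using norm_triangle_ineq4[of y ?my] that my pos \<rho> by (simp add: R2_def)
      from gauss_affine_lower[OF pos(1) Hm this] show ?thesis by (simp add: k2_def n_def)
    qed
    also have "\<dots> = (\<integral>\<^sup>+g. (\<integral>\<^sup>+h. f (ou_map t z (g, h)) \<partial>gauss) \<partial>gauss)"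
      by (simp add: H_def ou_map_def Let_def p_def r_def)
    also have "\<dots> = (\<integral>\<^sup>+q. f (ou_map t z q) \<partial>(gauss \<Otimes>\<^sub>M gauss))"
      by (rule G.nn_integral_fst) (rule measurable_compose[OF ou_map_measurable f])
    also have "\<dots> = (\<integral>\<^sup>+w. f w \<partial>ou_law t z)"
      unfolding ou_law_def by (rule nn_integral_distr[OF ou_map_measurable, symmetric]) (use f in simp)
    finally show ?thesis .
  qed
  have "k1 * k2 > 0" using k by simp
  then show ?thesis using main by (rule that)
qed

end

section \<open>Lyapunov functions\<close>

text \<open>Fatou's lemma; it yields integrability of the limit together with the bound, where no
  dominating function is at hand.\<close>

lemma integral_le_of_pointwise_limit:
  fixes h :: "nat \<Rightarrow> 'a \<Rightarrow> real"
  assumes int: "\<And>m. integrable M (h m)" and nonneg: "\<And>m w. 0 \<le> h m w"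
    and le: "\<And>m. (\<integral>w. h m w \<partial>M) \<le> b m" and b: "b \<longlonglongrightarrow> B" and lim: "\<And>w. (\<lambda>m. h m w) \<longlonglongrightarrow> f w"
  shows "integrable M f" "(\<integral>w. f w \<partial>M) \<le> B"
proof -
  have meas: "f \<in> borel_measurable M" using int lim by (intro borel_measurable_LIMSEQ_real[of M h f]) auto
  have f0: "0 \<le> f w" for w using nonneg by (intro LIMSEQ_le_const[OF lim]) auto
  have "0 \<le> b m" for m using le[of m] Bochner_Integration.integral_nonneg[of M "h m"] nonneg by (meson order_trans)
  then have B0: "0 \<le> B" by (intro LIMSEQ_le_const[OF b]) auto
  have "(\<integral>\<^sup>+w. ennreal (f w) \<partial>M) = (\<integral>\<^sup>+w. liminf (\<lambda>m. ennreal (h m w)) \<partial>M)"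
  proof (rule nn_integral_cong)
    fix w
    have "(\<lambda>m. ennreal (h m w)) \<longlonglongrightarrow> ennreal (f w)" by (intro tendsto_ennrealI lim)
    then show "ennreal (f w) = liminf (\<lambda>m. ennreal (h m w))" by (metis lim_imp_Liminf sequentially_bot)
  qed
  also have "\<dots> \<le> liminf (\<lambda>m. \<integral>\<^sup>+w. ennreal (h m w) \<partial>M)"
    by (rule nn_integral_liminf) (use int in auto)
  also have "\<dots> \<le> liminf (\<lambda>m. ennreal (b m))"
  proof (intro Liminf_mono always_eventually allI)
    fix m
    have "(\<integral>\<^sup>+w. ennreal (h m w) \<partial>M) = ennreal (\<integral>w. h m w \<partial>M)"
      by (rule nn_integral_eq_integral[OF int]) (use nonneg in auto)
    then show "(\<integral>\<^sup>+w. ennreal (h m w) \<partial>M) \<le> ennreal (b m)" using le[of m] by (simp add: ennreal_leI)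
  qed
  also have "\<dots> = ennreal B"
    using tendsto_ennrealI[OF b] by (metis lim_imp_Liminf sequentially_bot)
  finally have fin: "(\<integral>\<^sup>+w. ennreal (f w) \<partial>M) \<le> ennreal B" .
  show i: "integrable M f"
    by (rule integrableI_bounded[OF meas]) (use fin f0 in \<open>auto simp: less_top[symmetric] top_unique\<close>)
  then have "ennreal (\<integral>w. f w \<partial>M) \<le> ennreal B" using fin f0 by (simp add: nn_integral_eq_integral)
  then show "(\<integral>w. f w \<partial>M) \<le> B" using B0 by (simp add: ennreal_le_iff)
qed

context kinetic begin

text \<open>The normalization makes squaring double \<open>k\<close>. The weight of the final
  estimate is k = 1 / (2 \<sigma>^2), its square is k = 1 / \<sigma>^2, and both lie below the
  critical value 2 / \<sigma>^2 of \<open>lyap_drift\<close>.\<close>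

definition lyap :: "real \<Rightarrow> 'n state \<Rightarrow> real" where
  "lyap k w = exp (k / 2 * (snd w \<bullet> snd w))"

text \<open>\<open>L (lyap k) = lyap k * lyap_rate k\<close>, but \<open>lyap k\<close> is unbounded, so \<open>L\<close> is only applied to the bounded function
  \<open>1 / (N + lyap k)\<close>.\<close>

definition lyap_rate :: "real \<Rightarrow> 'n state \<Rightarrow> real" where
  "lyap_rate k w = k * (snd w \<bullet> v (fst w) / sqrt \<tau> - (snd w \<bullet> snd w) / \<tau>)
     + \<sigma>\<^sup>2 / (2 * \<tau>) * (k * DIM(real ^ 'n) + k\<^sup>2 * (snd w \<bullet> snd w))"

lemma lyap_pos: "0 < lyap k w"
  by (simp add: lyap_def)

lemma lyap_smooth: "smooth_fun (lyap k)"
proof -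
  have "smooth_fun (\<lambda>w::'n state. exp (k / 2 * (\<Sum>i\<in>Basis. (snd w \<bullet> i) * (snd w \<bullet> i))))"
    by (intro smooth_fun_comp[OF smooth_fun_exp] smooth_fun_mult smooth_fun_const smooth_fun_sum
        smooth_fun_bounded_linear bounded_linear_compose[OF bounded_linear_inner_left bounded_linear_snd])
  then show ?thesis by (simp add: lyap_def[abs_def] euclidean_inner[symmetric])
qed

lemma lyap_measurable: "lyap k \<in> borel_measurable borel"
  by (intro borel_measurable_continuous_onI smooth_fun_continuous lyap_smooth)

text \<open>The chain rule for the reciprocal: the first term comes from its first derivative
  applied to the generator of \<open>lyap k\<close>, the second from its second derivative 2 / (N +
  V)^3 and the squared gradient of \<open>lyap k\<close>.\<close>

lemma lyap_recip:
  assumes N: "N > 0"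
  shows "smooth_fun (\<lambda>w. inverse (N + lyap k w))" (is ?S)
    and "grad_y (\<lambda>w. inverse (N + lyap k w)) w = (- k * lyap k w / (N + lyap k w)\<^sup>2) *\<^sub>R snd w" (is ?G)
    and "L (\<lambda>w. inverse (N + lyap k w)) w = - lyap k w * lyap_rate k w / (N + lyap k w)\<^sup>2
      + \<sigma>\<^sup>2 / \<tau> * k\<^sup>2 * (snd w \<bullet> snd w) * (lyap k w)\<^sup>2 / (N + lyap k w) ^ 3" (is ?L)
proof -
  let ?V = "lyap k"
  have ne: "N + ?V w \<noteq> 0" for w using N lyap_pos[of k w] by linarith
  show ?S by (intro smooth_fun_inverse smooth_fun_add smooth_fun_const lyap_smooth ne)
  have dV: "(?V has_derivative (\<lambda>h. ?V w * (k * (snd w \<bullet> snd h)))) (at w)" for w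
    unfolding lyap_def by (auto intro!: derivative_eq_intros simp: inner_commute fun_eq_iff)
  let ?P = "\<lambda>w. (0 :: real ^ 'n, (- k * ?V w / (N + ?V w)\<^sup>2) *\<^sub>R snd w)"
  have P: "((\<lambda>w. inverse (N + ?V w)) has_derivative (\<lambda>h. ?P w \<bullet> h)) (at w)" for w
  proof -
    have "((\<lambda>w. inverse (N + ?V w)) has_derivative
        (\<lambda>h. - (inverse (N + ?V w) * (0 + ?V w * (k * (snd w \<bullet> snd h))) * inverse (N + ?V w)))) (at w)"
      by (rule Deriv.has_derivative_inverse[OF ne has_derivative_add[OF has_derivative_const dV]])
    then show ?thesis
      by (rule has_derivative_eq_rhs) (simp add: fun_eq_iff inner_prod_def power2_eq_square divide_inverse mult_ac)
  qed
  define q where "q = (\<lambda>w. - k * ?V w / (N + ?V w)\<^sup>2)"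
  define q' where "q' = - k * (k * ?V w) / (N + ?V w)\<^sup>2 + 2 * k * ?V w * (k * ?V w) / (N + ?V w) ^ 3"
  have dq: "(q has_derivative (\<lambda>h. q' * (snd w \<bullet> snd h))) (at w)"
  proof -
    have "((\<lambda>w. - k * ?V w * (inverse (N + ?V w) * inverse (N + ?V w))) has_derivative
      (\<lambda>h. (- k * ?V w) * (inverse (N + ?V w) * (?P w \<bullet> h) + (?P w \<bullet> h) * inverse (N + ?V w))
        + (- k * (?V w * (k * (snd w \<bullet> snd h)))) * (inverse (N + ?V w) * inverse (N + ?V w)))) (at w)"
      by (intro has_derivative_mult has_derivative_mult_right P dV)
    moreover have "(\<lambda>w. - k * ?V w * (inverse (N + ?V w) * inverse (N + ?V w))) = q"
      by (simp add: q_def fun_eq_iff power2_eq_square divide_inverse)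
    moreover have "(- k * ?V w) * (inverse (N + ?V w) * (?P w \<bullet> h) + (?P w \<bullet> h) * inverse (N + ?V w))
        + (- k * (?V w * (k * (snd w \<bullet> snd h)))) * (inverse (N + ?V w) * inverse (N + ?V w)) = q' * (snd w \<bullet> snd h)" for h
    proof -
      define u x where "u = inverse (N + ?V w)" and "x = snd w \<bullet> snd h"
      have "?P w \<bullet> h = - k * ?V w * (u * u) * x"
        by (simp add: inner_prod_def u_def x_def power2_eq_square divide_inverse)
      moreover have "q' = - k * (k * ?V w) * (u * u) + 2 * k * ?V w * (k * ?V w) * (u * u * u)"
        unfolding q'_def divide_inverse power2_eq_square power3_eq_cube inverse_mult_distrib u_def ..
      ultimately show ?thesis
        unfolding u_def[symmetric] x_def[symmetric] by (simp only:) (simp add: algebra_simps)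
    qed
    ultimately show ?thesis by simp
  qed
  let ?D = "\<lambda>i h. q w * (snd h \<bullet> i) + (q' * (snd w \<bullet> snd h)) * (snd w \<bullet> i)"
  have D: "((\<lambda>w. snd (?P w) \<bullet> i) has_derivative ?D i) (at w)" for i
  proof -
    have "((\<lambda>w. q w * (snd w \<bullet> i)) has_derivative ?D i) (at w)"
      by (intro has_derivative_mult dq has_derivative_inner_left has_derivative_snd has_derivative_ident)
    then show ?thesis by (simp only: snd_conv inner_scaleR_left q_def)
  qed
  show ?G using grad_y_eqI[OF P D] by simp
  have "(\<Sum>i\<in>Basis. ?D i (0, i)) = (\<Sum>i\<in>(Basis :: (real ^ 'n) set). q w + q' * ((snd w \<bullet> i) * (snd w \<bullet> i)))"
    by (intro sum.cong refl) simp
  also have "\<dots> = DIM(real ^ 'n) * q w + q' * (snd w \<bullet> snd w)"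
    unfolding sum.distrib sum_distrib_left[symmetric] euclidean_inner[of "snd w" "snd w", symmetric] by simp
  finally have S: "(\<Sum>i\<in>Basis. ?D i (0, i)) = DIM(real ^ 'n) * q w + q' * (snd w \<bullet> snd w)" .
  define A where "A = ?V w / (N + ?V w)\<^sup>2"
  define E where "E = (?V w)\<^sup>2 / (N + ?V w) ^ 3"
  have qA: "q w = - k * A" "q' = - k\<^sup>2 * A + 2 * k\<^sup>2 * E"
    by (simp_all add: q_def q'_def A_def E_def power2_eq_square mult_ac)
  have "L (\<lambda>w. inverse (N + lyap k w)) w = (1 / sqrt \<tau>) * (q w * (snd w \<bullet> v (fst w)))
      + (1 / \<tau>) * (- (q w * (snd w \<bullet> snd w)) + \<sigma>\<^sup>2 / 2 * (DIM(real ^ 'n) * q w + q' * (snd w \<bullet> snd w)))"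
    unfolding gen_eqI[OF P D] S by (simp add: q_def)
  also have "\<dots> = - A * lyap_rate k w + \<sigma>\<^sup>2 / \<tau> * k\<^sup>2 * (snd w \<bullet> snd w) * E"
    unfolding lyap_rate_def qA by (simp add: algebra_simps add_divide_distrib diff_divide_distrib power2_eq_square)
  finally show ?L by (simp add: A_def E_def)
qed

lemma lyap_dominates:
  assumes "k > 0"
  shows "1 + snd w \<bullet> snd w \<le> (1 + 2 / k) * lyap k w"
proof -
  let ?q = "snd w \<bullet> snd w"
  have "1 + k / 2 * ?q \<le> lyap k w" unfolding lyap_def by (rule exp_ge_add_one_self)
  moreover have "0 \<le> k / 2 * ?q" using assms by simp
  ultimately have 1: "1 \<le> lyap k w" and 2: "k / 2 * ?q \<le> lyap k w" by linarith+
  from 2 have "?q \<le> 2 / k * lyap k w" using assms by (simp add: field_simps)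
  with 1 show ?thesis by (simp add: distrib_right)
qed

lemma lyap_rate_abs_le:
  assumes k: "k > 0"
  obtains c where "c \<ge> 0" "\<And>w. \<bar>lyap_rate k w\<bar> \<le> c * (1 + snd w \<bullet> snd w)"
proof -
  define c where "c = k * (B\<^sub>v / sqrt \<tau> + 1 / \<tau>) + \<sigma>\<^sup>2 / (2 * \<tau>) * (k * DIM(real ^ 'n) + k\<^sup>2)"
  have B: "0 \<le> B\<^sub>v" using B\<^sub>v_ge_1 by simp
  have "\<bar>lyap_rate k w\<bar> \<le> c * (1 + snd w \<bullet> snd w)" for w
  proof -
    define s where "s = snd w \<bullet> snd w"
    have s: "0 \<le> s" "0 \<le> 1 + s" by (simp_all add: s_def)
    have "norm (snd w) \<le> 1 + s"
    proof -
      have "2 * norm (snd w) \<le> s + 1"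
        using sum_squares_bound[of "norm (snd w)" 1] by (simp add: s_def dot_square_norm)
      then show ?thesis using s(1) by linarith
    qed
    then have "\<bar>snd w \<bullet> v (fst w)\<bar> \<le> (1 + s) * B\<^sub>v"
      using s by (intro order_trans[OF Cauchy_Schwarz_ineq2] mult_mono v_bound) auto
    then have 1: "\<bar>snd w \<bullet> v (fst w) / sqrt \<tau>\<bar> \<le> (1 + s) * B\<^sub>v / sqrt \<tau>"
      using \<tau>_pos by (simp add: abs_divide divide_right_mono)
    have 2: "\<bar>s / \<tau>\<bar> \<le> (1 + s) / \<tau>" using s \<tau>_pos by (simp add: divide_right_mono)
    have 3: "\<bar>k * DIM(real ^ 'n) + k\<^sup>2 * s\<bar> \<le> (k * DIM(real ^ 'n) + k\<^sup>2) * (1 + s)"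
      using s k by (simp add: algebra_simps)
    have "\<bar>lyap_rate k w\<bar> \<le> \<bar>k * (snd w \<bullet> v (fst w) / sqrt \<tau> - s / \<tau>)\<bar> + \<bar>\<sigma>\<^sup>2 / (2 * \<tau>) * (k * DIM(real ^ 'n) + k\<^sup>2 * s)\<bar>"
      unfolding lyap_rate_def s_def[symmetric] by (rule abs_triangle_ineq)
    also have "\<dots> \<le> k * ((1 + s) * B\<^sub>v / sqrt \<tau> + (1 + s) / \<tau>) + \<sigma>\<^sup>2 / (2 * \<tau>) * ((k * DIM(real ^ 'n) + k\<^sup>2) * (1 + s))"
    proof (rule add_mono)
      have "\<bar>snd w \<bullet> v (fst w) / sqrt \<tau> - s / \<tau>\<bar> \<le> (1 + s) * B\<^sub>v / sqrt \<tau> + (1 + s) / \<tau>" using 1 2 by linarith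
      then show "\<bar>k * (snd w \<bullet> v (fst w) / sqrt \<tau> - s / \<tau>)\<bar> \<le> k * ((1 + s) * B\<^sub>v / sqrt \<tau> + (1 + s) / \<tau>)"
        unfolding abs_mult using k by (simp add: mult_left_mono)
      have "\<sigma>\<^sup>2 / (2 * \<tau>) \<ge> 0" using \<tau>_pos by simp
      with 3 show "\<bar>\<sigma>\<^sup>2 / (2 * \<tau>) * (k * DIM(real ^ 'n) + k\<^sup>2 * s)\<bar> \<le> \<sigma>\<^sup>2 / (2 * \<tau>) * ((k * DIM(real ^ 'n) + k\<^sup>2) * (1 + s))"
        unfolding abs_mult by (intro mult_mono) auto
    qed
    also have "\<dots> = c * (1 + s)" by (simp add: c_def algebra_simps add_divide_distrib)
    finally show ?thesis by (simp add: s_def)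
  qed
  moreover have "c \<ge> 0" using k B \<tau>_pos by (auto simp: c_def)
  ultimately show ?thesis using that by blast
qed

lemma obs_static:
  assumes "smooth_fun f" "\<And>w. \<bar>f w\<bar> \<le> C" "\<And>w. norm (grad_y f w) \<le> C" "\<And>w. \<bar>L f w\<bar> \<le> C"
  shows "obs T (\<lambda>s. f) (\<lambda>s. L f)"
proof (rule obsI[where F' = "\<lambda>_ _. 0" and C = C])
  show "continuous_on UNIV (\<lambda>p :: real \<times> 'n state. f (snd p))"
    by (rule continuous_on_compose2[OF smooth_fun_continuous[OF assms(1), of UNIV] continuous_on_snd[OF continuous_on_id]]) auto
  show "0 \<le> C" using order_trans[OF abs_ge_zero assms(2)] .
qed (use assms in auto)

text \<open>After taking the reciprocal every term carries a factor at most 1 / V with V =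
  \<open>lyap k\<close>, while the remaining factors grow only quadratically in y;
  \<open>lyap_dominates\<close> then bounds everything.\<close>

lemma obs_lyap_recip:
  assumes N: "N > 0" and k: "k > 0"
  shows "obs T (\<lambda>s w. inverse (N + lyap k w)) (\<lambda>s. L (\<lambda>w. inverse (N + lyap k w)))"
proof -
  obtain c where c: "c \<ge> 0" "\<And>w. \<bar>lyap_rate k w\<bar> \<le> c * (1 + snd w \<bullet> snd w)" by (rule lyap_rate_abs_le[OF k]) blast
  define m where "m = 1 + 2 / k"
  have m: "m \<ge> 0" using k by (simp add: m_def)
  have e: "\<sigma>\<^sup>2 / \<tau> * k\<^sup>2 \<ge> 0" using \<tau>_pos by simp
  define C where "C = 1 / N + k * m + (c * m + \<sigma>\<^sup>2 / \<tau> * k\<^sup>2 * m)"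
  have bd: "\<bar>inverse (N + lyap k w)\<bar> \<le> 1 / N"
    "norm (grad_y (\<lambda>w. inverse (N + lyap k w)) w) \<le> k * m"
    "\<bar>L (\<lambda>w. inverse (N + lyap k w)) w\<bar> \<le> c * m + \<sigma>\<^sup>2 / \<tau> * k\<^sup>2 * m" for w
  proof -
    define V where "V = lyap k w"
    define s where "s = snd w \<bullet> snd w"
    have V: "V > 0" by (simp add: V_def lyap_pos)
    have s: "0 \<le> s" "1 + s \<le> m * V" using lyap_dominates[OF k, of w] by (simp_all add: s_def V_def m_def)
    show "\<bar>inverse (N + lyap k w)\<bar> \<le> 1 / N" using N V by (simp add: V_def[symmetric] divide_simps)
    have VV: "V / (N + V)\<^sup>2 \<le> 1 / V"
    proof -
      have "V * V \<le> (N + V)\<^sup>2" unfolding power2_eq_square using N V by (intro mult_mono) auto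
      then show ?thesis using N V by (simp add: divide_simps)
    qed
    have VVV: "V\<^sup>2 / (N + V) ^ 3 \<le> 1 / V"
    proof -
      have "V\<^sup>2 * V \<le> (N + V) ^ 3" using power_mono[of V "N + V" 3] N V by (simp add: power3_eq_cube power2_eq_square)
      then show ?thesis using N V by (simp add: divide_simps)
    qed
    have ms: "(1 + s) * (1 / V) \<le> m" using s(2) V by (simp add: divide_le_eq)
    have nys: "norm (snd w) \<le> 1 + s"
    proof -
      have "2 * norm (snd w) \<le> s + 1"
        using sum_squares_bound[of "norm (snd w)" 1] by (simp add: s_def dot_square_norm)
      then show ?thesis using s(1) by linarith
    qed
    have "norm (grad_y (\<lambda>w. inverse (N + lyap k w)) w) = k * (norm (snd w) * (V / (N + V)\<^sup>2))"
      unfolding lyap_recip(2)[OF N] V_def[symmetric] using k V by (simp add: abs_mult abs_divide)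
    also have "\<dots> \<le> k * ((1 + s) * (1 / V))"
      using k nys VV s V by (intro mult_left_mono mult_mono) auto
    also have "\<dots> \<le> k * m" using ms k by (intro mult_left_mono) auto
    finally show "norm (grad_y (\<lambda>w. inverse (N + lyap k w)) w) \<le> k * m" .
    have 1: "\<bar>- V * lyap_rate k w / (N + V)\<^sup>2\<bar> \<le> c * m"
    proof -
      have "\<bar>- V * lyap_rate k w / (N + V)\<^sup>2\<bar> = \<bar>lyap_rate k w\<bar> * (V / (N + V)\<^sup>2)"
        using V by (simp add: abs_mult abs_divide)
      also have "\<dots> \<le> (c * (1 + s)) * (1 / V)"
        using c VV V s by (intro mult_mono) (auto simp: s_def)
      also have "\<dots> \<le> c * m" using mult_left_mono[OF ms c(1)] by simp
      finally show ?thesis .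
    qed
    have 2: "\<bar>\<sigma>\<^sup>2 / \<tau> * k\<^sup>2 * s * V\<^sup>2 / (N + V) ^ 3\<bar> \<le> \<sigma>\<^sup>2 / \<tau> * k\<^sup>2 * m"
    proof -
      have "\<bar>\<sigma>\<^sup>2 / \<tau> * k\<^sup>2 * s * V\<^sup>2 / (N + V) ^ 3\<bar> = (\<sigma>\<^sup>2 / \<tau> * k\<^sup>2) * (s * (V\<^sup>2 / (N + V) ^ 3))"
        using \<tau>_pos s N V by (simp add: abs_mult abs_divide)
      also have "\<dots> \<le> (\<sigma>\<^sup>2 / \<tau> * k\<^sup>2) * ((1 + s) * (1 / V))"
        using e VVV s N V by (intro mult_left_mono mult_mono) auto
      also have "\<dots> \<le> (\<sigma>\<^sup>2 / \<tau> * k\<^sup>2) * m" using ms e by (intro mult_left_mono)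
      finally show ?thesis .
    qed
    show "\<bar>L (\<lambda>w. inverse (N + lyap k w)) w\<bar> \<le> c * m + \<sigma>\<^sup>2 / \<tau> * k\<^sup>2 * m"
      unfolding lyap_recip(3)[OF N] V_def[symmetric] s_def[symmetric]
      by (rule order_trans[OF abs_triangle_ineq add_mono[OF 1 2]])
  qed
  have "0 \<le> 1 / N" "0 \<le> k * m" "0 \<le> c * m" using N k m c(1) by auto
  moreover note mult_nonneg_nonneg[OF e m]
  ultimately have "1 / N \<le> C" "k * m \<le> C" "c * m + \<sigma>\<^sup>2 / \<tau> * k\<^sup>2 * m \<le> C" unfolding C_def by linarith+
  then show ?thesis
    using bd by (intro obs_static[where C = C] lyap_recip(1)[OF N]) (blast intro: order_trans)+
qed

text \<open>For \<open>k\<close> below 2 / \<sigma>^2 friction beats the noise and leaves - \<delta>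
  |y|^2 in the rate. Half of it absorbs the linear contribution of \<open>v\<close>, and the other
  half makes the rate smaller than -1 for large y.\<close>

lemma lyap_drift:
  assumes k: "0 < k" "k < 2 / \<sigma>\<^sup>2"
  obtains C where "C \<ge> 0" "\<And>w. lyap k w * lyap_rate k w \<le> C - lyap k w"
proof -
  define \<delta> where "\<delta> = k / \<tau> * (1 - \<sigma>\<^sup>2 * k / 2)"
  have "\<sigma>\<^sup>2 * k < 2" using k \<sigma>_pos by (simp add: field_simps)
  then have d: "\<delta> > 0" using k \<tau>_pos by (simp add: \<delta>_def)
  define b where "b = k * B\<^sub>v / sqrt \<tau>"
  define A where "A = 1 + \<sigma>\<^sup>2 / (2 * \<tau>) * (k * DIM(real ^ 'n)) + b\<^sup>2 / (2 * \<delta>)"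
  have A: "A \<ge> 0" using k d \<tau>_pos by (auto simp: A_def)
  \<comment> \<open>A bound for the rate plus 1, times the largest value of the weight on the ball
    |y|^2 at most 2 A / \<delta>, outside of which the rate plus 1 is nonpositive.\<close>
  define C where "C = A * exp (k / 2 * (2 * A / \<delta>))"
  have "lyap k w * lyap_rate k w \<le> C - lyap k w" for w
  proof -
    define q where "q = norm (snd w)"
    have qq: "snd w \<bullet> snd w = q\<^sup>2" by (simp add: q_def dot_square_norm)
    have "snd w \<bullet> v (fst w) \<le> q * B\<^sub>v"
      unfolding q_def by (rule order_trans[OF norm_cauchy_schwarz]) (intro mult_left_mono v_bound norm_ge_zero)
    then have "k * (snd w \<bullet> v (fst w) / sqrt \<tau>) \<le> k * (q * B\<^sub>v / sqrt \<tau>)"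
      using k \<tau>_pos by (intro mult_left_mono divide_right_mono) auto
    also have "\<dots> = b * q" by (simp add: b_def)
    also have "b * q \<le> b\<^sup>2 / (2 * \<delta>) + \<delta> / 2 * q\<^sup>2"
    proof -
      have "0 \<le> (b - \<delta> * q)\<^sup>2 / (2 * \<delta>)" using d by simp
      also have "\<dots> = b\<^sup>2 / (2 * \<delta>) - b * q + \<delta> / 2 * q\<^sup>2"
        using d by (simp add: power2_diff power_mult_distrib field_simps power2_eq_square)
      finally show ?thesis by simp
    qed
    finally have 1: "k * (snd w \<bullet> v (fst w) / sqrt \<tau>) \<le> b\<^sup>2 / (2 * \<delta>) + \<delta> / 2 * q\<^sup>2" .
    have "lyap_rate k w = k * (snd w \<bullet> v (fst w) / sqrt \<tau>) - \<delta> * q\<^sup>2 + \<sigma>\<^sup>2 / (2 * \<tau>) * (k * DIM(real ^ 'n))"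
      unfolding lyap_rate_def qq \<delta>_def by (simp add: algebra_simps power2_eq_square add_divide_distrib diff_divide_distrib)
    then have rate: "lyap_rate k w + 1 \<le> A - \<delta> / 2 * q\<^sup>2" using 1 unfolding A_def by linarith
    have "lyap k w * (lyap_rate k w + 1) \<le> C"
    proof (cases "A - \<delta> / 2 * q\<^sup>2 \<le> 0")
      case True
      then have "lyap k w * (lyap_rate k w + 1) \<le> 0"
        using rate lyap_pos[of k w] by (intro mult_nonneg_nonpos) auto
      then show ?thesis using A by (simp add: C_def order_trans)
    next
      case False
      then have "q\<^sup>2 \<le> 2 * A / \<delta>" using d by (simp add: field_simps)
      then have "k / 2 * q\<^sup>2 \<le> k / 2 * (2 * A / \<delta>)" using k by (intro mult_left_mono) auto
      then have V: "lyap k w \<le> exp (k / 2 * (2 * A / \<delta>))" unfolding lyap_def qq by simp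
      have "lyap_rate k w + 1 \<le> A" using rate d by (smt (verit) divide_nonneg_nonneg mult_nonneg_nonneg zero_le_power2)
      then have "lyap k w * (lyap_rate k w + 1) \<le> lyap k w * A" using lyap_pos[of k w] by (intro mult_left_mono) auto
      also have "\<dots> \<le> exp (k / 2 * (2 * A / \<delta>)) * A" using V A by (intro mult_right_mono) auto
      finally show ?thesis by (simp add: C_def mult.commute)
    qed
    then show ?thesis by (simp add: algebra_simps)
  qed
  moreover have "C \<ge> 0" using A by (simp add: C_def)
  ultimately show ?thesis using that by blast
qed

text \<open>With V = \<open>lyap k\<close> this is N V / (N + V), a bounded concave function of V
  that increases to V as N grows. It is written through the reciprocal, for which the generator is
  already known.\<close>

definition trunc :: "real \<Rightarrow> real \<Rightarrow> 'n state \<Rightarrow> real" where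
  "trunc k N w = N - N\<^sup>2 * inverse (N + lyap k w)"

lemma trunc_eq: "N > 0 \<Longrightarrow> trunc k N w = N * lyap k w / (N + lyap k w)"
  using lyap_pos[of k w] by (simp add: trunc_def field_simps power2_eq_square)

lemma trunc_bounds:
  assumes "N > 0"
  shows "0 \<le> trunc k N w" "trunc k N w \<le> N" "trunc k N w \<le> lyap k w"
  using assms lyap_pos[of k w] by (simp_all add: trunc_eq divide_le_eq)

lemma trunc_tendsto: "(\<lambda>m. trunc k (real (Suc m)) w) \<longlonglongrightarrow> lyap k w"
proof -
  have "(\<lambda>m. lyap k w / (1 + lyap k w * inverse (real (Suc m)))) \<longlonglongrightarrow> lyap k w / (1 + lyap k w * 0)"
    by (intro tendsto_intros LIMSEQ_inverse_real_of_nat) auto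
  moreover have "trunc k (real (Suc m)) w = lyap k w / (1 + lyap k w * inverse (real (Suc m)))" for m
    using lyap_pos[of k w] by (subst trunc_eq) (simp_all add: field_simps del: of_nat_Suc)
  ultimately show ?thesis by simp
qed

lemma obs_trunc:
  assumes N: "N > 0" and k: "k > 0"
  shows "obs T (\<lambda>s w. exp (c * s) * trunc k N w)
    (\<lambda>s w. exp (c * s) * (c * trunc k N w - N\<^sup>2 * L (\<lambda>w. inverse (N + lyap k w)) w))"
proof -
  let ?f = "\<lambda>w. inverse (N + lyap k w)"
  have e: "obs T (\<lambda>s w. exp (c * s)) (\<lambda>s w. c * exp (c * s))"
    by (rule obs_time) (auto intro!: derivative_eq_intros continuous_intros)
  have N': "obs T (\<lambda>s w. N) (\<lambda>s w. 0)" by (rule obs_time) auto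
  have "obs T (\<lambda>s w. N + (- N\<^sup>2) * ?f w) (\<lambda>s w. 0 + (- N\<^sup>2) * L ?f w)"
    by (rule obs_add[OF N' obs_cmult[OF obs_lyap_recip[OF N k]]])
  from obs_mult[OF e this] show ?thesis
    by (simp add: grad_y_const trunc_def algebra_simps)
qed

text \<open>By concavity of the truncation the second-order term has a favourable sign and is
  dropped; the first-order factor N^2 / (N + V)^2 is at most 1 where it multiplies
  \<open>C\<close>.\<close>

lemma gen_trunc_le:
  assumes N: "N > 0" and drift: "lyap k w * lyap_rate k w \<le> C - lyap k w" and C: "C \<ge> 0"
  shows "- N\<^sup>2 * L (\<lambda>w. inverse (N + lyap k w)) w \<le> C - N\<^sup>2 * lyap k w / (N + lyap k w)\<^sup>2"
proof -
  define V where "V = lyap k w"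
  have V: "V > 0" by (simp add: V_def lyap_pos)
  have e: "0 \<le> \<sigma>\<^sup>2 / \<tau> * k\<^sup>2 * (snd w \<bullet> snd w) * V\<^sup>2 / (N + V) ^ 3" using \<tau>_pos N V by simp
  have "- N\<^sup>2 * L (\<lambda>w. inverse (N + lyap k w)) w
      = N\<^sup>2 / (N + V)\<^sup>2 * (V * lyap_rate k w) - N\<^sup>2 * (\<sigma>\<^sup>2 / \<tau> * k\<^sup>2 * (snd w \<bullet> snd w) * V\<^sup>2 / (N + V) ^ 3)"
    unfolding lyap_recip(3)[OF N] V_def[symmetric] by (simp add: algebra_simps)
  also have "\<dots> \<le> N\<^sup>2 / (N + V)\<^sup>2 * (C - V)"
  proof -
    have "N\<^sup>2 / (N + V)\<^sup>2 * (V * lyap_rate k w) \<le> N\<^sup>2 / (N + V)\<^sup>2 * (C - V)"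
      using drift by (intro mult_left_mono) (auto simp: V_def)
    moreover have "0 \<le> N\<^sup>2 * (\<sigma>\<^sup>2 / \<tau> * k\<^sup>2 * (snd w \<bullet> snd w) * V\<^sup>2 / (N + V) ^ 3)" by (rule mult_nonneg_nonneg[OF zero_le_power2 e])
    ultimately show ?thesis by linarith
  qed
  also have "\<dots> = N\<^sup>2 / (N + V)\<^sup>2 * C - N\<^sup>2 * V / (N + V)\<^sup>2" by (simp add: right_diff_distrib)
  also have "\<dots> \<le> 1 * C - N\<^sup>2 * V / (N + V)\<^sup>2"
  proof -
    have "N\<^sup>2 \<le> (N + V)\<^sup>2" using N V by (intro power_mono) auto
    then have "N\<^sup>2 / (N + V)\<^sup>2 \<le> 1" using N V by simp
    from mult_right_mono[OF this C] show ?thesis by linarith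
  qed
  finally show ?thesis by (simp add: V_def)
qed

end

context kinetic_diffusion begin

section \<open>Exponential moments along the diffusion\<close>

lemma trunc_integrable:
  assumes "N > 0" "0 \<le> t"
  shows "integrable (K t z) (trunc k N)"
proof (rule K_integrable[OF assms(2)])
  have "continuous_on UNIV (trunc k N)"
    unfolding trunc_def[abs_def] using lyap_recip(1)[OF assms(1)]
    by (intro continuous_intros smooth_fun_continuous)
  then show "trunc k N \<in> borel_measurable borel" by (rule borel_measurable_continuous_onI)
  show "\<bar>trunc k N w\<bar> \<le> N" for w using trunc_bounds[OF assms(1), of k w] by simp
qed

text \<open>Linear growth is crude but serves for one purpose: with k = 1 / \<sigma>^2 it keeps the
  second moment of the actual Lyapunov function finite on bounded time intervals.\<close>

lemma lyap_growth:
  assumes k: "0 < k" "k < 2 / \<sigma>\<^sup>2"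
  obtains C where "C \<ge> 0" "\<And>t z. 0 \<le> t \<Longrightarrow> integrable (K t z) (lyap k)"
    "\<And>t z. 0 \<le> t \<Longrightarrow> (\<integral>w. lyap k w \<partial>K t z) \<le> lyap k z + C * t"
proof -
  obtain C where C: "C \<ge> 0" "\<And>w. lyap k w * lyap_rate k w \<le> C - lyap k w" by (rule lyap_drift[OF k]) blast
  have *: "integrable (K t z) (lyap k) \<and> (\<integral>w. lyap k w \<partial>K t z) \<le> lyap k z + C * t" if t: "0 \<le> t" for t z
  proof -
    have le: "(\<integral>w. trunc k N w \<partial>K t z) \<le> lyap k z + C * t" if N: "N > 0" for N
    proof -
      define G where "G w = - N\<^sup>2 * L (\<lambda>w. inverse (N + lyap k w)) w" for w
      have "((\<lambda>s. \<integral>w. G w \<partial>K s z) has_integral ((\<integral>w. trunc k N w \<partial>K t z) - (\<integral>w. trunc k N w \<partial>K 0 z))) {0..t}"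
        using obs_has_integral[OF K_evol t obs_trunc[OF N k(1), of t 0], of z] by (simp add: G_def)
      moreover have "((\<lambda>s. C) has_integral C * t) {0..t}"
        using has_integral_const_real[of C 0 t] t by (simp add: mult.commute)
      ultimately have "(\<integral>w. trunc k N w \<partial>K t z) - (\<integral>w. trunc k N w \<partial>K 0 z) \<le> C * t"
      proof (rule has_integral_le)
        fix s assume s: "s \<in> {0..t}"
        interpret prob_space "K s z" by (rule K_prob) (use s in auto)
        have "G w \<le> C" for w
        proof -
          have "0 \<le> N\<^sup>2 * lyap k w / (N + lyap k w)\<^sup>2" using lyap_pos[of k w] N by simp
          with gen_trunc_le[OF N C(2) C(1), of w] show ?thesis unfolding G_def by linarith
        qed
        then have "(\<integral>w. G w \<partial>K s z) \<le> (\<integral>w. C \<partial>K s z)"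
        \<comment> \<open>A one-sided bound on \<open>G\<close> does not give integrability; if it
          fails, the integral is 0 and \<open>C\<close> is nonnegative.\<close>
        proof (cases "integrable (K s z) G")
          case True
          then show ?thesis by (rule integral_mono) (simp_all add: \<open>\<And>w. G w \<le> C\<close>)
        next
          case False
          then show ?thesis using C(1) by (simp add: not_integrable_integral_eq)
        qed
        then show "(\<integral>w. G w \<partial>K s z) \<le> C" by (simp add: prob_space)
      qed
      moreover have "(\<integral>w. trunc k N w \<partial>K 0 z) \<le> lyap k z"
      proof -
        have "trunc k N \<in> borel_measurable borel"
          using trunc_integrable[OF N order_refl, of z k] measurable_cong_sets[OF K_sets[OF order_refl] refl] by blast
        then show ?thesis using trunc_bounds(3)[OF N, of k z] by (simp add: K_0 integral_return)
      qed
      ultimately show ?thesis by linarith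
    qed
    have S: "real (Suc m) > 0" for m by simp
    show ?thesis
      using integral_le_of_pointwise_limit[OF trunc_integrable[OF S t] trunc_bounds(1)[OF S] le[OF S] tendsto_const trunc_tendsto]
      by blast
  qed
  show ?thesis by (rule that[OF C(1)]) (use * in blast)+
qed

text \<open>Truncation spoils the exact balance between the weight exp(t) and the drift inequality,
  with a defect of at most V^2 / N. Since V^2 is again a Lyapunov function,
  \<open>lyap_growth\<close> bounds the integrated defect by a constant over N, which disappears in
  the limit.\<close>

theorem lyap_contraction:
  obtains C where "C > 0"
    "\<And>t z. 0 \<le> t \<Longrightarrow> integrable (K t z) (lyap (1 / (2 * \<sigma>\<^sup>2)))"
    "\<And>t z. 0 \<le> t \<Longrightarrow> (\<integral>w. lyap (1 / (2 * \<sigma>\<^sup>2)) w \<partial>K t z) \<le> exp (- t) * lyap (1 / (2 * \<sigma>\<^sup>2)) z + C"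
proof -
  let ?k = "1 / (2 * \<sigma>\<^sup>2)" and ?k2 = "1 / \<sigma>\<^sup>2"
  have s2: "\<sigma>\<^sup>2 > 0" using \<sigma>_pos by simp
  have k: "0 < ?k" "?k < 2 / \<sigma>\<^sup>2" and k2: "0 < ?k2" "?k2 < 2 / \<sigma>\<^sup>2" using s2 by (auto simp: field_simps)
  obtain C where C: "C \<ge> 0" "\<And>w. lyap ?k w * lyap_rate ?k w \<le> C - lyap ?k w" by (rule lyap_drift[OF k]) blast
  obtain C2 where C2: "C2 \<ge> 0" "\<And>t z. 0 \<le> t \<Longrightarrow> integrable (K t z) (lyap ?k2)"
    "\<And>t z. 0 \<le> t \<Longrightarrow> (\<integral>w. lyap ?k2 w \<partial>K t z) \<le> lyap ?k2 z + C2 * t" by (rule lyap_growth[OF k2]) blast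
  have sq: "(lyap ?k w)\<^sup>2 = lyap ?k2 w" for w
    by (simp add: lyap_def power2_eq_square flip: exp_add)
  have *: "integrable (K t z) (lyap ?k) \<and> (\<integral>w. lyap ?k w \<partial>K t z) \<le> exp (- t) * lyap ?k z + C" if t: "0 \<le> t" for t z
  proof -
    define D where "D = lyap ?k2 z + C2 * t"
    have D: "D \<ge> 0" using C2(1) t lyap_pos[of ?k2 z] by (simp add: D_def)
    have le: "(\<integral>w. trunc ?k N w \<partial>K t z) \<le> exp (- t) * lyap ?k z + C + t * D * inverse N" if N: "N > 0" for N
    proof -
      define G where "G s w = exp (1 * s) * (1 * trunc ?k N w - N\<^sup>2 * L (\<lambda>w. inverse (N + lyap ?k w)) w)" for s w
      have G: "G s w \<le> exp s * (C + lyap ?k2 w / N)" for s w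
      \<comment> \<open>The defect is N V^2 / (N + V)^2, the difference between the truncation and
        the dissipation that survives in \<open>gen_trunc_le\<close>.\<close>
      proof -
        define V where "V = lyap ?k w"
        have V: "V > 0" by (simp add: V_def lyap_pos)
        have "trunc ?k N w - N\<^sup>2 * V / (N + V)\<^sup>2 = N * V\<^sup>2 / (N + V)\<^sup>2"
        proof -
          have "N * V / (N + V) = N * V * (N + V) / (N + V)\<^sup>2" using N V by (simp add: power2_eq_square)
          then have "trunc ?k N w - N\<^sup>2 * V / (N + V)\<^sup>2 = (N * V * (N + V) - N\<^sup>2 * V) / (N + V)\<^sup>2"
            unfolding trunc_eq[OF N] V_def[symmetric] by (simp only: diff_divide_distrib)
          also have "N * V * (N + V) - N\<^sup>2 * V = N * V\<^sup>2" by (simp add: algebra_simps power2_eq_square)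
          finally show ?thesis .
        qed
        also have "\<dots> \<le> V\<^sup>2 / N"
        proof -
          have "N * N \<le> (N + V)\<^sup>2" unfolding power2_eq_square using N V by (intro mult_mono) auto
          then have "V\<^sup>2 * (N * N) \<le> V\<^sup>2 * (N + V)\<^sup>2" by (intro mult_left_mono) auto
          then show ?thesis using N V by (simp add: divide_simps mult_ac)
        qed
        finally have "1 * trunc ?k N w - N\<^sup>2 * L (\<lambda>w. inverse (N + lyap ?k w)) w \<le> C + lyap ?k2 w / N"
          using gen_trunc_le[OF N C(2) C(1), of w] unfolding V_def sq by linarith
        then show ?thesis unfolding G_def by simp
      qed
      have "((\<lambda>s. \<integral>w. G s w \<partial>K s z) has_integral
          ((\<integral>w. exp (1 * t) * trunc ?k N w \<partial>K t z) - (\<integral>w. exp (1 * 0) * trunc ?k N w \<partial>K 0 z))) {0..t}"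
        using obs_has_integral[OF K_evol t obs_trunc[OF N k(1), of t 1], of z] unfolding G_def .
      moreover have "((\<lambda>s. exp s * C + exp t * (D / N)) has_integral (exp t * C - exp 0 * C) + exp t * (D / N) * t) {0..t}"
      proof (rule has_integral_add)
        show "((\<lambda>s. exp s * C) has_integral (exp t * C - exp 0 * C)) {0..t}"
          by (rule fundamental_theorem_of_calculus[OF t])
            (auto intro!: derivative_eq_intros simp: has_real_derivative_iff_has_vector_derivative[symmetric])
        show "((\<lambda>s. exp t * (D / N)) has_integral exp t * (D / N) * t) {0..t}"
          using has_integral_const_real[of "exp t * (D / N)" 0 t] t by (simp add: mult.commute)
      qed
      ultimately have "(\<integral>w. exp (1 * t) * trunc ?k N w \<partial>K t z) - (\<integral>w. exp (1 * 0) * trunc ?k N w \<partial>K 0 z)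
          \<le> (exp t * C - exp 0 * C) + exp t * (D / N) * t"
      proof (rule has_integral_le)
        fix s assume s: "s \<in> {0..t}"
        then have s0: "0 \<le> s" by simp
        interpret prob_space "K s z" by (rule K_prob[OF s0])
        have i: "integrable (K s z) (\<lambda>w. exp s * (C + lyap ?k2 w / N))" using C2(2)[OF s0] by simp
        have le0: "0 \<le> exp s * (C + lyap ?k2 w / N)" for w using C(1) lyap_pos[of ?k2 w] N by simp
        have "(\<integral>w. G s w \<partial>K s z) \<le> (\<integral>w. exp s * (C + lyap ?k2 w / N) \<partial>K s z)"
        proof (cases "integrable (K s z) (G s)")
          case True
          then show ?thesis using i G by (intro integral_mono)
        next
          case False
          then show ?thesis using le0 by (simp add: not_integrable_integral_eq del: integral_mult_right_zero)
        qed
        also have "\<dots> = exp s * (C + (\<integral>w. lyap ?k2 w \<partial>K s z) / N)" using C2(2)[OF s0] by (simp add: prob_space)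
        also have "\<dots> \<le> exp s * C + exp t * (D / N)"
        proof -
          have "(\<integral>w. lyap ?k2 w \<partial>K s z) \<le> D"
            using C2(3)[OF s0, of z] mult_left_mono[OF _ C2(1), of s t] s by (simp add: D_def)
          moreover have "0 \<le> (\<integral>w. lyap ?k2 w \<partial>K s z)"
            by (intro Bochner_Integration.integral_nonneg less_imp_le lyap_pos)
          ultimately have "exp s * ((\<integral>w. lyap ?k2 w \<partial>K s z) / N) \<le> exp t * (D / N)"
            using s N D by (intro mult_mono divide_right_mono) auto
          then show ?thesis by (simp add: distrib_left)
        qed
        finally show "(\<integral>w. G s w \<partial>K s z) \<le> exp s * C + exp t * (D / N)" .
      qed
      moreover have "(\<integral>w. exp (1 * 0) * trunc ?k N w \<partial>K 0 z) \<le> lyap ?k z"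
      proof -
        have "trunc ?k N \<in> borel_measurable borel"
          using trunc_integrable[OF N order_refl, of z ?k] measurable_cong_sets[OF K_sets[OF order_refl] refl] by blast
        then show ?thesis using trunc_bounds(3)[OF N, of ?k z] by (simp add: K_0 integral_return)
      qed
      ultimately have "exp t * (\<integral>w. trunc ?k N w \<partial>K t z) \<le> lyap ?k z + exp t * C + exp t * (D / N) * t"
        using C(1) by simp
      then have "exp (- t) * (exp t * (\<integral>w. trunc ?k N w \<partial>K t z)) \<le> exp (- t) * (lyap ?k z + exp t * C + exp t * (D / N) * t)"
        by (intro mult_left_mono) auto
      moreover have "exp (- t) * (lyap ?k z + exp t * C + exp t * (D / N) * t) = exp (- t) * lyap ?k z + C + t * D * inverse N"
        by (simp add: exp_minus field_simps)
      ultimately show ?thesis by (simp add: mult.assoc[symmetric] flip: exp_add)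
    qed
    have S: "real (Suc m) > 0" for m by simp
    have lim: "(\<lambda>m. exp (- t) * lyap ?k z + C + t * D * inverse (real (Suc m))) \<longlonglongrightarrow> exp (- t) * lyap ?k z + C + t * D * 0"
      by (intro tendsto_add tendsto_mult tendsto_const LIMSEQ_inverse_real_of_nat)
    show ?thesis
      using integral_le_of_pointwise_limit[OF trunc_integrable[OF S t] trunc_bounds(1)[OF S] le[OF S] lim trunc_tendsto]
      by simp
  qed
  show ?thesis
  proof (rule that[of "C + 1"])
    show "C + 1 > 0" using C(1) by simp
    show "integrable (K t z) (lyap ?k)" if "0 \<le> t" for t z using *[OF that] by blast
    show "(\<integral>w. lyap ?k w \<partial>K t z) \<le> exp (- t) * lyap ?k z + (C + 1)" if "0 \<le> t" for t z
      using *[OF that, of z] by linarith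
  qed
qed

end

section \<open>Overlap of transition probabilities\<close>

text \<open>Removing integer parts moves the point into the unit cube, and the l1 norm bounds the
  Euclidean norm by the dimension. This is how compactness of the torus enters.\<close>

lemma int_vec_shift_bounded:
  fixes x :: "real ^ 'n::finite"
  obtains k where "int_vec k" "norm (x + k) \<le> CARD('n)"
proof -
  define k :: "real ^ 'n" where "k = (\<chi> i. - of_int \<lfloor>x $ i\<rfloor>)"
  have b: "0 \<le> (x + k) $ i" "(x + k) $ i \<le> 1" for i
    by (simp_all add: k_def) linarith+
  have "norm (x + k) \<le> (\<Sum>i\<in>UNIV. \<bar>(x + k) $ i\<bar>)" by (rule norm_le_l1_cart)
  also have "\<dots> \<le> (\<Sum>i\<in>(UNIV :: 'n set). 1)" using b by (intro sum_mono) (auto simp: abs_le_iff intro: order_trans)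
  finally have "norm (x + k) \<le> CARD('n)" by simp
  moreover have "int_vec k" by (simp add: int_vec_def k_def)
  ultimately show ?thesis using that by blast
qed

context kinetic_diffusion begin

text \<open>Let a be the Gaussian expectation of f from \<open>z\<close> and b that of 1 - f from
  \<open>z'\<close>. The common lower bound of the densities gives a + b at least c m. Squaring and
  the comparison inequality turn this into a lower bound for the \<open>K\<close>-integrals of f^2
  and (1 - f)^2, hence of f and 1 - f.\<close>

lemma K_overlap:
  assumes T: "T > 2 * \<tau>"
  shows "\<exists>\<alpha>>0::real. \<alpha> \<le> 1 \<and> (\<forall>f\<in>borel_measurable borel. periodic_x f \<longrightarrow> (\<forall>w. 0 \<le> f w \<and> f w \<le> 1) \<longrightarrow>
     (\<forall>z z'. norm (snd z) \<le> \<rho> \<longrightarrow> norm (snd z') \<le> \<rho> \<longrightarrow>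
       \<alpha> - 1 \<le> (\<integral>w. f w \<partial>K T z) - (\<integral>w. f w \<partial>K T z')))"
proof -
  have T0: "0 \<le> T" using T \<tau>_pos by simp
  \<comment> \<open>Velocities are bounded by assumption, positions after an integer shift;
    periodicity of f makes the shift harmless.\<close>
  define R where "R = max \<rho> (real CARD('n))"
  obtain c where c: "c > 0" and lower: "\<And>z (f :: 'n state \<Rightarrow> ennreal). norm (fst z) \<le> R \<Longrightarrow> norm (snd z) \<le> R \<Longrightarrow>
      f \<in> borel_measurable borel \<Longrightarrow>
      ennreal c * (\<integral>\<^sup>+w. indicator (cball 0 1 \<times> cball 0 1) w * f w \<partial>lborel) \<le> (\<integral>\<^sup>+w. f w \<partial>ou_law T z)"
    by (rule ou_law_lower[OF T, of R]) blast
  let ?D = "cball 0 1 \<times> cball 0 1 :: 'n state set"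
  have Dm: "?D \<in> sets lborel" by (auto intro!: borel_closed closed_Times)
  define m where "m = measure lborel ?D"
  have emb: "emeasure lborel ?D = ennreal m" and m: "m > 0"
  proof -
    have "emeasure lborel ?D = emeasure lborel (cball (0::real^'n) 1) * emeasure lborel (cball (0::real^'n) 1)"
      unfolding lborel_prod[symmetric] by (rule lborel.emeasure_pair_measure_Times) auto
    also have "emeasure lborel (cball (0::real^'n) 1) = ennreal (measure lborel (cball (0::real^'n) 1))"
      using emeasure_bounded_finite[OF bounded_cball, of "0::real^'n" 1]
      by (intro emeasure_eq_ennreal_measure) (simp add: less_top[symmetric])
    also have "ennreal (measure lborel (cball (0::real^'n) 1)) * ennreal (measure lborel (cball (0::real^'n) 1))
      = ennreal (measure lborel (cball (0::real^'n) 1) * measure lborel (cball (0::real^'n) 1))"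
      by (rule ennreal_mult[symmetric]) auto
    finally have eq: "emeasure lborel ?D = ennreal (measure lborel (cball (0::real^'n) 1) * measure lborel (cball (0::real^'n) 1))" .
    then have meq: "m = measure lborel (cball (0::real^'n) 1) * measure lborel (cball (0::real^'n) 1)"
      unfolding m_def measure_def by simp
    with eq show "emeasure lborel ?D = ennreal m" by simp
    have "measure lborel (cball (0::real^'n) 1) > 0" by (rule content_cball_pos) simp
    then show "m > 0" using meq by simp
  qed
  define E where "E = exp (B\<^sub>v\<^sup>2 / \<sigma>\<^sup>2 * T)"
  define \<alpha> where "\<alpha> = min 1 ((c * m)\<^sup>2 / (2 * E))"
  have main: "\<alpha> - 1 \<le> (\<integral>w. f w \<partial>K T z) - (\<integral>w. f w \<partial>K T z')"
    if f: "f \<in> borel_measurable borel" "\<And>w. 0 \<le> f w" "\<And>w. f w \<le> 1"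
      and z: "norm (fst z) \<le> R" "norm (snd z) \<le> R" "norm (fst z') \<le> R" "norm (snd z') \<le> R"
    for f :: "'n state \<Rightarrow> real" and z z'
  proof -
    let ?g = "\<lambda>w. 1 - f w"
    have fb: "\<bar>f w\<bar> \<le> 1" and gb: "\<bar>?g w\<bar> \<le> 1" for w using f(2,3)[of w] by auto
    have gm: "?g \<in> borel_measurable borel" using f(1) by auto
    have fm2: "(\<lambda>w. (f w)\<^sup>2) \<in> borel_measurable borel" "(\<lambda>w. (?g w)\<^sup>2) \<in> borel_measurable borel"
      using f(1) by auto
    have f2b: "\<bar>(f w)\<^sup>2\<bar> \<le> 1" and g2b: "\<bar>(?g w)\<^sup>2\<bar> \<le> 1" for w
      using abs_power2_le[OF fb] abs_power2_le[OF gb] by simp_all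
    define a where "a = (\<integral>w. f w \<partial>ou_law T z)"
    define b where "b = (\<integral>w. ?g w \<partial>ou_law T z')"
    have nn: "(\<integral>\<^sup>+w. ennreal (h w) \<partial>ou_law T z) = ennreal (\<integral>w. h w \<partial>ou_law T z)"
      if "h \<in> borel_measurable borel" "\<And>w. \<bar>h w\<bar> \<le> 1" "\<And>w. 0 \<le> h w" for h :: "'n state \<Rightarrow> real" and z
      by (rule nn_integral_eq_integral[OF prob_space_integrable_borel[OF prob_space_ou_law sets_ou_law that(1,2)]])
        (use that(3) in auto)
    have a0: "0 \<le> a" "0 \<le> b" unfolding a_def b_def using f(2,3) by (auto intro!: Bochner_Integration.integral_nonneg)
    have "ennreal (c * m) = ennreal c * (\<integral>\<^sup>+w. indicator ?D w \<partial>lborel)"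
      using c m Dm by (simp add: emb ennreal_mult)
    also have "(\<integral>\<^sup>+w. indicator ?D w \<partial>lborel) = (\<integral>\<^sup>+w. indicator ?D w * ennreal (f w) + indicator ?D w * ennreal (?g w) \<partial>lborel)"
    proof (rule nn_integral_cong)
      fix w
      have "ennreal (f w) + ennreal (?g w) = 1" using f(2,3)[of w] by (simp flip: ennreal_plus)
      then show "indicator ?D w = indicator ?D w * ennreal (f w) + indicator ?D w * ennreal (?g w)"
        by (simp add: distrib_left[symmetric])
    qed
    also have "\<dots> = (\<integral>\<^sup>+w. indicator ?D w * ennreal (f w) \<partial>lborel) + (\<integral>\<^sup>+w. indicator ?D w * ennreal (?g w) \<partial>lborel)"
      using Dm f(1) gm by (intro nn_integral_add) auto
    also have "ennreal c * \<dots> \<le> ennreal a + ennreal b"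
      unfolding distrib_left a_def b_def nn[OF f(1) fb f(2), symmetric] 
      using nn[OF gm gb, of z'] f lower[OF z(1,2), of "\<lambda>w. ennreal (f w)"] lower[OF z(3,4), of "\<lambda>w. ennreal (?g w)"]
      by (intro add_mono) auto
    also have "\<dots> = ennreal (a + b)" using a0 by simp
    finally have "ennreal (c * m) \<le> ennreal (a + b)" .
    then have ab: "c * m \<le> a + b" using a0 by (subst (asm) ennreal_le_iff) auto
    have "(c * m)\<^sup>2 \<le> (a + b)\<^sup>2" using ab c m by (intro power_mono) auto
    also have "\<dots> \<le> 2 * (a\<^sup>2 + b\<^sup>2)"
      using sum_squares_bound[of a b] by (simp add: power2_sum)
    also have "\<dots> \<le> 2 * (E * (\<integral>w. (f w)\<^sup>2 \<partial>K T z) + E * (\<integral>w. (?g w)\<^sup>2 \<partial>K T z'))"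
      using ou_law_le_evol[OF K_evol K_0 T f(1) fb, of z] ou_law_le_evol[OF K_evol K_0 T gm gb, of z']
      unfolding a_def b_def E_def by simp
    also have "\<dots> = 2 * E * ((\<integral>w. (f w)\<^sup>2 \<partial>K T z) + (\<integral>w. (?g w)\<^sup>2 \<partial>K T z'))" by (simp add: algebra_simps)
    finally have "(c * m)\<^sup>2 / (2 * E) \<le> (\<integral>w. (f w)\<^sup>2 \<partial>K T z) + (\<integral>w. (?g w)\<^sup>2 \<partial>K T z')"
      by (simp add: E_def divide_le_eq mult.commute)
    also have "\<dots> \<le> (\<integral>w. f w \<partial>K T z) + (\<integral>w. ?g w \<partial>K T z')"
    proof (rule add_mono; rule integral_mono)
      show "(f w)\<^sup>2 \<le> f w" "(?g w)\<^sup>2 \<le> ?g w" for w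
        unfolding power2_eq_square using f(2,3)[of w] by (auto intro: mult_left_le)
    qed (rule K_integrable[OF T0] f fb gm gb fm2 f2b g2b)+
    also have "(\<integral>w. ?g w \<partial>K T z') = 1 - (\<integral>w. f w \<partial>K T z')"
    proof -
      interpret prob_space "K T z'" by (rule K_prob[OF T0])
      show ?thesis using K_integrable[OF T0 f(1) fb, of z'] by (simp add: prob_space)
    qed
    finally show ?thesis by (simp add: \<alpha>_def)
  qed
  show ?thesis
  proof (intro exI[of _ \<alpha>] conjI ballI impI allI)
    show "0 < \<alpha>" "\<alpha> \<le> 1" using c m by (auto simp: \<alpha>_def E_def)
    fix f :: "'n state \<Rightarrow> real" and z z' :: "'n state"
    assume f: "f \<in> borel_measurable borel" "periodic_x f" and "\<forall>w. 0 \<le> f w \<and> f w \<le> 1"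
    then have f01: "0 \<le> f w" "f w \<le> 1" for w by blast+
    assume z: "norm (snd z) \<le> \<rho>" "norm (snd z') \<le> \<rho>"
    obtain x y where zz: "z = (x, y)" by (cases z)
    obtain x' y' where zz': "z' = (x', y')" by (cases z')
    obtain k where k: "int_vec k" "norm (x + k) \<le> CARD('n)" by (rule int_vec_shift_bounded[of x])
    obtain k' where k': "int_vec k'" "norm (x' + k') \<le> CARD('n)" by (rule int_vec_shift_bounded[of x'])
    have "\<alpha> - 1 \<le> (\<integral>w. f w \<partial>K T (x + k, y)) - (\<integral>w. f w \<partial>K T (x' + k', y'))"
      by (rule main[OF f(1) f01]) (use z k(2) k'(2) in \<open>auto simp: zz zz' R_def\<close>)
    then show "\<alpha> - 1 \<le> (\<integral>w. f w \<partial>K T z) - (\<integral>w. f w \<partial>K T z')"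
      using periodic_K_integral[OF f(1,2) T0] k(1) k'(1) unfolding periodic_x_def zz zz' by simp
  qed
qed

end

section \<open>Harris' theorem\<close>

context kinetic_diffusion begin

abbreviation V :: "'n state \<Rightarrow> real" where "V \<equiv> lyap (1 / (2 * \<sigma>\<^sup>2))"

lemma V_ge_1: "1 \<le> V w"
  using \<sigma>_pos by (simp add: lyap_def)

text \<open>Following Hairer and Mattingly, the oscillation of \<open>f\<close> is measured relative to \<open>2 + \<beta> V z + \<beta> V z'\<close>;
  after subtracting a constant, \<open>f\<close> is dominated by \<open>1 + \<beta> V\<close>.\<close>

theorem harris_contraction:
  obtains T \<beta> \<gamma> where "T > 0" "\<beta> > 0" "0 < \<gamma>" "\<gamma> < 1"
    "\<forall>f c B. f \<in> borel_measurable borel \<longrightarrow> (\<forall>w. \<bar>f w\<bar> \<le> B) \<longrightarrow> periodic_x f \<longrightarrow> c > 0 \<longrightarrow>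
      (\<forall>z z'. f z - f z' \<le> c * (2 + \<beta> * V z + \<beta> * V z')) \<longrightarrow>
      (\<forall>z z'. (\<integral>w. f w \<partial>K T z) - (\<integral>w. f w \<partial>K T z') \<le> \<gamma> * c * (2 + \<beta> * V z + \<beta> * V z'))"
proof -
  let ?k = "1 / (2 * \<sigma>\<^sup>2)"
  have k: "?k > 0" using \<sigma>_pos by simp
  define T where "T = 3 * \<tau>"
  have T: "T > 2 * \<tau>" "T > 0" "0 \<le> T" using \<tau>_pos by (auto simp: T_def)
  obtain C where C: "C > 0" and Vint: "\<And>t z. 0 \<le> t \<Longrightarrow> integrable (K t z) V"
    and PV: "\<And>t z. 0 \<le> t \<Longrightarrow> (\<integral>w. V w \<partial>K t z) \<le> exp (- t) * V z + C" by (rule lyap_contraction) blast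
  define g where "g = exp (- T)"
  have g: "0 < g" "g < 1" using T by (auto simp: g_def)
  \<comment> \<open>Beyond this level the additive constants of \<open>PV\<close> cost at most half
    of the contraction, leaving the factor \<open>h\<close> midway between \<open>g\<close> and
    1.\<close>
  define R where "R = 4 * C / (1 - g)"
  have R: "R > 0" using C g by (simp add: R_def)
  define h where "h = (1 + g) / 2"
  have h: "0 < h" "h < 1" using g by (auto simp: h_def)
  have gR: "g * S + 2 * C \<le> h * S" if "S \<ge> R" for S
  proof -
    have "4 * C \<le> S * (1 - g)" using that g by (simp add: R_def field_simps)
    then show ?thesis by (simp add: h_def field_simps)
  qed
  \<comment> \<open>By \<open>lyap_dominates\<close>, this radius contains every velocity at which
    \<open>V\<close> is at most \<open>R\<close>.\<close>
  obtain \<alpha> :: real where \<alpha>: "0 < \<alpha>" "\<alpha> \<le> 1" and overlap: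
    "\<forall>f\<in>borel_measurable borel. periodic_x f \<longrightarrow> (\<forall>w. 0 \<le> f w \<and> f w \<le> 1) \<longrightarrow>
     (\<forall>z z'. norm (snd z) \<le> (1 + 2 / ?k) * R \<longrightarrow> norm (snd z') \<le> (1 + 2 / ?k) * R \<longrightarrow>
       \<alpha> - 1 \<le> (\<integral>w. f w \<partial>K T z) - (\<integral>w. f w \<partial>K T z'))"
    using K_overlap[OF T(1), of "(1 + 2 / ?k) * R"] by blast
  \<comment> \<open>Near the origin the overlap gains 2 \<alpha> and the unbounded part loses 2
    \<beta> C = \<alpha>, so a net gain of \<alpha> remains.\<close>
  define \<beta> where "\<beta> = \<alpha> / (2 * C)"
  have \<beta>: "\<beta> > 0" "2 * \<beta> * C = \<alpha>" using \<alpha> C by (auto simp: \<beta>_def)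
  \<comment> \<open>The ratio of the new to the old weight at S = R; it decreases in S because
    \<open>h\<close> is below 1, so it covers all larger S.\<close>
  define \<gamma>1 where "\<gamma>1 = (2 + \<beta> * h * R) / (2 + \<beta> * R)"
  define \<gamma> where "\<gamma> = max (max (1 - \<alpha> / 2) g) \<gamma>1"
  have den: "2 + \<beta> * R > 0" using \<beta> R by (simp add: add_pos_pos)
  have "\<gamma>1 < 1"
  proof -
    have "\<beta> * R * h < \<beta> * R * 1" using h \<beta> R by (intro mult_strict_left_mono) auto
    then show ?thesis using den by (simp add: \<gamma>1_def divide_less_eq mult_ac)
  qed
  then have \<gamma>: "0 < \<gamma>" "\<gamma> < 1" "1 - \<alpha> / 2 \<le> \<gamma>" "g \<le> \<gamma>" "\<gamma>1 \<le> \<gamma>" using g \<alpha> by (auto simp: \<gamma>_def)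
  show ?thesis
  proof (rule that[of T \<beta> \<gamma>]; (intro allI impI)?)
    fix f :: "'n state \<Rightarrow> real" and c B :: real and z z' :: "'n state"
    assume fB: "\<forall>w. \<bar>f w\<bar> \<le> B" and oscillation: "\<forall>z z'. f z - f z' \<le> c * (2 + \<beta> * V z + \<beta> * V z')"
      and c: "c > 0" and "f \<in> borel_measurable borel" "periodic_x f"
    then have f: "f \<in> borel_measurable borel" "\<And>w. \<bar>f w\<bar> \<le> B" "periodic_x f"
      and osc: "\<And>z z'. f z - f z' \<le> c * (2 + \<beta> * V z + \<beta> * V z')" by blast+
    \<comment> \<open>The centre of f: the oscillation bound says that every f - c (1 + \<beta> V)
      lies below every f + c (1 + \<beta> V), so this infimum separates them and |f - m| is at most
      c (1 + \<beta> V).\<close>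
    define m where "m = (INF z. f z + c * (1 + \<beta> * V z))"
    have bdd: "bdd_below (range (\<lambda>z. f z + c * (1 + \<beta> * V z)))"
    proof (rule bdd_belowI2)
      fix w
      have "0 \<le> c * (1 + \<beta> * V w)" using c \<beta> lyap_pos[of ?k w] by simp
      then show "- B \<le> f w + c * (1 + \<beta> * V w)" using f(2)[of w] by (simp add: abs_le_iff)
    qed
    have m1: "m \<le> f w + c * (1 + \<beta> * V w)" for w unfolding m_def by (rule cINF_lower[OF bdd]) simp
    have m2: "f w - c * (1 + \<beta> * V w) \<le> m" for w
      unfolding m_def
    proof (rule cINF_greatest)
      fix w' show "f w - c * (1 + \<beta> * V w) \<le> f w' + c * (1 + \<beta> * V w')"
        using osc[of w w'] by (simp add: algebra_simps)
    qed simp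
    define F1 where "F1 w = max (- c) (min c (f w - m))" for w
    define F2 where "F2 w = f w - m - F1 w" for w
    have F1b: "\<bar>F1 w\<bar> \<le> c" for w using c by (auto simp: F1_def)
    have F2b: "\<bar>F2 w\<bar> \<le> c * \<beta> * V w" for w
    proof -
      have "\<bar>f w - m\<bar> \<le> c + c * \<beta> * V w" using m1[of w] m2[of w] by (simp add: abs_le_iff algebra_simps)
      \<comment> \<open>Clipping at height c splits f - m into a bounded part \<open>F1\<close>, to
        be treated by the overlap, and a rest \<open>F2\<close> dominated by c \<beta> V, to be
        treated by the Lyapunov bound.\<close>
      moreover have "0 \<le> c * \<beta> * V w" using c \<beta> lyap_pos[of ?k w] by simp
      ultimately show ?thesis using c unfolding F2_def F1_def by linarith
    qed
    have F1m: "F1 \<in> borel_measurable borel" unfolding F1_def[abs_def] using f(1) by auto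
    have F2m: "F2 \<in> borel_measurable borel" unfolding F2_def[abs_def] using f(1) F1m by auto
    have F2int: "integrable (K T z) F2" for z
    proof (rule Bochner_Integration.integrable_bound)
      show "integrable (K T z) (\<lambda>w. c * \<beta> * V w)" using Vint[OF T(3)] by simp
      show "F2 \<in> borel_measurable (K T z)" using F2m measurable_cong_sets[OF K_sets[OF T(3)] refl] by blast
      show "AE w in K T z. norm (F2 w) \<le> norm (c * \<beta> * V w)"
        using F2b by (intro AE_I2) (auto intro: order_trans[OF _ abs_ge_self])
    qed
    have F1int: "integrable (K T z) F1" for z by (rule K_integrable[OF T(3) F1m F1b])
    have split: "(\<integral>w. f w \<partial>K T z) = m + (\<integral>w. F1 w \<partial>K T z) + (\<integral>w. F2 w \<partial>K T z)" for z
    proof -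
      have "(\<integral>w. f w \<partial>K T z) = (\<integral>w. m + F1 w + F2 w \<partial>K T z)" by (simp add: F2_def)
      also have "\<dots> = m + (\<integral>w. F1 w \<partial>K T z) + (\<integral>w. F2 w \<partial>K T z)"
      proof -
        interpret prob_space "K T z" by (rule K_prob[OF T(3)])
        show ?thesis using F1int[of z] F2int[of z] by (simp add: prob_space)
      qed
      finally show ?thesis .
    qed
    have P2: "\<bar>\<integral>w. F2 w \<partial>K T z\<bar> \<le> c * \<beta> * (g * V z + C)" for z
    proof -
      have "\<bar>\<integral>w. F2 w \<partial>K T z\<bar> \<le> (\<integral>w. \<bar>F2 w\<bar> \<partial>K T z)" by (rule integral_abs_bound)
      also have "\<dots> \<le> (\<integral>w. c * \<beta> * V w \<partial>K T z)"
        using F2int Vint[OF T(3)] F2b by (intro integral_mono) auto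
      also have "\<dots> = c * \<beta> * (\<integral>w. V w \<partial>K T z)" by simp
      also have "\<dots> \<le> c * \<beta> * (g * V z + C)"
        using PV[OF T(3), of z] c \<beta> unfolding g_def by (intro mult_left_mono) auto
      finally show ?thesis .
    qed
    have P1: "\<bar>\<integral>w. F1 w \<partial>K T z\<bar> \<le> c" for z by (rule prob_space.integral_abs_le[OF K_prob[OF T(3)] F1b])
    define S where "S = V z + V z'"
    have S: "S \<ge> 0" unfolding S_def using V_ge_1[of z] V_ge_1[of z'] by linarith
    have P2': "(\<integral>w. F2 w \<partial>K T z) - (\<integral>w. F2 w \<partial>K T z') \<le> c * (\<beta> * (g * S + 2 * C))"
    proof -
      have "(\<integral>w. F2 w \<partial>K T z) - (\<integral>w. F2 w \<partial>K T z') \<le> c * \<beta> * (g * V z + C) + c * \<beta> * (g * V z' + C)"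
        using P2[of z] P2[of z'] by linarith
      also have "\<dots> = c * (\<beta> * (g * S + 2 * C))" by (simp add: S_def algebra_simps)
      finally show ?thesis .
    qed
    have goal: "(\<integral>w. f w \<partial>K T z) - (\<integral>w. f w \<partial>K T z') \<le> c * (\<gamma> * (2 + \<beta> * S))"
    proof (cases "S \<ge> R")
      case True
      have "(\<integral>w. f w \<partial>K T z) - (\<integral>w. f w \<partial>K T z') \<le> c * 2 + c * (\<beta> * (g * S + 2 * C))"
        unfolding split using P1[of z] P1[of z'] P2' by linarith
      also have "\<dots> \<le> c * 2 + c * (\<beta> * (h * S))"
        using gR[OF True] c \<beta> by (intro add_left_mono mult_left_mono) auto
      also have "\<dots> = c * (2 + \<beta> * h * S)" by (simp add: algebra_simps)
      also have "\<dots> \<le> c * (\<gamma> * (2 + \<beta> * S))"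
      proof (intro mult_left_mono)
        have "\<beta> * ((1 - h) * R) \<le> \<beta> * ((1 - h) * S)" using True h \<beta> by (intro mult_left_mono) auto
        then have "(2 + \<beta> * h * S) * (2 + \<beta> * R) \<le> (2 + \<beta> * h * R) * (2 + \<beta> * S)" by (simp add: algebra_simps)
        then have "2 + \<beta> * h * S \<le> \<gamma>1 * (2 + \<beta> * S)" using den by (simp add: \<gamma>1_def field_simps)
        also have "\<dots> \<le> \<gamma> * (2 + \<beta> * S)" using \<gamma> \<beta> S by (intro mult_right_mono) auto
        finally show "2 + \<beta> * h * S \<le> \<gamma> * (2 + \<beta> * S)" .
      qed (use c in simp)
      finally show ?thesis .
    next
      case False
      have small: "norm (snd w) \<le> (1 + 2 / ?k) * R" if "V w \<le> R" for w
      proof -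
        have "2 * norm (snd w) \<le> snd w \<bullet> snd w + 1"
          using sum_squares_bound[of "norm (snd w)" 1] by (simp add: dot_square_norm)
        then have "norm (snd w) \<le> 1 + snd w \<bullet> snd w" using inner_ge_zero[of "snd w"] by linarith
        also have "\<dots> \<le> (1 + 2 / ?k) * V w" by (rule lyap_dominates[OF k])
        also have "\<dots> \<le> (1 + 2 / ?k) * R" using that k by (intro mult_left_mono) auto
        finally show ?thesis .
      qed
      have Vz: "V z \<le> R" "V z' \<le> R" using False V_ge_1[of z] V_ge_1[of z'] unfolding S_def by linarith+
      \<comment> \<open>\<open>F1\<close> rescaled to values between 0 and 1. The overlap inequality
        is a lower bound, so it is used with \<open>z\<close> and \<open>z'\<close>
        exchanged.\<close>
      let ?u = "\<lambda>w. 1 / 2 + F1 w / (2 * c)"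
      have "\<alpha> - 1 \<le> (\<integral>w. ?u w \<partial>K T z') - (\<integral>w. ?u w \<partial>K T z)"
      proof (rule overlap[rule_format])
        show "?u \<in> borel_measurable borel" using F1m by auto
        show "periodic_x ?u" using f(3) by (simp add: periodic_x_def F1_def)
        show "0 \<le> ?u w \<and> ?u w \<le> 1" for w using F1b[of w] c by (simp add: field_simps abs_le_iff)
      qed (use small Vz in auto)
      also have "\<dots> = (\<integral>w. F1 w \<partial>K T z') / (2 * c) - (\<integral>w. F1 w \<partial>K T z) / (2 * c)"
      proof -
        have "(\<integral>w. ?u w \<partial>K T z) = 1 / 2 + (\<integral>w. F1 w \<partial>K T z) / (2 * c)" for z
        proof -
          interpret prob_space "K T z" by (rule K_prob[OF T(3)])
          show ?thesis using F1int[of z] by (simp add: prob_space)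
        qed
        then show ?thesis by simp
      qed
      finally have "(\<integral>w. F1 w \<partial>K T z) - (\<integral>w. F1 w \<partial>K T z') \<le> c * (2 - 2 * \<alpha>)"
        using c by (simp add: field_simps)
      then have "(\<integral>w. f w \<partial>K T z) - (\<integral>w. f w \<partial>K T z') \<le> c * (2 - 2 * \<alpha>) + c * (\<beta> * (g * S + 2 * C))"
        unfolding split using P2' by linarith
      also have "\<dots> = c * (2 - 2 * \<alpha> + \<beta> * g * S + 2 * \<beta> * C)" by (simp add: algebra_simps)
      also have "\<dots> = c * (2 * (1 - \<alpha> / 2) + g * (\<beta> * S))" unfolding \<beta>(2) by (simp add: algebra_simps)
      also have "\<dots> \<le> c * (2 * \<gamma> + \<gamma> * (\<beta> * S))"
        using \<gamma> \<beta> S c by (intro mult_left_mono add_mono mult_right_mono) auto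
      also have "\<dots> = c * (\<gamma> * (2 + \<beta> * S))" by (simp add: algebra_simps)
      finally show ?thesis .
    qed
    then show "(\<integral>w. f w \<partial>K T z) - (\<integral>w. f w \<partial>K T z') \<le> \<gamma> * c * (2 + \<beta> * V z + \<beta> * V z')"
      by (simp add: S_def algebra_simps)
  qed (use T \<beta> \<gamma> in auto)
qed

text \<open>Invariance is available for bounded functions only, so it is applied to truncations at
  time n. The contraction bounds them by the minimum of N and exp(-n) V + C, and dominated
  convergence in n removes V although its \<mu>-integrability is not yet known.\<close>

lemma invariant_lyap:
  assumes \<mu>: "invariant_prob K \<mu>"
    and C: "C > 0" and Vint: "\<And>t z. 0 \<le> t \<Longrightarrow> integrable (K t z) V"
    and PV: "\<And>t z. 0 \<le> t \<Longrightarrow> (\<integral>w. V w \<partial>K t z) \<le> exp (- t) * V z + C"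
  shows "integrable \<mu> V" "(\<integral>w. V w \<partial>\<mu>) \<le> C"
proof -
  let ?k = "1 / (2 * \<sigma>\<^sup>2)"
  have ps: "prob_space \<mu>" and sets: "sets \<mu> = sets borel" using \<mu> unfolding invariant_prob_def by blast+
  interpret prob_space \<mu> by fact
  have tm: "trunc ?k N \<in> borel_measurable borel" if "N > 0" for N
  proof -
    have "continuous_on UNIV (trunc ?k N)"
      unfolding trunc_def[abs_def] using lyap_recip(1)[OF that]
      by (intro continuous_intros smooth_fun_continuous)
    then show ?thesis by (rule borel_measurable_continuous_onI)
  qed
  have tb: "\<bar>trunc ?k N w\<bar> \<le> N" if "N > 0" for N w using trunc_bounds[OF that, of ?k w] by simp
  have ti: "integrable \<mu> (trunc ?k N)" if "N > 0" for N
    by (rule prob_space_integrable_borel[OF ps sets tm[OF that] tb[OF that]])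
  have le: "(\<integral>w. trunc ?k N w \<partial>\<mu>) \<le> C" if N: "N > 0" for N
  proof -
    let ?b = "\<lambda>n w. min N (exp (- real n) * V w + C)"
    have bb: "\<bar>?b n w\<bar> \<le> N" for n w
    proof -
      have "0 \<le> exp (- real n) * V w + C" using C lyap_pos[of ?k w] by (intro add_nonneg_nonneg mult_nonneg_nonneg) auto
      then show ?thesis using N by simp
    qed
    have bm: "?b n \<in> borel_measurable borel" for n using lyap_measurable[of ?k] by auto
    have step: "(\<integral>w. trunc ?k N w \<partial>\<mu>) \<le> (\<integral>w. ?b n w \<partial>\<mu>)" for n
    proof -
      have inv: "(\<integral>z. (\<integral>w. trunc ?k N w \<partial>K (real n) z) \<partial>\<mu>) = (\<integral>z. trunc ?k N z \<partial>\<mu>)"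
      proof -
        have "bounded (range (trunc ?k N))" using tb[OF N] by (auto simp: bounded_iff)
        moreover have "periodic_x (trunc ?k N)" by (simp add: periodic_x_def trunc_def lyap_def)
        ultimately show ?thesis using \<mu> tm[OF N] unfolding invariant_prob_def by auto
      qed
      have n0: "0 \<le> real n" by simp
      have "(\<integral>z. (\<integral>w. trunc ?k N w \<partial>K (real n) z) \<partial>\<mu>) \<le> (\<integral>w. ?b n w \<partial>\<mu>)"
      proof (rule integral_mono)
        show "integrable \<mu> (\<lambda>z. \<integral>w. trunc ?k N w \<partial>K (real n) z)"
          by (rule prob_space_integrable_borel[OF ps sets K_integral_measurable[OF n0 tm[OF N]]
                prob_space.integral_abs_le[OF K_prob[OF n0] tb[OF N]]])
        show "integrable \<mu> (?b n)" by (rule prob_space_integrable_borel[OF ps sets bm bb])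
        fix z
        interpret Kz: prob_space "K (real n) z" by (rule K_prob[OF n0])
        have "(\<integral>w. trunc ?k N w \<partial>K (real n) z) \<le> (\<integral>w. V w \<partial>K (real n) z)"
          by (intro integral_mono trunc_integrable N n0 Vint trunc_bounds)
        moreover have "(\<integral>w. trunc ?k N w \<partial>K (real n) z) \<le> N"
          using prob_space.integral_abs_le[OF K_prob[OF n0] tb[OF N], of z] by (simp add: abs_le_iff)
        ultimately show "(\<integral>w. trunc ?k N w \<partial>K (real n) z) \<le> ?b n z" using PV[OF n0, of z] by simp
      qed
      with inv show ?thesis by simp
    qed
    have "(\<lambda>n. \<integral>w. ?b n w \<partial>\<mu>) \<longlonglongrightarrow> (\<integral>w. min N (0 * V w + C) \<partial>\<mu>)"
    proof (rule integral_bounded_lim[OF ps sets bm bb])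
      have "(\<lambda>n. exp (- real n)) \<longlonglongrightarrow> 0"
        by (rule filterlim_compose[OF exp_at_bot]) (simp add: filterlim_uminus_at_top[symmetric] filterlim_real_sequentially)
      then show "(\<lambda>n. ?b n w) \<longlonglongrightarrow> min N (0 * V w + C)" for w by (intro tendsto_intros)
    qed
    then have "(\<integral>w. trunc ?k N w \<partial>\<mu>) \<le> (\<integral>w. min N (0 * V w + C) \<partial>\<mu>)"
      by (rule LIMSEQ_le_const) (use step in auto)
    also have "\<dots> \<le> C" by (simp add: prob_space)
    finally show ?thesis .
  qed
  have S: "real (Suc m) > 0" for m by simp
  show "integrable \<mu> V" "(\<integral>w. V w \<partial>\<mu>) \<le> C"
    by (rule integral_le_of_pointwise_limit[OF ti[OF S] trunc_bounds(1)[OF S] le[OF S] tendsto_const trunc_tendsto])+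
qed

text \<open>The contraction is iterated over multiples of \<open>T\<close>, and averaging the second
  starting point over \<mu> replaces it by the invariant integral. The constants depend on
  \<open>M\<close> but not on the bound \<open>B\<close>, which is what permits removing boundedness
  afterwards.\<close>

lemma exponential_ergodicity_bounded:
  assumes \<mu>: "invariant_prob K \<mu>" and M: "M > 0"
  obtains A \<delta> where "A > 0" "\<delta> > 0"
    "\<forall>\<psi> B t z. \<psi> \<in> borel_measurable borel \<longrightarrow> (\<forall>w. \<bar>\<psi> w\<bar> \<le> B) \<longrightarrow> periodic_x \<psi> \<longrightarrow> (\<forall>w. \<bar>\<psi> w\<bar> \<le> M * V w) \<longrightarrow> 0 \<le> t \<longrightarrow>
      (\<integral>w. \<psi> w \<partial>K t z) - (\<integral>w. \<psi> w \<partial>\<mu>) \<le> A * exp (- \<delta> * t) * V z"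
proof -
  have ps: "prob_space \<mu>" and sets: "sets \<mu> = sets borel" using \<mu> unfolding invariant_prob_def by blast+
  obtain C where C: "C > 0" and Vint: "\<And>t z. 0 \<le> t \<Longrightarrow> integrable (K t z) V"
    and PV: "\<And>t z. 0 \<le> t \<Longrightarrow> (\<integral>w. V w \<partial>K t z) \<le> exp (- t) * V z + C" by (rule lyap_contraction) blast
  note \<mu>V = invariant_lyap[OF \<mu> C Vint PV]
  obtain T \<beta> \<gamma> where T: "T > 0" and \<beta>: "\<beta> > 0" and \<gamma>: "0 < \<gamma>" "\<gamma> < 1" and contr:
    "\<forall>f c B. f \<in> borel_measurable borel \<longrightarrow> (\<forall>w. \<bar>f w\<bar> \<le> B) \<longrightarrow> periodic_x f \<longrightarrow> c > 0 \<longrightarrow>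
      (\<forall>z z'. f z - f z' \<le> c * (2 + \<beta> * V z + \<beta> * V z')) \<longrightarrow>
      (\<forall>z z'. (\<integral>w. f w \<partial>K T z) - (\<integral>w. f w \<partial>K T z') \<le> \<gamma> * c * (2 + \<beta> * V z + \<beta> * V z'))"
    by (rule harris_contraction)
  define \<delta> where "\<delta> = - ln \<gamma> / T"
  define A where "A = M / \<beta> * (2 + \<beta> + 2 * \<beta> * C) / \<gamma>"
  have A: "A > 0" using M \<beta> C \<gamma> by (auto simp: A_def intro!: divide_pos_pos mult_pos_pos add_pos_pos)
  have \<delta>: "\<delta> > 0" using \<gamma> T by (simp add: \<delta>_def divide_neg_pos ln_less_zero)
  have main: "(\<integral>w. \<psi> w \<partial>K t z) - (\<integral>w. \<psi> w \<partial>\<mu>) \<le> A * exp (- \<delta> * t) * V z"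
    if \<psi>: "\<psi> \<in> borel_measurable borel" "\<And>w. \<bar>\<psi> w\<bar> \<le> B" "periodic_x \<psi>" "\<And>w. \<bar>\<psi> w\<bar> \<le> M * V w" and t: "0 \<le> t"
    for \<psi> B t z
  proof -
    define f where "f n z = (\<integral>w. \<psi> w \<partial>K (real n * T) z)" for n z
    have nT: "0 \<le> real n * T" for n using T by simp
    have fm: "f n \<in> borel_measurable borel" for n unfolding f_def[abs_def] by (rule K_integral_measurable[OF nT \<psi>(1)])
    have fb: "\<bar>f n w\<bar> \<le> B" for n w unfolding f_def by (rule prob_space.integral_abs_le[OF K_prob[OF nT] \<psi>(2)])
    have fp: "periodic_x (f n)" for n unfolding f_def[abs_def] by (rule periodic_K_integral[OF \<psi>(1,3) nT])
    have ck: "(\<integral>w. \<psi> w \<partial>K (s + real n * T) z) = (\<integral>w. f n w \<partial>K s z)" if "0 \<le> s" for s n z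
      unfolding f_def by (rule chapman_kolmogorov[OF that nT \<psi>(1,2)])
    \<comment> \<open>The factor M / \<beta> converts the bound M V on \<psi> into the form with
      weight \<beta> V at n = 0.\<close>
    have osc: "f n z - f n z' \<le> (M / \<beta> * \<gamma> ^ n) * (2 + \<beta> * V z + \<beta> * V z')" for n z z'
    proof (induction n arbitrary: z z')
      case 0
      have "f 0 w = \<psi> w" for w using \<psi>(1) by (simp add: f_def K_0 integral_return)
      then have "f 0 z - f 0 z' \<le> M * V z + M * V z'" using \<psi>(4)[of z] \<psi>(4)[of z'] by (simp add: abs_le_iff)
      also have "\<dots> = M / \<beta> * (\<beta> * V z + \<beta> * V z')" using \<beta> by (simp add: field_simps)
      also have "\<dots> \<le> M / \<beta> * (2 + \<beta> * V z + \<beta> * V z')" using M \<beta> by (intro mult_left_mono) auto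
      finally show ?case by simp
    next
      case (Suc n)
      have pos: "M / \<beta> * \<gamma> ^ n > 0" using M \<beta> \<gamma> by simp
      have "f (Suc n) w = (\<integral>x. f n x \<partial>K T w)" for w
        using ck[of T n w] T by (simp add: f_def algebra_simps)
      then show ?case using contr[rule_format, OF fm fb fp pos Suc, of z z'] by (simp add: mult_ac)
    qed
    have dist: "f n z - (\<integral>w. \<psi> w \<partial>\<mu>) \<le> (M / \<beta> * \<gamma> ^ n) * (2 + \<beta> * V z + \<beta> * C)" for n z
    proof -
      interpret prob_space \<mu> by fact
      have inv: "(\<integral>w. \<psi> w \<partial>\<mu>) = (\<integral>w. f n w \<partial>\<mu>)"
      proof -
        have "bounded (range \<psi>)" using \<psi>(2) by (auto simp: bounded_iff)
        then show ?thesis using \<mu> \<psi>(1,3) nT[of n] unfolding invariant_prob_def f_def by auto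
      qed
      have fi: "integrable \<mu> (f n)" by (rule prob_space_integrable_borel[OF ps sets fm fb])
      have "f n z - (\<integral>w. f n w \<partial>\<mu>) = (\<integral>w. f n z - f n w \<partial>\<mu>)" using fi by (simp add: prob_space)
      also have "\<dots> \<le> (\<integral>w. (M / \<beta> * \<gamma> ^ n) * (2 + \<beta> * V z + \<beta> * V w) \<partial>\<mu>)"
        by (rule integral_mono) (use fi \<mu>V(1) osc in auto)
      also have "\<dots> = (M / \<beta> * \<gamma> ^ n) * (2 + \<beta> * V z + \<beta> * (\<integral>w. V w \<partial>\<mu>))"
        using \<mu>V(1) by (simp add: prob_space)
      also have "\<dots> \<le> (M / \<beta> * \<gamma> ^ n) * (2 + \<beta> * V z + \<beta> * C)"
        using M \<beta> \<gamma> \<mu>V(2) by (intro mult_left_mono add_left_mono) auto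
      finally show ?thesis by (simp add: inv)
    qed
    define n where "n = nat \<lfloor>t / T\<rfloor>"
    \<comment> \<open>The leftover time runs first: \<open>f n\<close> is then integrated against
      \<open>K s z\<close>, where the Lyapunov bound controls its weight, and no estimate of \<psi>
      at intermediate times is needed.\<close>
    define s where "s = t - real n * T"
    have "real n = of_int \<lfloor>t / T\<rfloor>" using t T by (simp add: n_def)
    then have rn: "real n \<le> t / T" "t / T - 1 \<le> real n" by linarith+
    then have s: "0 \<le> s" using T by (simp add: s_def field_simps)
    interpret Ks: prob_space "K s z" by (rule K_prob[OF s])
    have fi: "integrable (K s z) (f n)" by (rule K_integrable[OF s fm fb])
    have "s + real n * T = t" by (simp add: s_def)
    with ck[OF s, of n z] have "(\<integral>w. \<psi> w \<partial>K t z) = (\<integral>w. f n w \<partial>K s z)" by simp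
    then have "(\<integral>w. \<psi> w \<partial>K t z) - (\<integral>w. \<psi> w \<partial>\<mu>) = (\<integral>w. f n w - (\<integral>w. \<psi> w \<partial>\<mu>) \<partial>K s z)"
      using fi by (simp add: Ks.prob_space)
    also have "\<dots> \<le> (\<integral>w. (M / \<beta> * \<gamma> ^ n) * (2 + \<beta> * V w + \<beta> * C) \<partial>K s z)"
      by (rule integral_mono) (use fi Vint[OF s] dist in auto)
    also have "\<dots> = (M / \<beta> * \<gamma> ^ n) * (2 + \<beta> * (\<integral>w. V w \<partial>K s z) + \<beta> * C)"
      using Vint[OF s] by (simp add: Ks.prob_space)
    also have "\<dots> \<le> (M / \<beta> * \<gamma> ^ n) * ((2 + \<beta> + 2 * \<beta> * C) * V z)"
    proof (intro mult_left_mono)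
      have "exp (- s) * V z \<le> 1 * V z" using s by (intro mult_right_mono less_imp_le[OF lyap_pos]) auto
      then have "(\<integral>w. V w \<partial>K s z) \<le> V z + C" using PV[OF s, of z] by linarith
      then have "\<beta> * (\<integral>w. V w \<partial>K s z) \<le> \<beta> * (V z + C)" using \<beta> by (intro mult_left_mono) auto
      moreover have "(2 + 2 * \<beta> * C) * 1 \<le> (2 + 2 * \<beta> * C) * V z" using \<beta> C V_ge_1 by (intro mult_left_mono) auto
      ultimately show "2 + \<beta> * (\<integral>w. V w \<partial>K s z) + \<beta> * C \<le> (2 + \<beta> + 2 * \<beta> * C) * V z"
        by (simp add: algebra_simps)
    qed (use M \<beta> \<gamma> in auto)
    also have "\<dots> = \<gamma> ^ n * (A * \<gamma> * V z)" using \<gamma> by (simp add: A_def)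
    \<comment> \<open>Rounding t / T down costs at most one factor 1 / \<gamma>, which is already
      included in \<open>A\<close>.\<close>
    also have "\<dots> \<le> (exp (- \<delta> * t) / \<gamma>) * (A * \<gamma> * V z)"
    proof (rule mult_right_mono)
      have "\<gamma> ^ n = exp (real n * ln \<gamma>)" using \<gamma> by (simp add: exp_of_nat_mult)
      also have "\<dots> \<le> exp ((t / T - 1) * ln \<gamma>)" using rn(2) \<gamma> by (simp add: mult_right_mono_neg)
      also have "(t / T - 1) * ln \<gamma> = - \<delta> * t - ln \<gamma>" using T by (simp add: \<delta>_def field_simps)
      also have "exp (- \<delta> * t - ln \<gamma>) = exp (- \<delta> * t) / \<gamma>" using \<gamma> by (simp add: exp_diff)
      finally show "\<gamma> ^ n \<le> exp (- \<delta> * t) / \<gamma>" .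
      show "0 \<le> A * \<gamma> * V z" using A \<gamma> by (intro mult_nonneg_nonneg less_imp_le[OF lyap_pos]) auto
    qed
    also have "\<dots> = A * exp (- \<delta> * t) * V z" using \<gamma> by simp
    finally show ?thesis .
  qed
  show ?thesis by (rule that[OF A \<delta>]) (use main in blast)
qed

text \<open>Clipping \<psi> at height m keeps periodicity and the bound M V, so the bounded case
  applies with constants independent of m. Integrability of \<open>V\<close> under the kernels and
  under \<mu> gives dominated convergence on both sides.\<close>

theorem exponential_ergodicity:
  assumes \<mu>: "invariant_prob K \<mu>" and M: "M > 0"
    and \<psi>: "\<psi> \<in> borel_measurable borel" "periodic_x \<psi>" "\<And>w. \<bar>\<psi> w\<bar> \<le> M * V w"
  obtains A \<delta> where "A > 0" "\<delta> > 0"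
    "\<And>t z. 0 \<le> t \<Longrightarrow> (\<integral>w. \<psi> w \<partial>K t z) - (\<integral>w. \<psi> w \<partial>\<mu>) \<le> A * exp (- \<delta> * t) * V z"
proof -
  obtain A \<delta> where A: "A > 0" "\<delta> > 0" and bd:
    "\<forall>\<psi> B t z. \<psi> \<in> borel_measurable borel \<longrightarrow> (\<forall>w. \<bar>\<psi> w\<bar> \<le> B) \<longrightarrow> periodic_x \<psi> \<longrightarrow> (\<forall>w. \<bar>\<psi> w\<bar> \<le> M * V w) \<longrightarrow> 0 \<le> t \<longrightarrow>
      (\<integral>w. \<psi> w \<partial>K t z) - (\<integral>w. \<psi> w \<partial>\<mu>) \<le> A * exp (- \<delta> * t) * V z"
    by (rule exponential_ergodicity_bounded[OF \<mu> M])
  have sets: "sets \<mu> = sets borel" using \<mu> unfolding invariant_prob_def by blast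
  obtain C where C: "C > 0" and Vint: "\<And>t z. 0 \<le> t \<Longrightarrow> integrable (K t z) V"
    and PV: "\<And>t z. 0 \<le> t \<Longrightarrow> (\<integral>w. V w \<partial>K t z) \<le> exp (- t) * V z + C" by (rule lyap_contraction) blast
  define F where "F m w = max (- real m) (min (real m) (\<psi> w))" for m w
  have Fm: "F m \<in> borel_measurable borel" for m unfolding F_def[abs_def] using \<psi>(1) by auto
  have Fb: "\<bar>F m w\<bar> \<le> real m" for m w by (auto simp: F_def)
  have FV: "\<bar>F m w\<bar> \<le> M * V w" for m w using \<psi>(3)[of w] by (auto simp: F_def)
  have Fp: "periodic_x (F m)" for m using \<psi>(2) by (simp add: periodic_x_def F_def)
  have Flim: "(\<lambda>m. F m w) \<longlonglongrightarrow> \<psi> w" for w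
  proof (rule tendsto_eventually)
    obtain N where "\<bar>\<psi> w\<bar> \<le> real N" using real_arch_simple by blast
    then have "F m w = \<psi> w" if "N \<le> m" for m using that by (auto simp: F_def)
    then show "\<forall>\<^sub>F m in sequentially. F m w = \<psi> w" using eventually_sequentially by blast
  qed
  have lim: "(\<lambda>m. \<integral>w. F m w \<partial>N) \<longlonglongrightarrow> (\<integral>w. \<psi> w \<partial>N)"
    if "sets N = sets borel" "integrable N V" for N
    by (rule integral_dominated_convergence[where w = "\<lambda>w. M * V w"])
      (use that \<psi>(1) Fm Flim FV measurable_cong_sets[OF that(1) refl, of borel] in auto)
  have "(\<integral>w. \<psi> w \<partial>K t z) - (\<integral>w. \<psi> w \<partial>\<mu>) \<le> A * exp (- \<delta> * t) * V z" if t: "0 \<le> t" for t z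
  proof (rule LIMSEQ_le_const2)
    show "(\<lambda>m. (\<integral>w. F m w \<partial>K t z) - (\<integral>w. F m w \<partial>\<mu>)) \<longlonglongrightarrow> (\<integral>w. \<psi> w \<partial>K t z) - (\<integral>w. \<psi> w \<partial>\<mu>)"
      by (intro tendsto_diff lim K_sets[OF t] sets Vint[OF t] invariant_lyap(1)[OF \<mu> C Vint PV])
    show "\<exists>N. \<forall>m\<ge>N. (\<integral>w. F m w \<partial>K t z) - (\<integral>w. F m w \<partial>\<mu>) \<le> A * exp (- \<delta> * t) * V z"
      using bd[rule_format, OF Fm Fb Fp FV t] by blast
  qed
  then show ?thesis by (rule that[OF A])
qed

end

lemma continuous_int_periodic_bounded:
  fixes v :: "real ^ 'n::finite \<Rightarrow> real ^ 'n"
  assumes "continuous_on UNIV v" "\<And>x k. int_vec k \<Longrightarrow> v (x + k) = v x"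
  obtains B where "B \<ge> 1" "\<And>x. norm (v x) \<le> B"
proof -
  have "bounded (v ` cball 0 (CARD('n)))"
    by (intro compact_imp_bounded compact_continuous_image continuous_on_subset[OF assms(1)]) auto
  then obtain B where B: "\<forall>x\<in>v ` cball 0 (CARD('n)). norm x \<le> B" unfolding bounded_iff by blast
  have "norm (v x) \<le> max 1 B" for x
  proof -
    obtain k where k: "int_vec k" "norm (x + k) \<le> CARD('n)" by (rule int_vec_shift_bounded[of x])
    then have "norm (v (x + k)) \<le> B" using B by auto
    then show ?thesis using assms(2)[OF k(1)] by simp
  qed
  then show ?thesis using that[of "max 1 B"] by auto
qed

theorem theorem3p5:
  fixes \<sigma> \<tau> :: real
    and v :: "real ^ 'n \<Rightarrow> real ^ 'n"
    and K :: "real \<Rightarrow> 'n state \<Rightarrow> 'n state measure"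
    and \<mu> :: "'n state measure"
    and \<psi> :: "'n state \<Rightarrow> real"
  assumes "\<sigma> > 0" and "\<tau> > 0"
    and "smooth_fun v" and "\<forall>x k. int_vec k \<longrightarrow> v (x + k) = v x"
    and "diffusion_law \<sigma> \<tau> v K"
    and "invariant_prob K \<mu>"
    and "\<psi> \<in> borel_measurable borel" and "periodic_x \<psi>"
    and "\<exists>M. \<forall>x y. \<bar>\<psi> (x, y) * exp (- (1/4) * (norm (y /\<^sub>R \<sigma>))\<^sup>2)\<bar> \<le> M"
  shows "\<exists>C \<delta>. C > 0 \<and> \<delta> > 0 \<and>
           (\<forall>x0 y0 t. 0 \<le> t \<longrightarrow>
              (\<integral>w. \<psi> w \<partial>K t (x0, y0)) - (\<integral>w. \<psi> w \<partial>\<mu>)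
                \<le> C * exp ((norm (y0 /\<^sub>R \<sigma>))\<^sup>2 - \<delta> * t))"
proof -
  have vc: "continuous_on UNIV v" using assms(3) by (rule smooth_fun_continuous)
  obtain B where B: "B \<ge> 1" "\<And>x. norm (v x) \<le> B"
    by (rule continuous_int_periodic_bounded[OF vc]) (use assms(4) in blast)+
  interpret kinetic_diffusion \<sigma> \<tau> B v K
    by unfold_locales (rule assms(1,2,5) vc B | rule assms(4)[rule_format], assumption)+
  \<comment> \<open>Identifies \<open>V\<close> with the reciprocal of the weight in the growth
    condition on \<psi>.\<close>
  have scaled: "1 / (2 * \<sigma>\<^sup>2) / 2 * (y \<bullet> y) = 1 / 4 * (norm (y /\<^sub>R \<sigma>))\<^sup>2" for y :: "real ^ 'n"
  proof -
    have "(norm (y /\<^sub>R \<sigma>))\<^sup>2 = inverse (\<sigma>\<^sup>2) * (norm y)\<^sup>2"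
      by (simp only: norm_scaleR power_mult_distrib power2_abs power_inverse)
    then show ?thesis by (simp only: dot_square_norm) (simp add: field_simps)
  qed
  obtain M where M: "\<And>x y. \<bar>\<psi> (x, y) * exp (- (1/4) * (norm (y /\<^sub>R \<sigma>))\<^sup>2)\<bar> \<le> M" using assms(9) by blast
  have M1: "max 1 M > 0" by simp
  have \<psi>M: "\<bar>\<psi> w\<bar> \<le> max 1 M * V w" for w
  proof -
    obtain x y where w: "w = (x, y)" by (cases w)
    define e where "e = exp (1 / 4 * (norm (y /\<^sub>R \<sigma>))\<^sup>2)"
    have e: "e > 0" "V w = e" "exp (- (1/4) * (norm (y /\<^sub>R \<sigma>))\<^sup>2) = inverse e"
      by (simp_all only: e_def w lyap_def snd_conv scaled exp_gt_zero mult_minus_left exp_minus)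
    have "\<bar>\<psi> w\<bar> * inverse e \<le> M" using M[of x y] e(1) unfolding e(3) w by (simp add: abs_mult)
    then have "\<bar>\<psi> w\<bar> \<le> M * e" using e(1) by (simp add: field_simps)
    also have "\<dots> \<le> max 1 M * e" using e(1) by (intro mult_right_mono) auto
    finally show ?thesis by (simp add: e(2))
  qed
  obtain A \<delta> where A: "A > 0" "\<delta> > 0"
    and le: "\<And>t z. 0 \<le> t \<Longrightarrow> (\<integral>w. \<psi> w \<partial>K t z) - (\<integral>w. \<psi> w \<partial>\<mu>) \<le> A * exp (- \<delta> * t) * V z"
    by (rule exponential_ergodicity[OF assms(6) M1 assms(7,8) \<psi>M]) blast
  have "(\<integral>w. \<psi> w \<partial>K t (x0, y0)) - (\<integral>w. \<psi> w \<partial>\<mu>) \<le> A * exp ((norm (y0 /\<^sub>R \<sigma>))\<^sup>2 - \<delta> * t)"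
    if t: "0 \<le> t" for x0 y0 t
  proof -
    have "A * exp (- \<delta> * t) * V (x0, y0) = A * exp (1 / 4 * (norm (y0 /\<^sub>R \<sigma>))\<^sup>2 - \<delta> * t)"
      unfolding lyap_def snd_conv scaled diff_conv_add_uminus exp_add minus_mult_left by (simp only: mult_ac)
    \<comment> \<open>The estimate obtained has exponent one quarter of the squared norm and is
      weakened to the stated one.\<close>
    also have "\<dots> \<le> A * exp ((norm (y0 /\<^sub>R \<sigma>))\<^sup>2 - \<delta> * t)" using A by simp
    finally show ?thesis using le[OF t, of "(x0, y0)"] by linarith
  qed
  with A show ?thesis by blast
qed

end
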